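(* Let $\mathbb{F}$ be a field, let $I$ be an infinite set, and let $\mathbf{A}=\otimes_{i\in I}A_i$, where all $A_i$ are finite-dimensional matrix algebras over $\mathbb{F}$. (1) Suppose that the set $I$ is countable. Then $$\mathrm{Der}(\mathbf{A})=\bigcup_{\mathcal{P}} D_{\mathcal{P}},$$ where the union is taken over all sparse systems $\mathcal{P}$ of nonempty finite subsets of $I$. (2) Let $I$ be an infinite (not necessarily countable) set, and let $\mathcal{P}$ be a sparse system of subsets of $I$. For each $i\in I$ let $A_i^0$ be a subspace of $A_i$ such that $A_i=\mathbb{F}\cdot 1_{A_i}\dotplus A_i^0$ is a direct sum, and let $E_i$ be a basis of $A_i^0$. Then the union of finite sets of operators $$\bigcup_{S\in\mathcal{P}}\mathrm{ad}_{\mathbf{A}}(E_S)$$ is a topological basis of $D_{\mathcal{P}}$.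
   Context: A matrix algebra is an algebra isomorphic to $M_n(\mathbb{F})$ for some $n\geq 1$. The (possibly infinite) tensor product $\mathbf{A}=\otimes_{i\in I}A_i$ of unital algebras over $\mathbb{F}$ is the direct limit of the finite tensor products $A_S:=A_{i_1}\otimes\cdots\otimes A_{i_r}$, $S=\{i_1,\dots,i_r\}\subset I$ finite, each regarded as a subalgebra of $\mathbf{A}$ (filling in units in the other positions). $\mathrm{Der}(\mathbf{A})$ is the Lie algebra of all $\mathbb{F}$-linear derivations of $\mathbf{A}$, and $\mathrm{ad}_{\mathbf{A}}(a):x\mapsto[a,x]=ax-xa$. A system $\mathcal{P}$ of nonempty finite subsets of $I$ is sparse if (i) for every $S\in\mathcal{P}$ all nonempty subsets of $S$ also lie in $\mathcal{P}$, and (ii) every element $i\in I$ lies in no more than finitely many subsets from $\mathcal{P}$. A sum $\sum_k f_k$ of linear operators $f_k:\mathbf{A}\to\mathbf{A}$ converges in the Tykhonoff topology if for every $a\in\mathbf{A}$ the set of indices $k$ with $f_k(a)\ne0$ is finite; its value is then the operator $a\mapsto\sum_k f_k(a)$. For a sparse system $\mathcal{P}$ and any choice of elements $a_S\in A_S$ $(S\in\mathcal{P})$, the sum $\sum_{S\in\mathcal{P}}\mathrm{ad}_{\mathbf{A}}(a_S)$ converges to a derivation of $\mathbf{A}$; $D_{\mathcal{P}}\subseteq\mathrm{Der}(\mathbf{A})$ denotes the vector space of all such sums. For $S=\{i_1,\dots,i_r\}$, $E_S:=\{a_1\otimes\cdots\otimes a_r\mid a_k\in E_{i_k},\ 1\le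 k\le r\}\subset A_S$, and $\mathrm{ad}_{\mathbf{A}}(E_S)=\{\mathrm{ad}_{\mathbf{A}}(e)\mid e\in E_S\}$. "Topological basis of $D_{\mathcal{P}}$" means: writing $\bigcup_{S\in\mathcal{P}}E_S=\{e_k\}_k$, every element of $D_{\mathcal{P}}$ can be represented as a converging (possibly infinite) sum $\sum_k\alpha_k\,\mathrm{ad}_{\mathbf{A}}(e_k)$ with $\alpha_k\in\mathbb{F}$, and this representation is unique, i.e. $\sum_k\alpha_k\,\mathrm{ad}_{\mathbf{A}}(e_k)=0$ implies $\alpha_k=0$ for all $k$. *)

theory Defs
  imports "Jordan_Normal_Form.VS_Connect" "HOL-Algebra.QuotRing" "HOL-Library.Countable_Set"
begin

section \<open>Matrix algebras\<close>

text \<open>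
  The ground field is a type \<open>'f\<close> of class \<open>field\<close>, seen as the structure \<open>class_ring\<close>.
  The locale \<open>algebra\<close> of HOL-Algebra requires commutativity, so (associative, unital, not
  necessarily commutative) algebras are introduced here, on the record type of modules, which also
  carries the ring operations.
\<close>

locale unital_algebra = vectorspace K A + ring A
  for K :: "('k, 'c) ring_scheme" and A :: "('k, 'a, 'd) module_scheme" (structure) +
  assumes smult_mult_left:
    "\<lbrakk>c \<in> carrier K; x \<in> carrier A; y \<in> carrier A\<rbrakk> \<Longrightarrow> (c \<odot> x) \<otimes> y = c \<odot> (x \<otimes> y)"
  and smult_mult_right:
    "\<lbrakk>c \<in> carrier K; x \<in> carrier A; y \<in> carrier A\<rbrakk> \<Longrightarrow> x \<otimes> (c \<odot> y) = c \<odot> (x \<otimes> y)"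

text \<open>The structure \<open>module_mat TYPE('f) n n\<close> comes with matrix product and identity matrix, so it is
  the full algebra of \<open>n \<times> n\<close> matrices.\<close>

definition matrix_algebra :: "('f::field, 'a) module \<Rightarrow> bool" where
  "matrix_algebra A \<longleftrightarrow> unital_algebra class_ring A \<and>
     (\<exists>n\<ge>1. \<exists>h \<in> ring_iso A (module_mat TYPE('f) n n).
        \<forall>c. \<forall>x\<in>carrier A. h (c \<odot>\<^bsub>A\<^esub> x) = c \<odot>\<^bsub>module_mat TYPE('f) n n\<^esub> h x)"

section \<open>Finite tensor products of algebras\<close>

text \<open>
  The tensor product of \<open>A i\<close>, \<open>i \<in> S\<close>, is the vector space with basis
  \<open>\<Pi>\<^sub>E i\<in>S. carrier (A i)\<close> modulo the span of the multilinearity relations. The product of two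
  basis vectors is the componentwise product; the span is an ideal, so the
  quotient inherits the multiplication.
\<close>

definition basis_vec :: "'p \<Rightarrow> 'p \<Rightarrow> 'f::field" where
  "basis_vec p = (\<lambda>q. if q = p then 1 else 0)"

definition free_tensor ::
  "('i \<Rightarrow> ('f::field, 'a) module) \<Rightarrow> 'i set \<Rightarrow> ('f, ('i \<Rightarrow> 'a) \<Rightarrow> 'f) module" where
  "free_tensor A S = \<lparr>
     carrier = {u. finite {p. u p \<noteq> 0} \<and> {p. u p \<noteq> 0} \<subseteq> (\<Pi>\<^sub>E i\<in>S. carrier (A i))},
     mult = (\<lambda>u v r. \<Sum>p | u p \<noteq> 0. \<Sum>q | v q \<noteq> 0.
               if (\<lambda>i\<in>S. p i \<otimes>\<^bsub>A i\<^esub> q i) = r then u p * v q else 0),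
     one = basis_vec (\<lambda>i\<in>S. \<one>\<^bsub>A i\<^esub>),
     zero = (\<lambda>p. 0),
     add = (\<lambda>u v p. u p + v p),
     smult = (\<lambda>c u p. c * u p)\<rparr>"

definition multilinear_rels ::
  "('i \<Rightarrow> ('f::field, 'a) module) \<Rightarrow> 'i set \<Rightarrow> (('i \<Rightarrow> 'a) \<Rightarrow> 'f) set" where
  "multilinear_rels A S =
     {\<lambda>r. basis_vec (p(i := x \<oplus>\<^bsub>A i\<^esub> y)) r - basis_vec (p(i := x)) r - basis_vec (p(i := y)) r
        | p i x y. p \<in> (\<Pi>\<^sub>E j\<in>S. carrier (A j)) \<and> i \<in> S \<and> x \<in> carrier (A i) \<and> y \<in> carrier (A i)} \<union>
     {\<lambda>r. basis_vec (p(i := c \<odot>\<^bsub>A i\<^esub> x)) r - c * basis_vec (p(i := x)) r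
        | p i c x. p \<in> (\<Pi>\<^sub>E j\<in>S. carrier (A j)) \<and> i \<in> S \<and> x \<in> carrier (A i)}"

definition tensor_ideal ::
  "('i \<Rightarrow> ('f::field, 'a) module) \<Rightarrow> 'i set \<Rightarrow> (('i \<Rightarrow> 'a) \<Rightarrow> 'f) set" where
  "tensor_ideal A S =
     LinearCombinations.module.span class_ring (free_tensor A S) (multilinear_rels A S)"

definition fin_tensor ::
  "('i \<Rightarrow> ('f::field, 'a) module) \<Rightarrow> 'i set \<Rightarrow> ('f, (('i \<Rightarrow> 'a) \<Rightarrow> 'f) set) module" where
  "fin_tensor A S = ring.extend (free_tensor A S Quot tensor_ideal A S)
     (module.fields (\<lambda>c X. \<Union>u\<in>X. tensor_ideal A S +>\<^bsub>free_tensor A S\<^esub> (c \<odot>\<^bsub>free_tensor A S\<^esub> u)))"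

definition pure_tensor ::
  "('i \<Rightarrow> ('f::field, 'a) module) \<Rightarrow> 'i set \<Rightarrow> ('i \<Rightarrow> 'a) \<Rightarrow> (('i \<Rightarrow> 'a) \<Rightarrow> 'f) set" where
  "pure_tensor A S p = tensor_ideal A S +>\<^bsub>free_tensor A S\<^esub> basis_vec p"

text \<open>The map from the tensor product over \<open>S\<close> to the one over \<open>T \<supseteq> S\<close> filling in units.\<close>

definition fill_units ::
  "('i \<Rightarrow> ('f::field, 'a) module) \<Rightarrow> 'i set \<Rightarrow> 'i set \<Rightarrow>
     (('i \<Rightarrow> 'a) \<Rightarrow> 'f) set \<Rightarrow> (('i \<Rightarrow> 'a) \<Rightarrow> 'f) set" where
  "fill_units A S T X = (\<Union>u\<in>X. tensor_ideal A T +>\<^bsub>free_tensor A T\<^esub>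
     (\<lambda>q. \<Sum>p | u p \<noteq> 0 \<and> (\<lambda>i\<in>T. if i \<in> S then p i else \<one>\<^bsub>A i\<^esub>) = q. u p))"

section \<open>Direct limits\<close>

text \<open>
  The direct limit of a system of algebras \<open>B S\<close> with transition maps \<open>f S T\<close> for \<open>S \<subseteq> T\<close>,
  where the family \<open>\<Lambda>\<close> of index sets is nonempty and closed under binary unions: pairs \<open>(S, x)\<close> with
  \<open>x \<in> B S\<close>, identified if they agree at a later stage.
\<close>

definition limit_rel ::
  "'i set set \<Rightarrow> ('i set \<Rightarrow> ('f, 'b) module) \<Rightarrow> ('i set \<Rightarrow> 'i set \<Rightarrow> 'b \<Rightarrow> 'b) \<Rightarrow>
     (('i set \<times> 'b) \<times> ('i set \<times> 'b)) set" where
  "limit_rel \<Lambda> B f = {((S, x), (T, y)). S \<in> \<Lambda> \<and> x \<in> carrier (B S) \<and> T \<in> \<Lambda> \<and> y \<in> carrier (B T) \<and>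
     (\<exists>U\<in>\<Lambda>. S \<subseteq> U \<and> T \<subseteq> U \<and> f S U x = f T U y)}"

definition limit_class ::
  "'i set set \<Rightarrow> ('i set \<Rightarrow> ('f, 'b) module) \<Rightarrow> ('i set \<Rightarrow> 'i set \<Rightarrow> 'b \<Rightarrow> 'b) \<Rightarrow>
     'i set \<Rightarrow> 'b \<Rightarrow> ('i set \<times> 'b) set" where
  "limit_class \<Lambda> B f S x = limit_rel \<Lambda> B f `` {(S, x)}"

definition direct_limit ::
  "'i set set \<Rightarrow> ('i set \<Rightarrow> ('f, 'b) module) \<Rightarrow> ('i set \<Rightarrow> 'i set \<Rightarrow> 'b \<Rightarrow> 'b) \<Rightarrow>
     ('f, ('i set \<times> 'b) set) module" where
  "direct_limit \<Lambda> B f = \<lparr>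
     carrier = (SIGMA S:\<Lambda>. carrier (B S)) // limit_rel \<Lambda> B f,
     mult = (\<lambda>X Y. \<Union>(S, x)\<in>X. \<Union>(T, y)\<in>Y.
               limit_class \<Lambda> B f (S \<union> T) (f S (S \<union> T) x \<otimes>\<^bsub>B (S \<union> T)\<^esub> f T (S \<union> T) y)),
     one = (\<Union>S\<in>\<Lambda>. limit_class \<Lambda> B f S \<one>\<^bsub>B S\<^esub>),
     zero = (\<Union>S\<in>\<Lambda>. limit_class \<Lambda> B f S \<zero>\<^bsub>B S\<^esub>),
     add = (\<lambda>X Y. \<Union>(S, x)\<in>X. \<Union>(T, y)\<in>Y.
               limit_class \<Lambda> B f (S \<union> T) (f S (S \<union> T) x \<oplus>\<^bsub>B (S \<union> T)\<^esub> f T (S \<union> T) y)),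
     smult = (\<lambda>c X. \<Union>(S, x)\<in>X. limit_class \<Lambda> B f S (c \<odot>\<^bsub>B S\<^esub> x))\<rparr>"

section \<open>The infinite tensor product\<close>

type_synonym ('i, 'f, 'a) tensor = "('i set \<times> (('i \<Rightarrow> 'a) \<Rightarrow> 'f) set) set"

definition finite_subsets :: "'i set \<Rightarrow> 'i set set" where
  "finite_subsets I = {S. S \<subseteq> I \<and> finite S}"

definition inf_tensor ::
  "('i \<Rightarrow> ('f::field, 'a) module) \<Rightarrow> 'i set \<Rightarrow> ('f, ('i, 'f, 'a) tensor) module" where
  "inf_tensor A I = direct_limit (finite_subsets I) (fin_tensor A) (fill_units A)"

definition tensor_incl ::
  "('i \<Rightarrow> ('f::field, 'a) module) \<Rightarrow> 'i set \<Rightarrow> 'i set \<Rightarrow> (('i \<Rightarrow> 'a) \<Rightarrow> 'f) set \<Rightarrow>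
     ('i, 'f, 'a) tensor" where
  "tensor_incl A I S = limit_class (finite_subsets I) (fin_tensor A) (fill_units A) S"

definition tensor_sub ::
  "('i \<Rightarrow> ('f::field, 'a) module) \<Rightarrow> 'i set \<Rightarrow> 'i set \<Rightarrow> ('i, 'f, 'a) tensor set" where
  "tensor_sub A I S = tensor_incl A I S ` carrier (fin_tensor A S)"

definition tensor_basis ::
  "('i \<Rightarrow> ('f::field, 'a) module) \<Rightarrow> 'i set \<Rightarrow> ('i \<Rightarrow> 'a set) \<Rightarrow> 'i set \<Rightarrow>
     ('i, 'f, 'a) tensor set" where
  "tensor_basis A I E S = {tensor_incl A I S (pure_tensor A S p) | p. p \<in> (\<Pi>\<^sub>E i\<in>S. E i)}"

section \<open>Derivations and converging sums of operators\<close>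

text \<open>Operators on an algebra are functions that are \<open>undefined\<close> outside its carrier, so that
  equality of operators is equality of functions.\<close>

definition Der :: "('f::field, 'b) module \<Rightarrow> ('b \<Rightarrow> 'b) set" where
  "Der A = {d \<in> extensional (carrier A). d \<in> LinearCombinations.module_hom class_ring A A \<and>
     (\<forall>x\<in>carrier A. \<forall>y\<in>carrier A. d (x \<otimes>\<^bsub>A\<^esub> y) = d x \<otimes>\<^bsub>A\<^esub> y \<oplus>\<^bsub>A\<^esub> x \<otimes>\<^bsub>A\<^esub> d y)}"

definition ad :: "('f::field, 'b) module \<Rightarrow> 'b \<Rightarrow> 'b \<Rightarrow> 'b" where
  "ad A a = (\<lambda>x\<in>carrier A. a \<otimes>\<^bsub>A\<^esub> x \<ominus>\<^bsub>A\<^esub> x \<otimes>\<^bsub>A\<^esub> a)"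

definition operator_sums ::
  "('f::field, 'b) module \<Rightarrow> 'k set \<Rightarrow> ('k \<Rightarrow> 'b \<Rightarrow> 'b) \<Rightarrow> ('b \<Rightarrow> 'b) \<Rightarrow> bool" where
  "operator_sums A K f g \<longleftrightarrow>
     (\<forall>x\<in>carrier A. finite {k \<in> K. f k x \<noteq> \<zero>\<^bsub>A\<^esub>}) \<and>
     g = (\<lambda>x\<in>carrier A. \<Oplus>\<^bsub>A\<^esub>k\<in>{k \<in> K. f k x \<noteq> \<zero>\<^bsub>A\<^esub>}. f k x)"

definition sparse_system :: "'i set \<Rightarrow> 'i set set \<Rightarrow> bool" where
  "sparse_system I P \<longleftrightarrow>
     (\<forall>S\<in>P. S \<noteq> {} \<and> finite S \<and> S \<subseteq> I) \<and>
     (\<forall>S\<in>P. \<forall>T. T \<noteq> {} \<and> T \<subseteq> S \<longrightarrow> T \<in> P) \<and>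
     (\<forall>i\<in>I. finite {S \<in> P. i \<in> S})"

definition sparse_derivations ::
  "('i \<Rightarrow> ('f::field, 'a) module) \<Rightarrow> 'i set \<Rightarrow> 'i set set \<Rightarrow>
     (('i, 'f, 'a) tensor \<Rightarrow> ('i, 'f, 'a) tensor) set" where
  "sparse_derivations A I P =
     {d. \<exists>a. (\<forall>S\<in>P. a S \<in> tensor_sub A I S) \<and>
             operator_sums (inf_tensor A I) P (\<lambda>S. ad (inf_tensor A I) (a S)) d}"

text \<open>The family \<open>{ad e}\<close>, indexed by the elements \<open>e\<close> of \<open>E\<close>, is a topological basis of \<open>D\<close>.\<close>

definition topological_basis_ad ::
  "('f::field, 'b) module \<Rightarrow> 'b set \<Rightarrow> ('b \<Rightarrow> 'b) set \<Rightarrow> bool" where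
  "topological_basis_ad A E D \<longleftrightarrow>
     (\<forall>d\<in>D. \<exists>\<alpha>. operator_sums A E (\<lambda>e. \<lambda>x\<in>carrier A. \<alpha> e \<odot>\<^bsub>A\<^esub> ad A e x) d) \<and>
     (\<forall>\<alpha>. operator_sums A E (\<lambda>e. \<lambda>x\<in>carrier A. \<alpha> e \<odot>\<^bsub>A\<^esub> ad A e x) (\<lambda>x\<in>carrier A. \<zero>\<^bsub>A\<^esub>)
        \<longrightarrow> (\<forall>e\<in>E. \<alpha> e = 0))"

definition direct_sum_decomp ::
  "('f::field, 'a) module \<Rightarrow> 'a set \<Rightarrow> 'a set \<Rightarrow> bool" where
  "direct_sum_decomp V U W \<longleftrightarrow>
     VectorSpace.subspace class_ring U V \<and> VectorSpace.subspace class_ring W V \<and>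
     LinearCombinations.module.submodule_sum V U W = carrier V \<and> U \<inter> W = {\<zero>\<^bsub>V\<^esub>}"

end

theory Submission
  imports Defs "HOL-Library.Function_Algebras"
begin

text \<open>
  The algebras are replaced by matrices. Choosing an isomorphism of each \<open>A i\<close> with the algebra of
  \<open>n i \<times> n i\<close> matrices, a pure tensor over a finite set \<open>S\<close> acts as a Kronecker product in the coordinates
  \<open>i \<in> S\<close> of indices \<open>x :: 'i \<Rightarrow> nat\<close> and as the identity in all other coordinates. This realizes all finite
  tensor products inside one ring of row-finite matrices, compatibly with the maps that fill in units,
  and their union \<open>Msp\<close> is isomorphic to the infinite tensor product. The point to prove is that no
  nonzero tensor is lost: the ideal of multilinear relations is the kernel of the evaluation in the model
  (\<open>tensor_ideal_kernel\<close>), because modulo the relations every tensor is a combination of tensors of matrix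
  units, which are linearly independent as matrices. Everything else takes place in this ring.

  Both parts of the theorem rest on one fact (\<open>centralizer_M\<close>): an element with support in \<open>S\<close> that commutes
  with the matrix units in the place \<open>i\<close> has support in \<open>S - {i}\<close>.

  For the first part, enumerate \<open>I\<close>. A derivation is inner on a single matrix algebra, so one may subtract
  inner derivations one after the other to make it vanish on the first place, the second place, and so on.
  The correction in the \<open>m\<close>-th step commutes with the matrix units in all earlier places, since the
  derivation already vanishes there; hence its support avoids the first \<open>m\<close> places. So each place lies in
  the supports of finitely many corrections only, the nonempty subsets of these supports form a sparse
  system, and the derivation is the sum of the corrections (\<open>derivation_decomposition\<close>, \<open>Der_sparse\<close>).
  Conversely, a sum over a sparse system is a finite sum of inner derivations on every finite tensor
  product, so it is a derivation (\<open>sparse_derivations_Der\<close>).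

  For the second part (\<open>topological_basis\<close>), the products of elements of the \<open>E i\<close> over the subsets of a
  finite set \<open>S\<close>, the empty product included, span the tensor product over \<open>S\<close>, which gives the existence
  of the representation after the coefficients have been collected. Uniqueness follows from the fact on
  centralizers: if a sum of multiples of the operators is zero, then the finite part of it that
  involves the place \<open>i\<close> commutes with the matrix units in this place, so \<open>i\<close> does not occur in it; a
  functional that picks out one product and kills all tensors with a unit in the place \<open>i\<close> then
  shows that the coefficient of this product is zero.
\<close>

lemma (in vector_space) span_image_coefficients:
  assumes "finite K" "r \<in> span (f ` K)"
  obtains c where "r = (\<Sum>k\<in>K. scale (c k) (f k))"
proof -
  have "\<exists>c. r = (\<Sum>k\<in>K. scale (c k) (f k))"
    using assms(2)
  proof (induction rule: span_induct_alt)
    case base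
    show ?case by (rule exI[of _ "\<lambda>_. 0"]) simp
  next
    case (step a x y)
    then obtain k c where k: "k \<in> K" "x = f k" and y: "y = (\<Sum>k\<in>K. scale (c k) (f k))" by auto
    have "(\<Sum>j\<in>K. scale (if j = k then a else 0) (f j)) = scale a x"
      using k assms(1) by (subst sum.remove[of _ k]) (auto intro!: sum.neutral)
    then have "scale a x + y = (\<Sum>j\<in>K. scale ((if j = k then a else 0) + c j) (f j))"
      unfolding scale_left_distrib sum.distrib y by simp
    then show ?case by (intro exI)
  qed
  then show ?thesis using that by blast
qed

section \<open>Row-finite matrices\<close>

text \<open>
  Finite rows make the product of two matrices with arbitrary index sets a finite sum. Making these
  matrices a type turns the ring laws into laws of a type class, which hold without any membership
  assumption.
\<close>

typedef (overloaded) ('x, 'f::zero) rfmat = "{a :: 'x \<Rightarrow> 'x \<Rightarrow> 'f. \<forall>x. finite {y. a x y \<noteq> 0}}"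
  morphisms entry rfmat
  by (rule exI[of _ "\<lambda>x y. 0"]) simp

setup_lifting type_definition_rfmat

lemma finite_row: "finite {y. entry a x y \<noteq> 0}"
  using entry[of a] by simp

lemma rfmat_eqI: "(\<And>x y. entry a x y = entry b x y) \<Longrightarrow> a = b"
  by (simp add: entry_inject[symmetric] fun_eq_iff)

lemma finite_support_combine:
  assumes "finite {y. f y \<noteq> 0}" "finite {y. g y \<noteq> 0}" "\<And>y. f y = 0 \<Longrightarrow> g y = 0 \<Longrightarrow> k y = 0"
  shows "finite {y. k y \<noteq> 0}"
  by (rule finite_subset[OF _ finite_UnI[OF assms(1,2)]]) (use assms(3) in blast)

lemma finite_row_sum:
  fixes f :: "'b \<Rightarrow> 'x \<Rightarrow> 'f::comm_monoid_add"
  assumes "finite B" and "\<And>z. z \<in> B \<Longrightarrow> finite {y. f z y \<noteq> 0}"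
  shows "finite {y. (\<Sum>z\<in>B. f z y) \<noteq> 0}"
proof (rule finite_subset)
  show "{y. (\<Sum>z\<in>B. f z y) \<noteq> 0} \<subseteq> (\<Union>z\<in>B. {y. f z y \<noteq> 0})"
    by (auto dest: sum.not_neutral_contains_not_neutral)
  show "finite (\<Union>z\<in>B. {y. f z y \<noteq> 0})"
    using assms by blast
qed

instantiation rfmat :: (type, field) ring_1
begin

lift_definition zero_rfmat :: "('a, 'b) rfmat" is "\<lambda>x y. 0" by simp
lift_definition one_rfmat :: "('a, 'b) rfmat" is "\<lambda>x y. if x = y then 1 else 0" by simp
lift_definition plus_rfmat :: "('a, 'b) rfmat \<Rightarrow> ('a, 'b) rfmat \<Rightarrow> ('a, 'b) rfmat"
  is "\<lambda>a b x y. a x y + b x y"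
  subgoal for a b x by (rule finite_support_combine[where f = "a x" and g = "b x"]) auto
  done
lift_definition uminus_rfmat :: "('a, 'b) rfmat \<Rightarrow> ('a, 'b) rfmat" is "\<lambda>a x y. - a x y" by simp
lift_definition minus_rfmat :: "('a, 'b) rfmat \<Rightarrow> ('a, 'b) rfmat \<Rightarrow> ('a, 'b) rfmat"
  is "\<lambda>a b x y. a x y - b x y"
  subgoal for a b x by (rule finite_support_combine[where f = "a x" and g = "b x"]) auto
  done
lift_definition times_rfmat :: "('a, 'b) rfmat \<Rightarrow> ('a, 'b) rfmat \<Rightarrow> ('a, 'b) rfmat"
  is "\<lambda>a b x y. \<Sum>z | a x z \<noteq> 0. a x z * b z y"
  by (rule finite_row_sum) auto

text \<open>
  The sum that defines a product runs over the support of a row, which depends on the left factor.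
  Comparing two products needs one common finite range of summation.
\<close>

lemma entry_mult_superset:
  fixes a b :: "('a, 'b::field) rfmat"
  assumes "finite Z" and "{z. entry a x z \<noteq> 0} \<subseteq> Z"
  shows "entry (a * b) x y = (\<Sum>z\<in>Z. entry a x z * entry b z y)"
  unfolding times_rfmat.rep_eq using assms by (intro sum.mono_neutral_left) auto

instance
proof
  fix a b c :: "('a, 'b::field) rfmat"
  show "a + b + c = a + (b + c)" "a + b = b + a" "0 + a = a" "- a + a = 0" "a - b = a + - b"
    by (rule rfmat_eqI; simp add: plus_rfmat.rep_eq zero_rfmat.rep_eq uminus_rfmat.rep_eq
        minus_rfmat.rep_eq)+
  show "1 * a = a"
    by (rule rfmat_eqI) (simp add: times_rfmat.rep_eq one_rfmat.rep_eq)
  show "a * 1 = a"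
  proof (rule rfmat_eqI)
    fix x y
    have "entry (a * 1) x y = (\<Sum>z | entry a x z \<noteq> 0. if z = y then entry a x z else 0)"
      unfolding times_rfmat.rep_eq one_rfmat.rep_eq by (intro sum.cong) auto
    then show "entry (a * 1) x y = entry a x y"
      by (simp add: finite_row)
  qed
  show "(a + b) * c = a * c + b * c"
  proof (rule rfmat_eqI)
    fix x y
    let ?Z = "{z. entry a x z \<noteq> 0} \<union> {z. entry b x z \<noteq> 0}"
    have "finite ?Z" by (simp add: finite_row)
    then show "entry ((a + b) * c) x y = entry (a * c + b * c) x y"
      by (subst entry_mult_superset[where Z = ?Z])
        (auto simp: plus_rfmat.rep_eq distrib_right sum.distrib entry_mult_superset[where Z = ?Z])
  qed
  show "a * (b + c) = a * b + a * c"
    by (rule rfmat_eqI) (simp add: times_rfmat.rep_eq plus_rfmat.rep_eq distrib_left sum.distrib)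
  show "a * b * c = a * (b * c)"
  proof (rule rfmat_eqI)
    fix x y
    let ?W = "{w. entry a x w \<noteq> 0}"
    let ?Z = "\<Union>w\<in>?W. {z. entry b w z \<noteq> 0}"
    have fin: "finite ?Z" "finite ?W" by (simp_all add: finite_row)
    have sub: "{z. entry (a * b) x z \<noteq> 0} \<subseteq> ?Z"
    proof
      fix z assume "z \<in> {z. entry (a * b) x z \<noteq> 0}"
      then have "(\<Sum>w\<in>?W. entry a x w * entry b w z) \<noteq> 0"
        by (simp add: times_rfmat.rep_eq)
      then obtain w where "w \<in> ?W" "entry a x w * entry b w z \<noteq> 0"
        by (rule sum.not_neutral_contains_not_neutral)
      then show "z \<in> ?Z" by auto
    qed
    have "entry (a * b * c) x y = (\<Sum>z\<in>?Z. (\<Sum>w\<in>?W. entry a x w * entry b w z) * entry c z y)"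
      by (subst entry_mult_superset[OF fin(1) sub]) (simp add: times_rfmat.rep_eq)
    also have "\<dots> = (\<Sum>w\<in>?W. entry a x w * (\<Sum>z\<in>?Z. entry b w z * entry c z y))"
      unfolding sum_distrib_right sum_distrib_left by (subst sum.swap) (simp add: mult.assoc)
    also have "\<dots> = (\<Sum>w\<in>?W. entry a x w * entry (b * c) w y)"
      by (intro sum.cong refl arg_cong2[where f = "(*)"] entry_mult_superset[symmetric])
        (use fin in auto)
    finally show "entry (a * b * c) x y = entry (a * (b * c)) x y"
      by (simp add: times_rfmat.rep_eq)
  qed
  show "(0 :: ('a, 'b) rfmat) \<noteq> 1"
  proof
    assume "(0 :: ('a, 'b) rfmat) = 1"
    then have "entry (0 :: ('a, 'b) rfmat) undefined undefined = entry 1 undefined undefined"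
      by simp
    then show False by (simp add: zero_rfmat.rep_eq one_rfmat.rep_eq)
  qed
qed

end

lift_definition scale :: "'f::field \<Rightarrow> ('x, 'f) rfmat \<Rightarrow> ('x, 'f) rfmat" is "\<lambda>c a x y. c * a x y"
  subgoal for c a x by (rule finite_support_combine[where f = "a x" and g = "a x"]) auto
  done

lemmas entry_simps = zero_rfmat.rep_eq one_rfmat.rep_eq plus_rfmat.rep_eq uminus_rfmat.rep_eq
  minus_rfmat.rep_eq scale.rep_eq

interpretation rfmat: vector_space "scale :: 'f::field \<Rightarrow> ('x, 'f) rfmat \<Rightarrow> ('x, 'f) rfmat"
  by unfold_locales (rule rfmat_eqI; simp add: entry_simps algebra_simps)+

lemma scale_mult_left: "scale c a * b = scale c (a * b)"
proof (rule rfmat_eqI)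
  fix x y
  have "entry (scale c a * b) x y = (\<Sum>z | entry a x z \<noteq> 0. c * entry a x z * entry b z y)"
    by (subst entry_mult_superset[where Z = "{z. entry a x z \<noteq> 0}"])
      (auto simp: finite_row scale.rep_eq)
  then show "entry (scale c a * b) x y = entry (scale c (a * b)) x y"
    by (simp add: scale.rep_eq times_rfmat.rep_eq sum_distrib_left mult.assoc)
qed

lemma scale_mult_right: "a * scale c b = scale c (a * b)"
  by (rule rfmat_eqI)
    (simp add: scale.rep_eq times_rfmat.rep_eq sum_distrib_left mult.left_commute)

lemma entry_sum: "entry (sum f B) x y = (\<Sum>z\<in>B. entry (f z) x y)"
  by (induction B rule: infinite_finite_induct) (simp_all add: entry_simps)

section \<open>Kronecker products of row-finite matrices\<close>

text \<open>
  \<open>kron S m\<close> acts by \<open>m i\<close> on the coordinates \<open>i \<in> S\<close> of an index \<open>x :: 'i \<Rightarrow> nat\<close> and by the identity on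
  all other coordinates, so that Kronecker products over different finite sets \<open>S\<close> live in one algebra
  and filling in units changes nothing. It is \<open>0\<close> by convention if \<open>S\<close> is infinite.
\<close>

lift_definition kron :: "'i set \<Rightarrow> ('i \<Rightarrow> (nat, 'f::field) rfmat) \<Rightarrow> ('i \<Rightarrow> nat, 'f) rfmat"
  is "\<lambda>S m x y. if finite S \<and> (\<forall>i. i \<notin> S \<longrightarrow> x i = y i) then \<Prod>i\<in>S. m i (x i) (y i) else 0"
proof -
  fix S :: "'i set" and m :: "'i \<Rightarrow> nat \<Rightarrow> nat \<Rightarrow> 'f" and x :: "'i \<Rightarrow> nat"
  assume m: "\<And>i x. finite {y. m i x y \<noteq> 0}"
  let ?G = "(\<lambda>w i. if i \<in> S then w i else x i) ` (\<Pi>\<^sub>E i\<in>S. {l. m i (x i) l \<noteq> 0})"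
  show "finite {y. (if finite S \<and> (\<forall>i. i \<notin> S \<longrightarrow> x i = y i)
                    then \<Prod>i\<in>S. m i (x i) (y i) else 0) \<noteq> 0}" (is "finite ?R")
  proof (cases "finite S")
    case True
    have "y \<in> ?G" if "y \<in> ?R" for y
      using that True
      by (intro image_eqI[where x = "restrict y S"]) (auto split: if_splits)
    then have "?R \<subseteq> ?G" by blast
    moreover have "finite ?G" using True m by (intro finite_imageI finite_PiE) auto
    ultimately show ?thesis by (rule finite_subset)
  qed auto
qed

lemma kron_cong: "(\<And>i. i \<in> S \<Longrightarrow> m i = m' i) \<Longrightarrow> kron S m = kron S m'"
  by (rule rfmat_eqI) (auto simp: kron.rep_eq intro!: prod.cong)

text \<open>
  Coordinatewise multiplication is a product of sums, and expanding it gives one summand for every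
  intermediate index that agrees with the row index off \<open>S\<close>.
\<close>

lemma kron_mult:
  assumes S: "finite S"
  shows "kron S m * kron S m' = kron S (\<lambda>i. m i * m' i)"
proof (rule rfmat_eqI)
  fix x y :: "'a \<Rightarrow> nat"
  let ?B = "\<lambda>i. {l. entry (m i) (x i) l \<noteq> 0}"
  let ?g = "\<lambda>w i. if i \<in> S then w i else x i"
  have finB: "finite (\<Pi>\<^sub>E i\<in>S. ?B i)" using S by (intro finite_PiE) (auto simp: finite_row)
  have inj: "inj_on ?g (\<Pi>\<^sub>E i\<in>S. ?B i)"
  proof (rule inj_onI)
    fix v w assume vw: "v \<in> (\<Pi>\<^sub>E i\<in>S. ?B i)" "w \<in> (\<Pi>\<^sub>E i\<in>S. ?B i)" and eq: "?g v = ?g w"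
    show "v = w"
      by (rule PiE_ext[OF vw]) (use fun_cong[OF eq] in \<open>metis (full_types)\<close>)
  qed
  have sub: "{z. entry (kron S m) x z \<noteq> 0} \<subseteq> ?g ` (\<Pi>\<^sub>E i\<in>S. ?B i)"
  proof
    fix z assume "z \<in> {z. entry (kron S m) x z \<noteq> 0}"
    then show "z \<in> ?g ` (\<Pi>\<^sub>E i\<in>S. ?B i)" using S
      by (intro image_eqI[where x = "restrict z S"]) (auto simp: kron.rep_eq split: if_splits)
  qed
  have "entry (kron S m * kron S m') x y
      = (\<Sum>w\<in>(\<Pi>\<^sub>E i\<in>S. ?B i). entry (kron S m) x (?g w) * entry (kron S m') (?g w) y)"
    by (subst entry_mult_superset[OF finite_imageI[OF finB] sub], subst sum.reindex[OF inj]) simp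
  also have "\<dots> = (if \<forall>i. i \<notin> S \<longrightarrow> x i = y i
      then \<Sum>w\<in>(\<Pi>\<^sub>E i\<in>S. ?B i). \<Prod>i\<in>S. entry (m i) (x i) (w i) * entry (m' i) (w i) (y i) else 0)"
    using S by (auto simp: kron.rep_eq prod.distrib intro!: sum.cong sum.neutral)
  also have "\<dots> = entry (kron S (\<lambda>i. m i * m' i)) x y"
    using S by (auto simp: kron.rep_eq times_rfmat.rep_eq prod_sum_PiE finite_row)
  finally show "entry (kron S m * kron S m') x y = entry (kron S (\<lambda>i. m i * m' i)) x y" .
qed

text \<open>
  A matrix entry off the diagonal in a coordinate of \<open>T - S\<close> contributes a factor \<open>0\<close> on the left, and the
  right side vanishes there by definition.
\<close>

lemma kron_extend:
  assumes "finite T" "S \<subseteq> T"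
  shows "kron T (\<lambda>i. if i \<in> S then m i else 1) = kron S m"
proof (rule rfmat_eqI)
  fix x y
  have fin: "finite S" using assms by (rule rev_finite_subset)
  have split: "(\<Prod>i\<in>T. entry (if i \<in> S then m i else 1) (x i) (y i))
      = (\<Prod>i\<in>S. entry (m i) (x i) (y i)) * (\<Prod>i\<in>T - S. if x i = y i then 1 else 0)"
    using assms by (subst prod.subset_diff[OF assms(2,1)])
      (auto simp: one_rfmat.rep_eq mult.commute intro!: arg_cong2[where f = "(*)"] prod.cong)
  show "entry (kron T (\<lambda>i. if i \<in> S then m i else 1)) x y = entry (kron S m) x y"
  proof (cases "\<forall>i. i \<notin> S \<longrightarrow> x i = y i")
    case True
    then show ?thesis using assms fin by (auto simp: kron.rep_eq split intro!: prod.neutral)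
  next
    case False
    then obtain j where j: "j \<notin> S" "x j \<noteq> y j" by blast
    show ?thesis
    proof (cases "j \<in> T")
      case True
      then have "(\<Prod>i\<in>T - S. if x i = y i then 1 else 0) = (0 :: 'b)"
        using assms j by (intro prod_zero) auto
      then show ?thesis using False by (auto simp: kron.rep_eq split)
    next
      case False
      then show ?thesis using j by (auto simp: kron.rep_eq)
    qed
  qed
qed

lemma kron_empty: "kron {} m = 1"
  by (rule rfmat_eqI) (auto simp: kron.rep_eq one_rfmat.rep_eq)

lemma kron_update_add:
  assumes "finite S" "i \<in> S"
  shows "kron S (m(i := a + b)) = kron S (m(i := a)) + kron S (m(i := b))"
  using assms by (intro rfmat_eqI)
    (auto simp: kron.rep_eq entry_simps prod.remove[of S i] distrib_right intro!: prod.cong)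

lemma kron_update_scale:
  assumes "finite S" "i \<in> S"
  shows "kron S (m(i := scale c a)) = scale c (kron S (m(i := a)))"
  using assms by (intro rfmat_eqI)
    (auto simp: kron.rep_eq entry_simps prod.remove[of S i] intro!: prod.cong)

lemma kron_sum:
  assumes S: "finite S" and B: "\<And>i. i \<in> S \<Longrightarrow> finite (B i)"
  shows "kron S (\<lambda>i. \<Sum>j\<in>B i. m i j) = (\<Sum>w\<in>(\<Pi>\<^sub>E i\<in>S. B i). kron S (\<lambda>i. m i (w i)))"
  using assms by (intro rfmat_eqI) (auto simp: kron.rep_eq entry_sum prod_sum_PiE intro!: sum.neutral[symmetric] sum.neutral)

lemma kron_scale: "finite S \<Longrightarrow> kron S (\<lambda>i. scale (c i) (m i)) = scale (\<Prod>i\<in>S. c i) (kron S m)"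
  by (intro rfmat_eqI) (auto simp: kron.rep_eq scale.rep_eq prod.distrib)

section \<open>Amplification of finite matrices\<close>

text \<open>
  The block diagonal matrix with infinitely many copies of an \<open>n \<times> n\<close> matrix. In contrast to extension by
  zeros, this sends the identity matrix to the identity; so matrix algebras of different sizes \<open>n i\<close> embed
  unitally into the one algebra of row-finite matrices over \<open>nat\<close>, and \<open>'i \<Rightarrow> nat\<close> can serve as the index
  type for every family \<open>A\<close>.
\<close>

lift_definition amp :: "nat \<Rightarrow> 'f::field mat \<Rightarrow> (nat, 'f) rfmat"
  is "\<lambda>n a k l. if n > 0 \<and> k div n = l div n then a $$ (k mod n, l mod n) else 0"
proof -
  fix n k :: nat and a :: "'f mat"
  have "l < Suc (k div n) * n" if "n > 0" "k div n = l div n" for l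
    using mod_less_divisor[OF that(1), of l] div_mult_mod_eq[of l n] unfolding that(2) mult_Suc
    by linarith
  then have "{l. (if n > 0 \<and> k div n = l div n then a $$ (k mod n, l mod n) else 0) \<noteq> 0}
      \<subseteq> {..<Suc (k div n) * n}"
    by (auto split: if_splits simp del: mult_Suc)
  then show "finite {l. (if n > 0 \<and> k div n = l div n then a $$ (k mod n, l mod n) else 0) \<noteq> 0}"
    by (rule finite_subset) simp
qed

lemma entry_amp: "k < n \<Longrightarrow> l < n \<Longrightarrow> entry (amp n a) k l = a $$ (k, l)"
  by (simp add: amp.rep_eq)

lemma amp_add: "a \<in> carrier_mat n n \<Longrightarrow> b \<in> carrier_mat n n \<Longrightarrow> amp n (a + b) = amp n a + amp n b"
  by (rule rfmat_eqI) (simp add: amp.rep_eq entry_simps)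

lemma amp_smult: "a \<in> carrier_mat n n \<Longrightarrow> amp n (c \<cdot>\<^sub>m a) = scale c (amp n a)"
  by (rule rfmat_eqI) (simp add: amp.rep_eq entry_simps)

lemma amp_one: "n > 0 \<Longrightarrow> amp n (1\<^sub>m n) = 1"
  by (rule rfmat_eqI) (auto simp: amp.rep_eq entry_simps, metis div_mod_decomp)

lemma amp_mult:
  assumes a: "a \<in> carrier_mat n n" and b: "b \<in> carrier_mat n n"
  shows "amp n (a * b) = amp n a * amp n b"
proof (rule rfmat_eqI)
  fix k l
  show "entry (amp n (a * b)) k l = entry (amp n a * amp n b) k l"
  proof (cases "n > 0")
    case True
    let ?g = "\<lambda>j. (k div n) * n + j"
    have "{z. entry (amp n a) k z \<noteq> 0} \<subseteq> ?g ` {..<n}"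
    proof
      fix z assume "z \<in> {z. entry (amp n a) k z \<noteq> 0}"
      then have "z = ?g (z mod n)" by (simp add: amp.rep_eq split: if_splits)
      then show "z \<in> ?g ` {..<n}"
        by (rule image_eqI) (use True in simp)
    qed
    then have "entry (amp n a * amp n b) k l
        = (\<Sum>j<n. entry (amp n a) k (?g j) * entry (amp n b) (?g j) l)"
      by (subst entry_mult_superset[where Z = "?g ` {..<n}"]) (auto simp: sum.reindex inj_on_def)
    also have "\<dots> = (\<Sum>j<n. a $$ (k mod n, j) * (if k div n = l div n then b $$ (j, l mod n) else 0))"
      using True by (intro sum.cong) (auto simp: amp.rep_eq div_add1_eq)
    also have "\<dots> = entry (amp n (a * b)) k l"
      using True a b by (auto simp: amp.rep_eq scalar_prod_def lessThan_atLeast0)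
    finally show ?thesis ..
  qed (simp add: amp.rep_eq times_rfmat.rep_eq)
qed

lemma amp_inj:
  assumes a: "a \<in> carrier_mat n n" and b: "b \<in> carrier_mat n n" and eq: "amp n a = amp n b"
  shows "a = b"
proof (rule eq_matI)
  fix k l assume "k < dim_row b" "l < dim_col b"
  then show "a $$ (k, l) = b $$ (k, l)" using b entry_amp[of k n l a] entry_amp[of k n l b] eq by auto
qed (use a b in auto)

definition unit_mat :: "nat \<Rightarrow> nat \<times> nat \<Rightarrow> 'f::field mat" where
  "unit_mat n w = mat n n (\<lambda>q. if q = w then 1 else 0)"

lemma unit_mat_carrier [simp]: "unit_mat n w \<in> carrier_mat n n"
  by (simp add: unit_mat_def)

lemma entry_amp_unit:
  assumes "k < n" "l < n"
  shows "entry (amp n (unit_mat n w)) k l = (if (k, l) = w then 1 else 0)"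
  using assms by (simp add: entry_amp unit_mat_def)

text \<open>
  The expansion in matrix units may be checked on one diagonal block, as all blocks are equal.
\<close>

lemma amp_expand:
  assumes n: "n > 0" and a: "a \<in> carrier_mat n n"
  shows "amp n a = (\<Sum>w\<in>{..<n} \<times> {..<n}. scale (entry (amp n a) (fst w) (snd w)) (amp n (unit_mat n w)))"
proof (rule rfmat_eqI)
  fix k l
  have "(\<Sum>w\<in>{..<n} \<times> {..<n}. entry (scale (entry (amp n a) (fst w) (snd w)) (amp n (unit_mat n w))) k l)
    = (\<Sum>w\<in>{..<n} \<times> {..<n}. if w = (k mod n, l mod n) then entry (amp n a) k l else 0)"
    using n by (intro sum.cong) (auto simp: scale.rep_eq amp.rep_eq unit_mat_def)
  then show "entry (amp n a) k l
      = entry (\<Sum>w\<in>{..<n} \<times> {..<n}. scale (entry (amp n a) (fst w) (snd w)) (amp n (unit_mat n w))) k l"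
    using n by (simp add: entry_sum)
qed

section \<open>Tensors of matrices and their coordinates\<close>

text \<open>
  A family of matrix algebras with a chosen isomorphism \<open>h i\<close> of each onto the \<open>n i \<times> n i\<close> matrices.
\<close>

locale matrix_factors =
  fixes I :: "'i set" and A :: "'i \<Rightarrow> ('f::field, 'a) module"
    and n :: "'i \<Rightarrow> nat" and h :: "'i \<Rightarrow> 'a \<Rightarrow> 'f mat"
  assumes algebra: "i \<in> I \<Longrightarrow> unital_algebra class_ring (A i)"
    and n_pos: "i \<in> I \<Longrightarrow> n i > 0"
    and iso: "i \<in> I \<Longrightarrow> h i \<in> ring_iso (A i) (module_mat TYPE('f) (n i) (n i))"
    and h_smult: "i \<in> I \<Longrightarrow> a \<in> carrier (A i) \<Longrightarrow> h i (c \<odot>\<^bsub>A i\<^esub> a) = c \<cdot>\<^sub>m h i a"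
begin

lemma h_carrier: "i \<in> I \<Longrightarrow> a \<in> carrier (A i) \<Longrightarrow> h i a \<in> carrier_mat (n i) (n i)"
  using iso by (auto simp: ring_iso_def Ring.ring_hom_def module_mat_simps)

lemma h_surj:
  assumes "i \<in> I" "m \<in> carrier_mat (n i) (n i)"
  shows "\<exists>a\<in>carrier (A i). h i a = m"
proof -
  have "m \<in> h i ` carrier (A i)"
    using iso[OF assms(1)] assms(2) by (simp add: ring_iso_def module_mat_simps bij_betw_def)
  then show ?thesis by blast
qed

lemma ring: "i \<in> I \<Longrightarrow> Ring.ring (A i)"
  using algebra by (auto simp: unital_algebra_def)

lemma module: "i \<in> I \<Longrightarrow> Module.module class_ring (A i)"
  using algebra by (auto simp: unital_algebra_def vectorspace_def)

lemma A_closed: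
  assumes "i \<in> I"
  shows "\<one>\<^bsub>A i\<^esub> \<in> carrier (A i)" "\<zero>\<^bsub>A i\<^esub> \<in> carrier (A i)"
    "a \<in> carrier (A i) \<Longrightarrow> b \<in> carrier (A i) \<Longrightarrow> a \<otimes>\<^bsub>A i\<^esub> b \<in> carrier (A i)"
    "a \<in> carrier (A i) \<Longrightarrow> b \<in> carrier (A i) \<Longrightarrow> a \<oplus>\<^bsub>A i\<^esub> b \<in> carrier (A i)"
    "a \<in> carrier (A i) \<Longrightarrow> c \<odot>\<^bsub>A i\<^esub> a \<in> carrier (A i)"
proof -
  interpret ring "A i" by (rule ring[OF assms])
  interpret m: Module.module class_ring "A i" by (rule module[OF assms])
  show "\<one>\<^bsub>A i\<^esub> \<in> carrier (A i)" "\<zero>\<^bsub>A i\<^esub> \<in> carrier (A i)"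
    "a \<in> carrier (A i) \<Longrightarrow> b \<in> carrier (A i) \<Longrightarrow> a \<otimes>\<^bsub>A i\<^esub> b \<in> carrier (A i)"
    "a \<in> carrier (A i) \<Longrightarrow> b \<in> carrier (A i) \<Longrightarrow> a \<oplus>\<^bsub>A i\<^esub> b \<in> carrier (A i)"
    "a \<in> carrier (A i) \<Longrightarrow> c \<odot>\<^bsub>A i\<^esub> a \<in> carrier (A i)"
    by (auto intro: m.smult_closed)
qed

definition rho :: "'i \<Rightarrow> 'a \<Rightarrow> (nat, 'f) rfmat" where
  "rho i a = amp (n i) (h i a)"

lemma rho_add: "i \<in> I \<Longrightarrow> a \<in> carrier (A i) \<Longrightarrow> b \<in> carrier (A i) \<Longrightarrow>
    rho i (a \<oplus>\<^bsub>A i\<^esub> b) = rho i a + rho i b"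
  using iso[of i] by (simp add: rho_def ring_iso_def Ring.ring_hom_def module_mat_simps amp_add h_carrier)

lemma rho_mult: "i \<in> I \<Longrightarrow> a \<in> carrier (A i) \<Longrightarrow> b \<in> carrier (A i) \<Longrightarrow>
    rho i (a \<otimes>\<^bsub>A i\<^esub> b) = rho i a * rho i b"
  using iso[of i] by (simp add: rho_def ring_iso_def Ring.ring_hom_def module_mat_simps amp_mult h_carrier)

lemma rho_one: "i \<in> I \<Longrightarrow> rho i \<one>\<^bsub>A i\<^esub> = 1"
  using iso[of i] by (simp add: rho_def ring_iso_def Ring.ring_hom_def module_mat_simps amp_one n_pos)

lemma rho_smult: "i \<in> I \<Longrightarrow> a \<in> carrier (A i) \<Longrightarrow> rho i (c \<odot>\<^bsub>A i\<^esub> a) = scale c (rho i a)"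
  by (simp add: rho_def h_smult amp_smult h_carrier)

lemma rho_inj:
  assumes "i \<in> I" "a \<in> carrier (A i)" "b \<in> carrier (A i)" "rho i a = rho i b"
  shows "a = b"
  using assms iso[of i] amp_inj[OF h_carrier h_carrier]
  by (auto simp: rho_def ring_iso_def bij_betw_def inj_on_def)

abbreviation ixs :: "'i \<Rightarrow> (nat \<times> nat) set" where
  "ixs i \<equiv> {..<n i} \<times> {..<n i}"

definition unit :: "'i \<Rightarrow> nat \<times> nat \<Rightarrow> 'a" where
  "unit i w = (SOME a. a \<in> carrier (A i) \<and> h i a = unit_mat (n i) w)"

lemma unit:
  assumes "i \<in> I"
  shows unit_closed: "unit i w \<in> carrier (A i)" and rho_unit: "rho i (unit i w) = amp (n i) (unit_mat (n i) w)"
proof -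
  have "unit i w \<in> carrier (A i) \<and> h i (unit i w) = unit_mat (n i) w"
    unfolding unit_def by (rule someI_ex) (use h_surj[OF assms, of "unit_mat (n i) w"] in auto)
  then show "unit i w \<in> carrier (A i)" "rho i (unit i w) = amp (n i) (unit_mat (n i) w)"
    by (auto simp: rho_def)
qed

text \<open>
  The coordinates of an element of the \<open>i\<close>-th algebra with respect to its matrix units.
\<close>

definition val :: "'i \<Rightarrow> nat \<times> nat \<Rightarrow> 'a \<Rightarrow> 'f" where
  "val i w a = entry (rho i a) (fst w) (snd w)"

lemma val_unit: "i \<in> I \<Longrightarrow> v \<in> ixs i \<Longrightarrow> val i v (unit i w) = (if v = w then 1 else 0)"
  by (auto simp: val_def rho_unit entry_amp_unit)

lemma rho_expand:
  "i \<in> I \<Longrightarrow> a \<in> carrier (A i) \<Longrightarrow> rho i a = (\<Sum>w\<in>ixs i. scale (val i w a) (rho i (unit i w)))"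
  using amp_expand[OF n_pos h_carrier] by (simp add: rho_unit val_def) (simp add: rho_def)

text \<open>
  The image of a pure tensor in the model. Only the values of \<open>p\<close> on \<open>S\<close> matter, so arguments need not be
  extensional; this keeps \<open>tau\<close> free of restrictions when arguments are combined or updated.
\<close>

definition tau :: "'i set \<Rightarrow> ('i \<Rightarrow> 'a) \<Rightarrow> ('i \<Rightarrow> nat, 'f) rfmat" where
  "tau S p = kron S (\<lambda>i. rho i (p i))"

definition args :: "'i set \<Rightarrow> ('i \<Rightarrow> 'a) set" where
  "args S = {p. \<forall>i\<in>S. p i \<in> carrier (A i)}"

abbreviation fin :: "'i set \<Rightarrow> bool" where
  "fin S \<equiv> finite S \<and> S \<subseteq> I"

lemma tau_cong: "(\<And>i. i \<in> S \<Longrightarrow> p i = q i) \<Longrightarrow> tau S p = tau S q"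
  unfolding tau_def by (rule kron_cong) simp

lemma tau_mult:
  assumes "fin S" "p \<in> args S" "q \<in> args S"
  shows "tau S p * tau S q = tau S (\<lambda>i. p i \<otimes>\<^bsub>A i\<^esub> q i)"
  unfolding tau_def using assms
  by (subst kron_mult) (auto simp: args_def rho_mult[OF subsetD] intro!: kron_cong)

lemma tau_extend:
  assumes "fin T" "S \<subseteq> T"
  shows "tau T (\<lambda>i. if i \<in> S then p i else \<one>\<^bsub>A i\<^esub>) = tau S p"
proof -
  have "tau T (\<lambda>i. if i \<in> S then p i else \<one>\<^bsub>A i\<^esub>) = kron T (\<lambda>i. if i \<in> S then rho i (p i) else 1)"
    unfolding tau_def using assms by (intro kron_cong) (auto simp: rho_one)
  then show ?thesis using assms by (simp add: kron_extend tau_def)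
qed

lemma tau_empty: "tau {} p = 1"
  by (simp add: tau_def kron_empty)

lemma tau_one: "fin S \<Longrightarrow> tau S (\<lambda>i. \<one>\<^bsub>A i\<^esub>) = 1"
  using tau_extend[of S "{}" p] by (simp add: tau_empty)

lemma tau_update_add:
  assumes "fin S" "i \<in> S" "a \<in> carrier (A i)" "b \<in> carrier (A i)"
  shows "tau S (p(i := a \<oplus>\<^bsub>A i\<^esub> b)) = tau S (p(i := a)) + tau S (p(i := b))"
proof -
  have "(\<lambda>j. rho j ((p(i := x)) j)) = (\<lambda>j. rho j (p j))(i := rho i x)" for x by auto
  then show ?thesis using assms by (auto simp: tau_def rho_add kron_update_add subset_iff)
qed

lemma tau_update_smult:
  assumes "fin S" "i \<in> S" "a \<in> carrier (A i)"
  shows "tau S (p(i := c \<odot>\<^bsub>A i\<^esub> a)) = scale c (tau S (p(i := a)))"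
proof -
  have "(\<lambda>j. rho j ((p(i := x)) j)) = (\<lambda>j. rho j (p j))(i := rho i x)" for x by auto
  then show ?thesis using assms by (auto simp: tau_def rho_smult kron_update_scale subset_iff)
qed

text \<open>
  Tensors of matrix units. The coordinates with respect to them are entries of the matrix: the index
  \<open>0\<close> in the places outside \<open>S\<close> is an arbitrary choice, any fixed value would do.
\<close>

definition mu :: "'i set \<Rightarrow> ('i \<Rightarrow> nat \<times> nat) \<Rightarrow> ('i \<Rightarrow> nat, 'f) rfmat" where
  "mu S w = tau S (\<lambda>i. unit i (w i))"

definition coef :: "'i set \<Rightarrow> ('i \<Rightarrow> nat \<times> nat) \<Rightarrow> ('i \<Rightarrow> nat, 'f) rfmat \<Rightarrow> 'f" where
  "coef S w r = entry r (\<lambda>i. if i \<in> S then fst (w i) else 0) (\<lambda>i. if i \<in> S then snd (w i) else 0)"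

lemma coef_add: "coef S w (r + s) = coef S w r + coef S w s"
  and coef_scale: "coef S w (scale c r) = c * coef S w r"
  and coef_zero: "coef S w 0 = 0"
  and coef_sum: "coef S w (sum f B) = (\<Sum>z\<in>B. coef S w (f z))"
  by (simp_all add: coef_def entry_simps entry_sum)

lemma coef_tau: "finite S \<Longrightarrow> coef S w (tau S p) = (\<Prod>i\<in>S. val i (w i) (p i))"
  by (simp add: coef_def tau_def kron.rep_eq val_def)

lemma coef_mu:
  assumes "fin S" "v \<in> (\<Pi>\<^sub>E i\<in>S. ixs i)" "w \<in> (\<Pi>\<^sub>E i\<in>S. ixs i)"
  shows "coef S v (mu S w) = (if v = w then 1 else 0)"
proof -
  have "coef S v (mu S w) = (\<Prod>i\<in>S. if v i = w i then 1 else 0)"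
    using assms(1) by (simp add: mu_def coef_tau)
      (intro prod.cong refl val_unit, blast, rule PiE_mem[OF assms(2)])
  also have "\<dots> = (if \<forall>i\<in>S. v i = w i then 1 else 0)"
    using assms by (auto intro: prod.neutral)
  also have "(\<forall>i\<in>S. v i = w i) \<longleftrightarrow> v = w"
    using PiE_ext[OF assms(2,3)] by auto
  finally show ?thesis .
qed

text \<open>
  The subalgebra of the model that corresponds to the finite tensor product over \<open>S\<close>.
\<close>

definition M :: "'i set \<Rightarrow> ('i \<Rightarrow> nat, 'f) rfmat set" where
  "M S = rfmat.span (tau S ` args S)"

lemma tau_expand:
  assumes "fin S" "p \<in> args S"
  shows "tau S p = (\<Sum>w\<in>(\<Pi>\<^sub>E i\<in>S. ixs i). scale (coef S w (tau S p)) (mu S w))"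
proof -
  have "tau S p = kron S (\<lambda>i. \<Sum>w\<in>ixs i. scale (val i w (p i)) (rho i (unit i w)))"
    unfolding tau_def using assms
    by (intro kron_cong) (auto simp: args_def intro!: rho_expand)
  also have "\<dots> = (\<Sum>w\<in>(\<Pi>\<^sub>E i\<in>S. ixs i). kron S (\<lambda>i. scale (val i (w i) (p i)) (rho i (unit i (w i)))))"
    using assms by (intro kron_sum) auto
  also have "\<dots> = (\<Sum>w\<in>(\<Pi>\<^sub>E i\<in>S. ixs i). scale (coef S w (tau S p)) (mu S w))"
    using assms(1) by (simp only: kron_scale coef_tau mu_def) (simp add: tau_def)
  finally show ?thesis .
qed

text \<open>
  Elements of \<open>M S\<close> are determined by their coordinates; \<open>coef_mu\<close> shows that the coordinates are
  independent, so the \<open>mu S w\<close> form a basis of \<open>M S\<close>.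
\<close>

lemma M_expand:
  assumes "fin S" "r \<in> M S"
  shows "r = (\<Sum>w\<in>(\<Pi>\<^sub>E i\<in>S. ixs i). scale (coef S w r) (mu S w))"
  using assms(2) unfolding M_def
proof (induction rule: rfmat.span_induct_alt)
  case base
  then show ?case by (simp add: coef_zero)
next
  case (step c x y)
  then obtain p where p: "p \<in> args S" "x = tau S p" by blast
  have "scale c x = (\<Sum>w\<in>(\<Pi>\<^sub>E i\<in>S. ixs i). scale (c * coef S w x) (mu S w))"
    using arg_cong[OF tau_expand[OF assms(1) p(1)], of "scale c"] unfolding p(2)[symmetric]
    by (simp add: rfmat.scale_sum_right)
  then show ?case
    unfolding coef_add coef_scale rfmat.scale_left_distrib sum.distrib
    using step.IH by (rule arg_cong2)
qed

lemma tau_in_M: "p \<in> args S \<Longrightarrow> tau S p \<in> M S"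
  unfolding M_def by (rule rfmat.span_base) simp

lemma subspace_M: "rfmat.subspace (M S)"
  unfolding M_def by (rule rfmat.subspace_span)

lemmas M_zero = rfmat.subspace_0[OF subspace_M]
  and M_add = rfmat.subspace_add[OF subspace_M]
  and M_diff = rfmat.subspace_diff[OF subspace_M]
  and M_scale = rfmat.subspace_scale[OF subspace_M]
  and M_sum = rfmat.subspace_sum[OF subspace_M]

lemma M_mono:
  assumes "fin T" "S \<subseteq> T"
  shows "M S \<subseteq> M T"
  unfolding M_def
proof (rule rfmat.span_minimal[OF _ rfmat.subspace_span], safe)
  fix p assume "p \<in> args S"
  then have "(\<lambda>i. if i \<in> S then p i else \<one>\<^bsub>A i\<^esub>) \<in> args T"
    using assms by (auto simp: args_def A_closed)
  then have "tau T (\<lambda>i. if i \<in> S then p i else \<one>\<^bsub>A i\<^esub>) \<in> rfmat.span (tau T ` args T)"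
    by (intro rfmat.span_base imageI)
  then show "tau S p \<in> rfmat.span (tau T ` args T)"
    by (simp only: tau_extend[OF assms])
qed

lemma one_args: "fin S \<Longrightarrow> (\<lambda>i. \<one>\<^bsub>A i\<^esub>) \<in> args S"
  by (auto simp: args_def A_closed(1))

lemma M_one: "fin S \<Longrightarrow> 1 \<in> M S"
  using tau_in_M[OF one_args, of S] by (simp add: tau_one)

lemma subspace_left_mult: "rfmat.subspace V \<Longrightarrow> rfmat.subspace {r. r * s \<in> V}"
  by (auto simp: rfmat.subspace_def distrib_right scale_mult_left)

lemma subspace_right_mult: "rfmat.subspace V \<Longrightarrow> rfmat.subspace {r. s * r \<in> V}"
  by (auto simp: rfmat.subspace_def distrib_left scale_mult_right)

lemma M_mult:
  assumes S: "fin S" and r: "r \<in> M S" and s: "s \<in> M S"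
  shows "r * s \<in> M S"
proof -
  have 1: "tau S p * tau S q \<in> M S" if "p \<in> args S" "q \<in> args S" for p q
  proof -
    have "(\<lambda>i. p i \<otimes>\<^bsub>A i\<^esub> q i) \<in> args S" using S that by (auto simp: args_def A_closed)
    then show ?thesis using tau_mult[OF S that] by (simp add: tau_in_M)
  qed
  have 2: "tau S p * s \<in> M S" if p: "p \<in> args S" for p
    using s unfolding M_def[of S]
    by (rule rfmat.span_induct[OF _ subspace_right_mult[OF subspace_M, unfolded M_def], simplified])
      (use 1 p in \<open>auto simp: M_def\<close>)
  show ?thesis
    using r unfolding M_def[of S]
    by (rule rfmat.span_induct[OF _ subspace_left_mult[OF subspace_M, unfolded M_def], simplified])
      (use 2 in \<open>auto simp: M_def\<close>)
qed

end

section \<open>Finitely supported functions\<close>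

definition fscale :: "'f::field \<Rightarrow> ('p \<Rightarrow> 'f) \<Rightarrow> 'p \<Rightarrow> 'f" where
  "fscale c u = (\<lambda>p. c * u p)"

interpretation fn: vector_space "fscale :: 'f::field \<Rightarrow> ('p \<Rightarrow> 'f) \<Rightarrow> 'p \<Rightarrow> 'f"
  by unfold_locales (auto simp: fscale_def algebra_simps)

lemma sum_apply: "(\<Sum>k\<in>K. f k) x = (\<Sum>k\<in>K. (f k x :: 'f::field))"
  by (induction K rule: infinite_finite_induct) auto

text \<open>
  The linear extension of \<open>g\<close> from basis vectors to finitely supported functions.
\<close>

definition lin_ext :: "('p \<Rightarrow> ('x, 'f::field) rfmat) \<Rightarrow> ('p \<Rightarrow> 'f) \<Rightarrow> ('x, 'f) rfmat" where
  "lin_ext g u = (\<Sum>p | u p \<noteq> 0. scale (u p) (g p))"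

abbreviation fsupp :: "('p \<Rightarrow> 'f::field) \<Rightarrow> bool" where
  "fsupp u \<equiv> finite {p. u p \<noteq> 0}"

lemma lin_ext_superset:
  "finite P \<Longrightarrow> {p. u p \<noteq> 0} \<subseteq> P \<Longrightarrow> lin_ext g u = (\<Sum>p\<in>P. scale (u p) (g p))"
  unfolding lin_ext_def by (intro sum.mono_neutral_left) auto

lemma fsupp_add: "fsupp u \<Longrightarrow> fsupp v \<Longrightarrow> fsupp (u + v)"
  by (rule finite_support_combine[where f = u and g = v]) auto

lemma fsupp_scale: "fsupp u \<Longrightarrow> fsupp (fscale c u)"
  by (rule finite_support_combine[where f = u and g = u]) (auto simp: fscale_def)

lemma fsupp_basis: "fsupp (basis_vec p :: 'p \<Rightarrow> 'f::field)"
  by (simp add: basis_vec_def)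

lemma fsupp_sum: "(\<And>k. k \<in> K \<Longrightarrow> fsupp (f k)) \<Longrightarrow> fsupp (sum f K)"
  by (induction K rule: infinite_finite_induct) (simp_all add: fsupp_add del: plus_fun_apply)

lemma lin_ext_add:
  assumes "fsupp u" "fsupp v"
  shows "lin_ext g (u + v) = lin_ext g u + lin_ext g v"
proof -
  let ?P = "{p. u p \<noteq> 0} \<union> {p. v p \<noteq> 0}"
  have "finite ?P" using assms by simp
  then show ?thesis
    by (subst (1 2 3) lin_ext_superset[where P = ?P])
      (auto simp: sum.distrib rfmat.scale_left_distrib)
qed

lemma lin_ext_scale:
  assumes "fsupp u"
  shows "lin_ext g (fscale c u) = scale c (lin_ext g u)"
  using assms by (subst (1 2) lin_ext_superset[where P = "{p. u p \<noteq> 0}"])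
    (auto simp: fscale_def rfmat.scale_sum_right)

lemma lin_ext_basis: "lin_ext g (basis_vec p) = g p"
  by (subst lin_ext_superset[where P = "{p}"]) (auto simp: basis_vec_def)

lemma lin_ext_zero: "lin_ext g 0 = 0"
  by (simp add: lin_ext_def)

lemma lin_ext_sum:
  "(\<And>k. k \<in> K \<Longrightarrow> fsupp (f k)) \<Longrightarrow> lin_ext g (sum f K) = (\<Sum>k\<in>K. lin_ext g (f k))"
  by (induction K rule: infinite_finite_induct)
    (simp_all add: lin_ext_zero lin_ext_add fsupp_sum del: plus_fun_apply)

lemma lin_ext_combination:
  "lin_ext g (\<Sum>k\<in>K. fscale (c k) (basis_vec (f k))) = (\<Sum>k\<in>K. scale (c k) (g (f k)))"
  by (subst lin_ext_sum) (simp_all add: fsupp_scale fsupp_basis lin_ext_scale lin_ext_basis)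

lemma fsupp_expand:
  assumes "fsupp u"
  shows "u = (\<Sum>p | u p \<noteq> 0. fscale (u p) (basis_vec p))"
proof
  fix q
  have "(\<Sum>p | u p \<noteq> 0. fscale (u p) (basis_vec p)) q = (\<Sum>p | u p \<noteq> 0. if q = p then u q else 0)"
    unfolding sum_apply by (intro sum.cong) (auto simp: fscale_def basis_vec_def)
  then show "u q = (\<Sum>p | u p \<noteq> 0. fscale (u p) (basis_vec p)) q"
    using assms by simp
qed

section \<open>The relations are the kernel of the evaluation map\<close>

context matrix_factors
begin

abbreviation basis_args :: "'i set \<Rightarrow> ('i \<Rightarrow> 'a) set" where
  "basis_args S \<equiv> \<Pi>\<^sub>E i\<in>S. carrier (A i)"

text \<open>
  The carrier of the free vector space that the tensor product is a quotient of, and the evaluation of its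
  elements in the model.
\<close>

definition F :: "'i set \<Rightarrow> (('i \<Rightarrow> 'a) \<Rightarrow> 'f) set" where
  "F S = {u. fsupp u \<and> {p. u p \<noteq> 0} \<subseteq> basis_args S}"

definition Phi :: "'i set \<Rightarrow> (('i \<Rightarrow> 'a) \<Rightarrow> 'f) \<Rightarrow> ('i \<Rightarrow> nat, 'f) rfmat" where
  "Phi S = lin_ext (tau S)"

lemma free_simps:
  "carrier (free_tensor A S) = F S"
  "u \<oplus>\<^bsub>free_tensor A S\<^esub> v = u + v"
  "\<zero>\<^bsub>free_tensor A S\<^esub> = 0"
  "c \<odot>\<^bsub>free_tensor A S\<^esub> u = fscale c u"
  by (simp_all add: free_tensor_def F_def fscale_def plus_fun_def zero_fun_def)

lemma basis_args_upd:
  "p \<in> basis_args S \<Longrightarrow> i \<in> S \<Longrightarrow> x \<in> carrier (A i) \<Longrightarrow> p(i := x) \<in> basis_args S"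
  using PiE_fun_upd[of x "\<lambda>i. carrier (A i)" i p S] by (simp add: insert_absorb)

lemma basis_args_args: "p \<in> basis_args S \<Longrightarrow> p \<in> args S"
  by (auto simp: args_def)

lemma subspace_F: "fn.subspace (F S)"
proof (rule fn.subspaceI)
  fix u v assume uv: "u \<in> F S" "v \<in> F S"
  have "{p. (u + v) p \<noteq> 0} \<subseteq> {p. u p \<noteq> 0} \<union> {p. v p \<noteq> 0}" by auto
  then show "u + v \<in> F S" using uv unfolding F_def by (blast intro: fsupp_add)
next
  fix c u assume u: "u \<in> F S"
  have "{p. fscale c u p \<noteq> 0} \<subseteq> {p. u p \<noteq> 0}" by (auto simp: fscale_def)
  then show "fscale c u \<in> F S" using u unfolding F_def by (blast intro: fsupp_scale)
qed (simp add: F_def)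

lemma F_fsupp: "u \<in> F S \<Longrightarrow> fsupp u"
  by (simp add: F_def)

lemmas F_zero = fn.subspace_0[OF subspace_F]
  and F_add = fn.subspace_add[OF subspace_F]
  and F_diff = fn.subspace_diff[OF subspace_F]
  and F_scale = fn.subspace_scale[OF subspace_F]
  and F_sum = fn.subspace_sum[OF subspace_F]

lemma F_basis: "p \<in> basis_args S \<Longrightarrow> basis_vec p \<in> F S"
  by (auto simp: F_def basis_vec_def)

lemma Phi_add: "u \<in> F S \<Longrightarrow> v \<in> F S \<Longrightarrow> Phi S (u + v) = Phi S u + Phi S v"
  unfolding Phi_def by (intro lin_ext_add F_fsupp)

lemma Phi_scale: "u \<in> F S \<Longrightarrow> Phi S (fscale c u) = scale c (Phi S u)"
  unfolding Phi_def by (intro lin_ext_scale F_fsupp)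

lemma Phi_diff: "u \<in> F S \<Longrightarrow> v \<in> F S \<Longrightarrow> Phi S (u - v) = Phi S u - Phi S v"
  using Phi_add[OF F_diff, of u S v v] by simp

lemma Phi_basis: "Phi S (basis_vec p) = tau S p"
  by (simp add: Phi_def lin_ext_basis)

lemma module_free: "Module.module class_ring (free_tensor A S)"
proof (rule Module.module.intro)
  show "cring (class_ring :: 'f ring)" ..
  show "abelian_group (free_tensor A S)"
  proof (rule abelian_groupI)
    fix u assume u: "u \<in> carrier (free_tensor A S)"
    show "\<exists>v\<in>carrier (free_tensor A S). v \<oplus>\<^bsub>free_tensor A S\<^esub> u = \<zero>\<^bsub>free_tensor A S\<^esub>"
      by (rule bexI[of _ "- u"]) (use u in \<open>simp_all add: free_simps fn.subspace_neg[OF subspace_F]\<close>)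
  qed (simp_all add: free_simps F_add F_zero ac_simps)
  show "Module.module_axioms class_ring (free_tensor A S)"
    by unfold_locales (simp_all add: free_simps F_scale fn.scale_left_distrib fn.scale_right_distrib)
qed

lemma relE:
  assumes "fin S" "u \<in> multilinear_rels A S"
  obtains
    (add) p i x y where "i \<in> S" "x \<in> carrier (A i)" "y \<in> carrier (A i)"
      "p(i := x \<oplus>\<^bsub>A i\<^esub> y) \<in> basis_args S" "p(i := x) \<in> basis_args S" "p(i := y) \<in> basis_args S"
      "u = basis_vec (p(i := x \<oplus>\<^bsub>A i\<^esub> y)) - basis_vec (p(i := x)) - basis_vec (p(i := y))"
  | (smult) p i c x where "i \<in> S" "x \<in> carrier (A i)"
      "p(i := c \<odot>\<^bsub>A i\<^esub> x) \<in> basis_args S" "p(i := x) \<in> basis_args S"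
      "u = basis_vec (p(i := c \<odot>\<^bsub>A i\<^esub> x)) - fscale c (basis_vec (p(i := x)))"
proof -
  from assms(2) consider
    (1) p i x y where "p \<in> basis_args S" "i \<in> S" "x \<in> carrier (A i)" "y \<in> carrier (A i)"
      "u = basis_vec (p(i := x \<oplus>\<^bsub>A i\<^esub> y)) - basis_vec (p(i := x)) - basis_vec (p(i := y))"
  | (2) p i c x where "p \<in> basis_args S" "i \<in> S" "x \<in> carrier (A i)"
      "u = basis_vec (p(i := c \<odot>\<^bsub>A i\<^esub> x)) - fscale c (basis_vec (p(i := x)))"
    unfolding multilinear_rels_def fscale_def fun_diff_def by blast
  then show ?thesis
  proof cases
    case 1
    then have "x \<oplus>\<^bsub>A i\<^esub> y \<in> carrier (A i)" using assms(1) by (blast intro: A_closed)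
    then show ?thesis using 1 by (intro add[of i x y p]) (simp_all add: basis_args_upd)
  next
    case 2
    then have "c \<odot>\<^bsub>A i\<^esub> x \<in> carrier (A i)" using assms(1) by (blast intro: A_closed)
    then show ?thesis using 2 by (intro smult[of i x p c]) (simp_all add: basis_args_upd)
  qed
qed

lemma rels_F:
  assumes "fin S"
  shows "multilinear_rels A S \<subseteq> F S"
proof
  fix u assume "u \<in> multilinear_rels A S"
  with assms show "u \<in> F S"
    by (cases rule: relE) (simp_all add: F_diff F_scale F_basis)
qed

lemma submodule_free:
  assumes "fn.subspace N" "N \<subseteq> F S"
  shows "LinearCombinations.submodule class_ring N (free_tensor A S)"
  unfolding LinearCombinations.submodule_def using module_free assms
  by (simp add: free_simps fn.subspace_add fn.subspace_0 fn.subspace_scale)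

text \<open>
  The ideal of relations as a span in the vector space of all functions, whose operations are those of
  type classes.
\<close>

lemma tensor_ideal_span:
  assumes S: "fin S"
  shows "tensor_ideal A S = fn.span (multilinear_rels A S)"
proof
  interpret Module.module class_ring "free_tensor A S" by (rule module_free)
  have sub: "fn.span (multilinear_rels A S) \<subseteq> F S"
    by (intro fn.span_minimal rels_F S subspace_F)
  show "tensor_ideal A S \<subseteq> fn.span (multilinear_rels A S)"
    unfolding tensor_ideal_def
    by (rule span_is_subset[OF fn.span_superset submodule_free[OF fn.subspace_span sub]])
  have "multilinear_rels A S \<subseteq> carrier (free_tensor A S)"
    using rels_F[OF S] by (simp add: free_simps)
  from span_is_submodule[OF this] in_own_span[OF this]
  show "fn.span (multilinear_rels A S) \<subseteq> tensor_ideal A S"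
    unfolding tensor_ideal_def
    by (intro fn.span_minimal)
      (simp_all add: LinearCombinations.submodule_def fn.subspace_def free_simps)
qed

lemma Phi_rel:
  assumes S: "fin S" and u: "u \<in> multilinear_rels A S"
  shows "Phi S u = 0"
  using assms
proof (cases rule: relE)
  case (add p i x y)
  then show ?thesis using tau_update_add[OF S add(1-3), of p]
    by (simp add: Phi_diff F_diff F_basis Phi_basis)
next
  case (smult p i c x)
  then show ?thesis using tau_update_smult[OF S smult(1,2), of p c]
    by (simp add: Phi_diff F_scale F_basis Phi_basis Phi_scale)
qed

text \<open>
  Matrix units span the matrix algebra. In this form the fact avoids sums in the \<open>i\<close>-th algebra.
\<close>

lemma A_unit_induct:
  assumes i: "i \<in> I" and a: "a \<in> carrier (A i)"
    and unit: "\<And>w. w \<in> ixs i \<Longrightarrow> Q (unit i w)"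
    and add: "\<And>x y. x \<in> carrier (A i) \<Longrightarrow> y \<in> carrier (A i) \<Longrightarrow> Q x \<Longrightarrow> Q y \<Longrightarrow> Q (x \<oplus>\<^bsub>A i\<^esub> y)"
    and smult: "\<And>c x. x \<in> carrier (A i) \<Longrightarrow> Q x \<Longrightarrow> Q (c \<odot>\<^bsub>A i\<^esub> x)"
  shows "Q a"
proof -
  have "\<exists>x\<in>carrier (A i). Q x \<and> rho i x = (\<Sum>w\<in>W. scale (val i w a) (rho i (unit i w)))"
    if "finite W" "W \<subseteq> ixs i" for W
    using that
  proof (induction W rule: finite_induct)
    case empty
    have "(0, 0) \<in> ixs i" using n_pos[OF i] by simp
    then show ?case
      by (intro bexI[of _ "0 \<odot>\<^bsub>A i\<^esub> unit i (0, 0)"])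
        (simp_all add: i unit_closed A_closed rho_smult unit smult del: mem_Sigma_iff)
  next
    case (insert w W)
    then obtain x where x: "x \<in> carrier (A i)" "Q x"
      "rho i x = (\<Sum>w\<in>W. scale (val i w a) (rho i (unit i w)))" by auto
    let ?y = "val i w a \<odot>\<^bsub>A i\<^esub> unit i w"
    have "Q ?y" "?y \<in> carrier (A i)"
      using insert.prems by (auto simp: i unit_closed A_closed intro!: smult unit)
    then show ?case using insert.hyps x i
      by (intro bexI[of _ "?y \<oplus>\<^bsub>A i\<^esub> x"]) (simp_all add: add A_closed rho_add rho_smult unit_closed)
  qed
  from this[of "ixs i"] obtain x where "x \<in> carrier (A i)" "Q x" "rho i x = rho i a"
    using rho_expand[OF i a] by auto
  then show ?thesis using rho_inj[OF i _ a] by blast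
qed

definition unit_args :: "'i set \<Rightarrow> ('i \<Rightarrow> nat \<times> nat) \<Rightarrow> 'i \<Rightarrow> 'a" where
  "unit_args S w = (\<lambda>i\<in>S. unit i (w i))"

text \<open>
  Multilinearity in one argument at a time: the induction is on the set \<open>S'\<close> of the places whose argument
  has not yet been replaced by matrix units.
\<close>

lemma reduce_to_units:
  assumes S: "fin S" and S': "finite S'" "S' \<subseteq> S"
    and p: "p \<in> basis_args S" "\<forall>i\<in>S - S'. \<exists>w\<in>ixs i. p i = unit i w"
  shows "basis_vec p \<in> fn.span (multilinear_rels A S \<union>
           basis_vec ` unit_args S ` (\<Pi>\<^sub>E i\<in>S. ixs i))" (is "_ \<in> fn.span ?X")
  using S' p
proof (induction S' arbitrary: p rule: finite_induct)
  case empty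
  then obtain w where w: "\<forall>i\<in>S. w i \<in> ixs i \<and> p i = unit i (w i)"
    using bchoice[of S "\<lambda>i w. w \<in> ixs i \<and> p i = unit i w"] unfolding Diff_empty by blast
  have "p = unit_args S (restrict w S)"
    using w empty.prems(2) by (auto simp: unit_args_def fun_eq_iff PiE_def extensional_def)
  moreover have "restrict w S \<in> (\<Pi>\<^sub>E i\<in>S. ixs i)" using w by auto
  ultimately show ?case by (intro fn.span_base UnI2 imageI) blast
next
  case (insert i S')
  have i: "i \<in> S" "i \<in> I" using insert.prems S by auto
  have upd: "p(i := x) \<in> basis_args S" if "x \<in> carrier (A i)" for x
    using basis_args_upd[OF insert.prems(2) i(1) that] .
  have "basis_vec (p(i := p i)) \<in> fn.span ?X"
  proof (rule A_unit_induct[OF i(2), of "p i" "\<lambda>a. basis_vec (p(i := a)) \<in> fn.span ?X"])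
    show "p i \<in> carrier (A i)" using insert.prems(2) i by auto
    fix w assume w: "w \<in> ixs i"
    show "basis_vec (p(i := unit i w)) \<in> fn.span ?X"
    proof (rule insert.IH)
      show "\<forall>j\<in>S - S'. \<exists>v\<in>ixs j. (p(i := unit i w)) j = unit j v"
        using insert.prems(3) w by (metis DiffD1 DiffD2 DiffI fun_upd_def insert_iff)
    qed (use insert.prems upd[OF unit_closed[OF i(2)]] in blast)+
  next
    fix x y assume x: "x \<in> carrier (A i)" "y \<in> carrier (A i)" "basis_vec (p(i := x)) \<in> fn.span ?X"
      "basis_vec (p(i := y)) \<in> fn.span ?X"
    let ?r = "basis_vec (p(i := x \<oplus>\<^bsub>A i\<^esub> y)) - basis_vec (p(i := x)) - basis_vec (p(i := y))
      :: ('i \<Rightarrow> 'a) \<Rightarrow> 'f"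
    have "?r \<in> multilinear_rels A S"
      unfolding multilinear_rels_def fun_diff_def using insert.prems(2) i x by blast
    then have "?r \<in> fn.span ?X" by (intro fn.span_base UnI1)
    from fn.span_add[OF fn.span_add[OF this x(3)] x(4)]
    show "basis_vec (p(i := x \<oplus>\<^bsub>A i\<^esub> y)) \<in> fn.span ?X" by simp
  next
    fix c x assume x: "x \<in> carrier (A i)" "basis_vec (p(i := x)) \<in> fn.span ?X"
    let ?r = "basis_vec (p(i := c \<odot>\<^bsub>A i\<^esub> x)) - fscale c (basis_vec (p(i := x)))
      :: ('i \<Rightarrow> 'a) \<Rightarrow> 'f"
    have "?r \<in> multilinear_rels A S"
      unfolding multilinear_rels_def fun_diff_def fscale_def using insert.prems(2) i x by blast
    then have "?r \<in> fn.span ?X" by (intro fn.span_base UnI1)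
    from fn.span_add[OF this fn.span_scale[OF x(2), of c]]
    show "basis_vec (p(i := c \<odot>\<^bsub>A i\<^esub> x)) \<in> fn.span ?X" by simp
  qed
  then show ?case by simp
qed

text \<open>
  The relations hold in the model, as Kronecker products are multilinear. Conversely, modulo the relations
  every element is a combination of tensors of matrix units; if it evaluates to \<open>0\<close>, then the coefficients
  of this combination vanish, because the tensors of matrix units are linearly independent in the model.
  So the ideal is a kernel, and all statements about cosets become statements about values of \<open>Phi\<close>.
\<close>

lemma tensor_ideal_kernel:
  assumes S: "fin S"
  shows "tensor_ideal A S = {u \<in> F S. Phi S u = 0}"
proof
  have "fn.subspace {u \<in> F S. Phi S u = 0}"
    unfolding fn.subspace_def
    by (auto simp: F_zero F_add F_scale Phi_add Phi_scale simp del: plus_fun_apply)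
      (simp add: Phi_def lin_ext_zero)
  then show "tensor_ideal A S \<subseteq> {u \<in> F S. Phi S u = 0}"
    unfolding tensor_ideal_span[OF S]
    by (intro fn.span_minimal) (use rels_F[OF S] Phi_rel[OF S] in auto)
  show "{u \<in> F S. Phi S u = 0} \<subseteq> tensor_ideal A S"
  proof safe
    fix u assume u: "u \<in> F S" "Phi S u = 0"
    let ?U = "unit_args S" and ?W = "\<Pi>\<^sub>E i\<in>S. ixs i"
    let ?J = "fn.span (multilinear_rels A S)"
    have fW: "finite ?W" using S by (intro finite_PiE) auto
    have "basis_vec p \<in> fn.span (multilinear_rels A S \<union> basis_vec ` ?U ` ?W)"
      if "u p \<noteq> 0" for p
      using that u(1) S by (intro reduce_to_units[OF S, of S]) (auto simp: F_def)
    then have "u \<in> fn.span (multilinear_rels A S \<union> basis_vec ` ?U ` ?W)"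
      by (subst fsupp_expand[OF F_fsupp[OF u(1)]]) (intro fn.span_sum fn.span_scale, simp)
    then obtain j v where jv: "u = j + v" "j \<in> ?J" "v \<in> fn.span (basis_vec ` ?U ` ?W)"
      unfolding fn.span_Un by blast
    obtain c where v: "v = (\<Sum>w\<in>?W. fscale (c w) (basis_vec (?U w)))"
      by (rule fn.span_image_coefficients[OF fW, of v "\<lambda>w. basis_vec (?U w)"])
        (use jv(3) in \<open>simp add: image_image\<close>)
    have j: "j \<in> F S" "Phi S j = 0"
      using jv(2) \<open>tensor_ideal A S \<subseteq> _\<close> unfolding tensor_ideal_span[OF S] by auto
    have tauU: "tau S (?U w) = mu S w" for w
      unfolding mu_def unit_args_def by (rule tau_cong) simp
    have "v = u - j" using jv(1) by simp
    then have "Phi S v = 0" using u j by (simp add: Phi_diff)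
    then have sum0: "(\<Sum>w\<in>?W. scale (c w) (mu S w)) = 0"
      unfolding v Phi_def by (simp add: lin_ext_combination tauU)
    have "c w = 0" if w: "w \<in> ?W" for w
    proof -
      have "coef S w (\<Sum>v\<in>?W. scale (c v) (mu S v)) = (\<Sum>v\<in>?W. if w = v then c v else 0)"
        unfolding coef_sum coef_scale by (intro sum.cong refl) (simp add: coef_mu[OF S w])
      then show ?thesis using w fW by (simp add: sum0 coef_zero)
    qed
    then have "v = 0" by (simp add: v)
    then show "u \<in> tensor_ideal A S" using jv by (simp add: tensor_ideal_span[OF S])
  qed
qed

end

section \<open>The finite tensor products and their limit in the model\<close>

context matrix_factors
begin

definition comp :: "'i set \<Rightarrow> ('i \<Rightarrow> 'a) \<Rightarrow> ('i \<Rightarrow> 'a) \<Rightarrow> 'i \<Rightarrow> 'a" where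
  "comp S p q = (\<lambda>i\<in>S. p i \<otimes>\<^bsub>A i\<^esub> q i)"

lemma free_mult:
  assumes "u \<in> F S" "v \<in> F S"
  shows "u \<otimes>\<^bsub>free_tensor A S\<^esub> v =
     (\<Sum>w\<in>{p. u p \<noteq> 0} \<times> {q. v q \<noteq> 0}. fscale (u (fst w) * v (snd w)) (basis_vec (comp S (fst w) (snd w))))"
proof
  fix r
  have "(u \<otimes>\<^bsub>free_tensor A S\<^esub> v) r
      = (\<Sum>w\<in>{p. u p \<noteq> 0} \<times> {q. v q \<noteq> 0}.
            if comp S (fst w) (snd w) = r then u (fst w) * v (snd w) else 0)"
    by (simp add: free_tensor_def comp_def sum.cartesian_product case_prod_beta)
  also have "\<dots> = (\<Sum>w\<in>{p. u p \<noteq> 0} \<times> {q. v q \<noteq> 0}.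
      fscale (u (fst w) * v (snd w)) (basis_vec (comp S (fst w) (snd w)))) r"
    unfolding sum_apply by (intro sum.cong) (auto simp: fscale_def basis_vec_def)
  finally show "(u \<otimes>\<^bsub>free_tensor A S\<^esub> v) r = (\<Sum>w\<in>{p. u p \<noteq> 0} \<times> {q. v q \<noteq> 0}.
      fscale (u (fst w) * v (snd w)) (basis_vec (comp S (fst w) (snd w)))) r" .
qed

lemma F_supp: "u \<in> F S \<Longrightarrow> u p \<noteq> 0 \<Longrightarrow> p \<in> basis_args S"
  unfolding F_def by blast

lemma comp_basis_args: "fin S \<Longrightarrow> p \<in> basis_args S \<Longrightarrow> q \<in> basis_args S \<Longrightarrow> comp S p q \<in> basis_args S"
  by (auto simp: comp_def intro!: A_closed)

lemma F_mult:
  assumes S: "fin S" and uv: "u \<in> F S" "v \<in> F S"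
  shows "u \<otimes>\<^bsub>free_tensor A S\<^esub> v \<in> F S"
proof -
  have "comp S (fst w) (snd w) \<in> basis_args S" if "w \<in> {p. u p \<noteq> 0} \<times> {q. v q \<noteq> 0}" for w
    using that F_supp[OF uv(1), of "fst w"] F_supp[OF uv(2), of "snd w"]
    by (intro comp_basis_args S) (simp_all add: mem_Times_iff)
  then show ?thesis unfolding free_mult[OF uv] by (intro F_sum F_scale F_basis)
qed

lemma Phi_expand: "Phi S u = (\<Sum>p | u p \<noteq> 0. scale (u p) (tau S p))"
  by (simp add: Phi_def lin_ext_def)

lemma tau_comp:
  assumes "fin S" "p \<in> basis_args S" "q \<in> basis_args S"
  shows "tau S (comp S p q) = tau S p * tau S q"
  unfolding tau_mult[OF assms(1) basis_args_args[OF assms(2)] basis_args_args[OF assms(3)]]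
  by (rule tau_cong) (simp add: comp_def)

lemma Phi_mult:
  assumes S: "fin S" and uv: "u \<in> F S" "v \<in> F S"
  shows "Phi S (u \<otimes>\<^bsub>free_tensor A S\<^esub> v) = Phi S u * Phi S v"
proof -
  have "Phi S (u \<otimes>\<^bsub>free_tensor A S\<^esub> v) =
    (\<Sum>w\<in>{p. u p \<noteq> 0} \<times> {q. v q \<noteq> 0}. scale (u (fst w) * v (snd w)) (tau S (comp S (fst w) (snd w))))"
    unfolding free_mult[OF uv] Phi_def by (rule lin_ext_combination)
  also have "\<dots> = (\<Sum>w\<in>{p. u p \<noteq> 0} \<times> {q. v q \<noteq> 0}.
      scale (u (fst w)) (tau S (fst w)) * scale (v (snd w)) (tau S (snd w)))"
    using uv by (intro sum.cong refl)
      (auto simp: tau_comp[OF S] scale_mult_left scale_mult_right F_def subset_iff)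
  also have "\<dots> = Phi S u * Phi S v"
    unfolding Phi_expand sum_product sum.cartesian_product by (simp add: case_prod_beta)
  finally show ?thesis .
qed

lemma Phi_in_M: "u \<in> F S \<Longrightarrow> Phi S u \<in> M S"
  unfolding Phi_expand by (intro M_sum M_scale tau_in_M basis_args_args) (auto simp: F_def)

lemma Phi_surj: "r \<in> M S \<Longrightarrow> \<exists>u\<in>F S. Phi S u = r"
  unfolding M_def
proof (induction rule: rfmat.span_induct_alt)
  case base
  have "Phi S 0 = 0" unfolding Phi_def by (rule lin_ext_zero)
  then show ?case using F_zero by (rule bexI)
next
  case (step c x y)
  then obtain p u where p: "p \<in> args S" "x = tau S p" and u: "u \<in> F S" "Phi S u = y" by blast
  have "restrict p S \<in> basis_args S" using p by (auto simp: args_def)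
  moreover have "tau S (restrict p S) = tau S p" by (rule tau_cong) simp
  ultimately have "Phi S (fscale c (basis_vec (restrict p S)) + u) = scale c x + y"
    "fscale c (basis_vec (restrict p S)) + u \<in> F S"
    using p u by (simp_all only: Phi_add F_add F_scale F_basis Phi_scale Phi_basis)
  then show ?case by (rule bexI)
qed

text \<open>
  The coset of all elements with value \<open>r\<close>. The elements of the finite tensor product over \<open>S\<close> are exactly
  these fibres, so its operations are those of the model.
\<close>

definition fib :: "'i set \<Rightarrow> ('i \<Rightarrow> nat, 'f) rfmat \<Rightarrow> (('i \<Rightarrow> 'a) \<Rightarrow> 'f) set" where
  "fib S r = {u \<in> F S. Phi S u = r}"

lemma fib_inj: "r \<in> M S \<Longrightarrow> fib S r = fib S s \<Longrightarrow> r = s"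
  using Phi_surj[of r S] by (auto simp: fib_def)

lemma coset_fib:
  assumes S: "fin S" and u: "u \<in> F S"
  shows "tensor_ideal A S +>\<^bsub>free_tensor A S\<^esub> u = fib S (Phi S u)"
proof
  show "tensor_ideal A S +>\<^bsub>free_tensor A S\<^esub> u \<subseteq> fib S (Phi S u)"
    using u by (auto simp: a_r_coset_def' free_simps tensor_ideal_kernel[OF S] fib_def F_add Phi_add
        simp del: plus_fun_apply)
  show "fib S (Phi S u) \<subseteq> tensor_ideal A S +>\<^bsub>free_tensor A S\<^esub> u"
  proof
    fix v assume v: "v \<in> fib S (Phi S u)"
    then have "v - u \<in> tensor_ideal A S"
      using u by (simp add: tensor_ideal_kernel[OF S] fib_def F_diff Phi_diff)
    moreover have "v = (v - u) + u" by simp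
    ultimately show "v \<in> tensor_ideal A S +>\<^bsub>free_tensor A S\<^esub> u"
      unfolding a_r_coset_def' free_simps by blast
  qed
qed

lemma union_fib: "r \<in> M S \<Longrightarrow> (\<And>u. u \<in> F S \<Longrightarrow> Phi S u = r \<Longrightarrow> f u = X) \<Longrightarrow> (\<Union>u\<in>fib S r. f u) = X"
  using Phi_surj[of r S] by (auto simp: fib_def)

lemma fin_tensor_simps:
  "carrier (fin_tensor A S) = a_rcosets\<^bsub>free_tensor A S\<^esub> (tensor_ideal A S)"
  "X \<otimes>\<^bsub>fin_tensor A S\<^esub> Y = rcoset_mult (free_tensor A S) (tensor_ideal A S) X Y"
  "\<zero>\<^bsub>fin_tensor A S\<^esub> = tensor_ideal A S"
  "X \<oplus>\<^bsub>fin_tensor A S\<^esub> Y = X <+>\<^bsub>free_tensor A S\<^esub> Y"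
  "c \<odot>\<^bsub>fin_tensor A S\<^esub> X =
     (\<Union>u\<in>X. tensor_ideal A S +>\<^bsub>free_tensor A S\<^esub> (c \<odot>\<^bsub>free_tensor A S\<^esub> u))"
  by (simp_all add: fin_tensor_def FactRing_def ring.defs module.defs)

lemma carrier_fin_tensor:
  assumes "fin S"
  shows "carrier (fin_tensor A S) = fib S ` M S"
  unfolding fin_tensor_simps A_RCOSETS_def'
  using coset_fib[OF assms] Phi_in_M Phi_surj by (fastforce simp: free_simps)

lemma fin_tensor_mult:
  assumes S: "fin S" and rs: "r \<in> M S" "s \<in> M S"
  shows "fib S r \<otimes>\<^bsub>fin_tensor A S\<^esub> fib S s = fib S (r * s)"
  unfolding fin_tensor_simps rcoset_mult_def
  by (intro union_fib rs) (simp add: coset_fib[OF S] F_mult[OF S] Phi_mult[OF S])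

lemma fin_tensor_smult:
  assumes S: "fin S" and r: "r \<in> M S"
  shows "c \<odot>\<^bsub>fin_tensor A S\<^esub> fib S r = fib S (scale c r)"
  unfolding fin_tensor_simps
  by (intro union_fib r) (simp add: coset_fib[OF S] F_scale Phi_scale free_simps)

lemma fin_tensor_add:
  assumes S: "fin S" and rs: "r \<in> M S" "s \<in> M S"
  shows "fib S r \<oplus>\<^bsub>fin_tensor A S\<^esub> fib S s = fib S (r + s)"
proof
  show "fib S r \<oplus>\<^bsub>fin_tensor A S\<^esub> fib S s \<subseteq> fib S (r + s)"
    by (auto simp: fin_tensor_simps set_add_def' free_simps fib_def F_add Phi_add simp del: plus_fun_apply)
  show "fib S (r + s) \<subseteq> fib S r \<oplus>\<^bsub>fin_tensor A S\<^esub> fib S s"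
  proof
    fix w assume w: "w \<in> fib S (r + s)"
    obtain u where u: "u \<in> F S" "Phi S u = r" using Phi_surj[OF rs(1)] by blast
    have "w - u \<in> fib S s" "u \<in> fib S r" "w = u + (w - u)"
      using w u by (simp_all add: fib_def F_diff Phi_diff)
    then show "w \<in> fib S r \<oplus>\<^bsub>fin_tensor A S\<^esub> fib S s"
      unfolding fin_tensor_simps set_add_def' free_simps by blast
  qed
qed

lemma fin_tensor_zero: "fin S \<Longrightarrow> \<zero>\<^bsub>fin_tensor A S\<^esub> = fib S 0"
  by (simp add: fin_tensor_simps tensor_ideal_kernel fib_def)

lemma pure_tensor_fib: "fin S \<Longrightarrow> p \<in> basis_args S \<Longrightarrow> pure_tensor A S p = fib S (tau S p)"
  by (simp add: pure_tensor_def coset_fib F_basis Phi_basis)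

definition ext_args :: "'i set \<Rightarrow> 'i set \<Rightarrow> ('i \<Rightarrow> 'a) \<Rightarrow> 'i \<Rightarrow> 'a" where
  "ext_args S T p = (\<lambda>i\<in>T. if i \<in> S then p i else \<one>\<^bsub>A i\<^esub>)"

text \<open>
  Evaluation is compatible with the transition maps of the direct limit, since a unit in an additional
  place does not change the Kronecker product.
\<close>

lemma fill_units_fib:
  assumes T: "fin T" and ST: "S \<subseteq> T" and r: "r \<in> M S"
  shows "fill_units A S T (fib S r) = fib T r"
  unfolding fill_units_def
proof (rule union_fib[OF r])
  fix u assume u: "u \<in> F S" "Phi S u = r"
  let ?v = "\<lambda>q. \<Sum>p | u p \<noteq> 0 \<and> (\<lambda>i\<in>T. if i \<in> S then p i else \<one>\<^bsub>A i\<^esub>) = q. u p"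
  have v: "?v = (\<Sum>p | u p \<noteq> 0. fscale (u p) (basis_vec (ext_args S T p)))"
  proof
    fix q
    have "?v q = (\<Sum>p | u p \<noteq> 0. if ext_args S T p = q then u p else 0)"
      using F_fsupp[OF u(1)] by (subst sum.If_cases) (auto simp: ext_args_def Collect_conj_eq)
    also have "\<dots> = (\<Sum>p | u p \<noteq> 0. fscale (u p) (basis_vec (ext_args S T p))) q"
      unfolding sum_apply by (intro sum.cong) (auto simp: fscale_def basis_vec_def)
    finally show "?v q = (\<Sum>p | u p \<noteq> 0. fscale (u p) (basis_vec (ext_args S T p))) q" .
  qed
  have ext: "ext_args S T p \<in> basis_args T" if "p \<in> basis_args S" for p
    using PiE_mem[OF that] T unfolding ext_args_def restrict_PiE_iff by (simp add: A_closed(1) subset_iff)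
  have tau: "tau T (ext_args S T p) = tau S p" for p
    unfolding tau_extend[OF T ST, symmetric] by (rule tau_cong) (simp add: ext_args_def)
  have "?v \<in> F T" unfolding v using u by (intro F_sum F_scale F_basis ext) (auto simp: F_def)
  moreover have "Phi T ?v = r"
    unfolding v Phi_def lin_ext_combination tau u(2)[symmetric] by (simp add: lin_ext_def)
  ultimately show "tensor_ideal A T +>\<^bsub>free_tensor A T\<^esub> ?v = fib T r"
    by (simp add: coset_fib[OF T])
qed

text \<open>
  The model of the infinite tensor product: the union of the models of the finite ones.
\<close>

definition Msp :: "('i \<Rightarrow> nat, 'f) rfmat set" where
  "Msp = (\<Union>S\<in>finite_subsets I. M S)"

abbreviation B :: "('f, ('i, 'f, 'a) tensor) module" where
  "B \<equiv> inf_tensor A I"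

text \<open>
  The element of the direct limit that an element \<open>r\<close> of the model represents: all its incarnations in the
  finite tensor products.
\<close>

definition cls :: "('i \<Rightarrow> nat, 'f) rfmat \<Rightarrow> ('i, 'f, 'a) tensor" where
  "cls r = {(S, fib S r) | S. fin S \<and> r \<in> M S}"

lemma finite_subsets_fin: "S \<in> finite_subsets I \<longleftrightarrow> fin S"
  by (auto simp: finite_subsets_def)

text \<open>
  Two representatives agree at a later stage if and only if they have the same value in the model: a value
  determines the fibre at every stage where it occurs.
\<close>

lemma tensor_incl_fib:
  assumes S: "fin S" and r: "r \<in> M S"
  shows "tensor_incl A I S (fib S r) = cls r"
proof -
  have "((S, fib S r), (T, Y)) \<in> limit_rel (finite_subsets I) (fin_tensor A) (fill_units A)
      \<longleftrightarrow> fin T \<and> r \<in> M T \<and> Y = fib T r" for T Y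
  proof
    assume "((S, fib S r), (T, Y)) \<in> limit_rel (finite_subsets I) (fin_tensor A) (fill_units A)"
    then obtain s U where T: "fin T" and s: "s \<in> M T" "Y = fib T s"
      and U: "fin U" "S \<subseteq> U" "T \<subseteq> U" "fill_units A S U (fib S r) = fill_units A T U (fib T s)"
      by (auto simp: limit_rel_def finite_subsets_fin carrier_fin_tensor)
    then have "fib U r = fib U s" using r by (simp add: fill_units_fib)
    then have "r = s" using fib_inj M_mono[of U S] U r by blast
    then show "fin T \<and> r \<in> M T \<and> Y = fib T r" using T s by simp
  next
    assume *: "fin T \<and> r \<in> M T \<and> Y = fib T r"
    then have "fill_units A S (S \<union> T) (fib S r) = fill_units A T (S \<union> T) (fib T r)"
      using r S by (simp add: fill_units_fib)
    then show "((S, fib S r), (T, Y)) \<in> limit_rel (finite_subsets I) (fin_tensor A) (fill_units A)"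
      unfolding limit_rel_def finite_subsets_fin using * r S
      by (auto simp: finite_subsets_fin carrier_fin_tensor intro!: bexI[of _ "S \<union> T"])
  qed
  then show ?thesis
    unfolding tensor_incl_def limit_class_def cls_def by auto
qed

lemma MspE:
  assumes "r \<in> Msp"
  obtains S where "fin S" "r \<in> M S"
proof -
  from assms obtain S where "S \<in> finite_subsets I" "r \<in> M S" unfolding Msp_def by (rule UN_E)
  then show ?thesis using that unfolding finite_subsets_fin by blast
qed

lemma MspI: "fin S \<Longrightarrow> r \<in> M S \<Longrightarrow> r \<in> Msp"
  by (auto simp: Msp_def finite_subsets_fin)

lemma cls_inj: "inj_on cls Msp"
proof (rule inj_onI)
  fix r s assume "r \<in> Msp" and eq: "cls r = cls s"
  from \<open>r \<in> Msp\<close> obtain S where S: "fin S" "r \<in> M S" by (rule MspE)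
  then have "(S, fib S r) \<in> cls r" unfolding cls_def by simp
  then have "(S, fib S r) \<in> cls s" unfolding eq .
  then have "fib S r = fib S s" unfolding cls_def by blast
  then show "r = s" by (rule fib_inj[OF S(2)])
qed

lemma tensor_sub_cls: "fin S \<Longrightarrow> tensor_sub A I S = cls ` M S"
  unfolding tensor_sub_def
  by (simp add: carrier_fin_tensor image_image tensor_incl_fib cong: image_cong_simp)

lemma tensor_basis_cls:
  assumes S: "fin S" and E: "\<And>i. i \<in> S \<Longrightarrow> E i \<subseteq> carrier (A i)"
  shows "tensor_basis A I E S = (\<lambda>p. cls (tau S p)) ` (\<Pi>\<^sub>E i\<in>S. E i)"
proof -
  have "tensor_incl A I S (pure_tensor A S p) = cls (tau S p)" if "p \<in> (\<Pi>\<^sub>E i\<in>S. E i)" for p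
  proof -
    have "p \<in> basis_args S" using that E by blast
    then show ?thesis
      using S by (simp add: pure_tensor_fib tensor_incl_fib tau_in_M basis_args_args)
  qed
  then show ?thesis by (auto simp: tensor_basis_def)
qed

lemma limit_class_fib:
  "fin S \<Longrightarrow> r \<in> M S \<Longrightarrow> limit_class (finite_subsets I) (fin_tensor A) (fill_units A) S (fib S r) = cls r"
  using tensor_incl_fib by (simp add: tensor_incl_def)

text \<open>
  From here on \<open>cls\<close> is an isomorphism from \<open>Msp\<close> onto the infinite tensor product.
\<close>

lemma carrier_B: "carrier B = cls ` Msp"
proof -
  have "carrier B = (\<Union>S\<in>finite_subsets I. \<Union>X\<in>carrier (fin_tensor A S). {tensor_incl A I S X})"
    by (auto simp: inf_tensor_def direct_limit_def quotient_def tensor_incl_def limit_class_def)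
  also have "\<dots> = (\<Union>S\<in>finite_subsets I. cls ` M S)"
    by (intro SUP_cong refl) (auto simp: finite_subsets_fin carrier_fin_tensor tensor_incl_fib)
  finally show ?thesis by (simp add: Msp_def image_UN)
qed

lemma union_cls:
  "r \<in> Msp \<Longrightarrow> (\<And>S. fin S \<Longrightarrow> r \<in> M S \<Longrightarrow> f S (fib S r) = X) \<Longrightarrow> (\<Union>(S, x)\<in>cls r. f S x) = X"
  by (auto simp: cls_def elim!: MspE)

lemma B_mult:
  assumes r: "r \<in> Msp" and s: "s \<in> Msp"
  shows "cls r \<otimes>\<^bsub>B\<^esub> cls s = cls (r * s)"
  unfolding inf_tensor_def direct_limit_def monoid.simps
proof (rule union_cls[OF r], rule union_cls[OF s])
  fix S T assume S: "fin S" "r \<in> M S" and T: "fin T" "s \<in> M T"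
  have U: "fin (S \<union> T)" "r \<in> M (S \<union> T)" "s \<in> M (S \<union> T)"
    using S T M_mono[of "S \<union> T" S] M_mono[of "S \<union> T" T] by auto
  show "limit_class (finite_subsets I) (fin_tensor A) (fill_units A) (S \<union> T)
      (fill_units A S (S \<union> T) (fib S r) \<otimes>\<^bsub>fin_tensor A (S \<union> T)\<^esub> fill_units A T (S \<union> T) (fib T s)) =
    cls (r * s)"
    using S T U by (simp add: fill_units_fib fin_tensor_mult limit_class_fib M_mult)
qed

lemma B_add:
  assumes r: "r \<in> Msp" and s: "s \<in> Msp"
  shows "cls r \<oplus>\<^bsub>B\<^esub> cls s = cls (r + s)"
  unfolding inf_tensor_def direct_limit_def ring.simps
proof (rule union_cls[OF r], rule union_cls[OF s])
  fix S T assume S: "fin S" "r \<in> M S" and T: "fin T" "s \<in> M T"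
  have U: "fin (S \<union> T)" "r \<in> M (S \<union> T)" "s \<in> M (S \<union> T)"
    using S T M_mono[of "S \<union> T" S] M_mono[of "S \<union> T" T] by auto
  show "limit_class (finite_subsets I) (fin_tensor A) (fill_units A) (S \<union> T)
      (fill_units A S (S \<union> T) (fib S r) \<oplus>\<^bsub>fin_tensor A (S \<union> T)\<^esub> fill_units A T (S \<union> T) (fib T s)) =
    cls (r + s)"
    using S T U by (simp add: fill_units_fib fin_tensor_add limit_class_fib M_add)
qed

lemma B_smult:
  assumes r: "r \<in> Msp"
  shows "c \<odot>\<^bsub>B\<^esub> cls r = cls (scale c r)"
  unfolding inf_tensor_def direct_limit_def module.simps
  by (rule union_cls[OF r]) (simp add: fin_tensor_smult limit_class_fib M_scale)

lemma B_zero: "\<zero>\<^bsub>B\<^esub> = cls 0"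
proof -
  have "\<zero>\<^bsub>B\<^esub> = (\<Union>S\<in>finite_subsets I. cls 0)"
    unfolding inf_tensor_def direct_limit_def ring.simps
    by (intro SUP_cong refl) (simp add: finite_subsets_fin fin_tensor_zero limit_class_fib M_zero)
  moreover have "{} \<in> finite_subsets I" by (simp add: finite_subsets_fin)
  ultimately show ?thesis by blast
qed

end

section \<open>Matrix units, centralizers and derivations\<close>

definition commut :: "'r::ring_1 \<Rightarrow> 'r \<Rightarrow> 'r" where
  "commut a x = a * x - x * a"

context matrix_factors
begin

text \<open>The embedding of the \<open>i\<close>-th algebra into the model, and the images of its matrix units.\<close>

definition iota :: "'i \<Rightarrow> 'a \<Rightarrow> ('i \<Rightarrow> nat, 'f) rfmat" where
  "iota i a = tau {i} (\<lambda>_. a)"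

definition e :: "'i \<Rightarrow> nat \<times> nat \<Rightarrow> ('i \<Rightarrow> nat, 'f) rfmat" where
  "e i w = iota i (unit i w)"

lemma iota_eq: "i \<in> I \<Longrightarrow> iota i a = tau {i} p" if "p i = a"
  unfolding iota_def by (rule tau_cong) (simp add: that)

lemma iota_mult:
  assumes "i \<in> I" "a \<in> carrier (A i)" "b \<in> carrier (A i)"
  shows "iota i a * iota i b = iota i (a \<otimes>\<^bsub>A i\<^esub> b)"
  unfolding iota_def by (subst tau_mult) (use assms in \<open>auto simp: args_def intro: tau_cong\<close>)

lemma iota_one: "i \<in> I \<Longrightarrow> iota i \<one>\<^bsub>A i\<^esub> = 1"
  using tau_one[of "{i}"] by (simp add: iota_eq[symmetric])

lemma tau_insert:
  assumes S: "fin S" and i: "i \<in> I" "i \<notin> S" and p: "p \<in> args (insert i S)"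
  shows "iota i (p i) * tau S p = tau (insert i S) p" "tau S p * iota i (p i) = tau (insert i S) p"
proof -
  let ?T = "insert i S"
  let ?p = "\<lambda>j. if j \<in> S then p j else \<one>\<^bsub>A j\<^esub>" and ?q = "\<lambda>j. if j \<in> {i} then p i else \<one>\<^bsub>A j\<^esub>"
  have T: "fin ?T" using S i by simp
  have args: "?p \<in> args ?T" "?q \<in> args ?T"
    using p T by (auto simp: args_def intro: A_closed(1))
  have eq: "tau ?T ?p = tau S p" "tau ?T ?q = iota i (p i)"
    using tau_extend[OF T, of S p] tau_extend[OF T, of "{i}" "\<lambda>_. p i"] by (auto simp: iota_def)
  have one: "\<one>\<^bsub>A j\<^esub> \<otimes>\<^bsub>A j\<^esub> p j = p j" "p j \<otimes>\<^bsub>A j\<^esub> \<one>\<^bsub>A j\<^esub> = p j" if "j \<in> ?T" for j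
  proof -
    have j: "j \<in> I" "p j \<in> carrier (A j)" using that T p by (auto simp: args_def)
    interpret ring "A j" by (rule ring[OF j(1)])
    show "\<one>\<^bsub>A j\<^esub> \<otimes>\<^bsub>A j\<^esub> p j = p j" "p j \<otimes>\<^bsub>A j\<^esub> \<one>\<^bsub>A j\<^esub> = p j" using j by simp_all
  qed
  show "iota i (p i) * tau S p = tau ?T p"
    unfolding eq[symmetric] tau_mult[OF T args(2,1)] by (rule tau_cong) (use i one in auto)
  show "tau S p * iota i (p i) = tau ?T p"
    unfolding eq[symmetric] tau_mult[OF T args(1,2)] by (rule tau_cong) (use i one in auto)
qed

lemma iota_M: "i \<in> I \<Longrightarrow> a \<in> carrier (A i) \<Longrightarrow> iota i a \<in> M {i}"
  unfolding iota_def by (rule tau_in_M) (simp add: args_def)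

lemma e_M: "i \<in> I \<Longrightarrow> e i w \<in> M {i}"
  unfolding e_def by (rule iota_M) (simp_all add: unit_closed)

lemma e_mult:
  assumes i: "i \<in> I" and v: "v \<in> ixs i" and w: "w \<in> ixs i"
  shows "e i v * e i w = (if snd v = fst w then e i (fst v, snd w) else 0)"
proof -
  let ?N = "n i"
  have "rho i (unit i v \<otimes>\<^bsub>A i\<^esub> unit i w) = amp ?N (unit_mat ?N v * unit_mat ?N w)"
    by (simp add: rho_mult i unit_closed rho_unit amp_mult)
  also have "unit_mat ?N v * unit_mat ?N w
      = (if snd v = fst w then unit_mat ?N (fst v, snd w) else 0\<^sub>m ?N ?N :: 'f mat)"
  proof (rule eq_matI)
    fix k l assume "k < dim_row (if snd v = fst w then unit_mat ?N (fst v, snd w) else 0\<^sub>m ?N ?N :: 'f mat)"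
      "l < dim_col (if snd v = fst w then unit_mat ?N (fst v, snd w) else 0\<^sub>m ?N ?N :: 'f mat)"
    then have kl: "k < ?N" "l < ?N" by (auto simp: unit_mat_def split: if_splits)
    have "(unit_mat ?N v * unit_mat ?N w :: 'f mat) $$ (k, l)
        = (\<Sum>j<?N. (if (k, j) = v then 1 else 0) * (if (j, l) = w then 1 else 0))"
      using kl by (simp add: unit_mat_def scalar_prod_def lessThan_atLeast0)
    also have "\<dots> = (\<Sum>j<?N. if j = snd v then (if k = fst v \<and> snd v = fst w \<and> l = snd w then 1 else 0) else 0)"
      by (intro sum.cong refl; cases v; cases w) auto
    also have "\<dots> = (if k = fst v \<and> snd v = fst w \<and> l = snd w then 1 else 0)"
      using v by auto
    finally show "(unit_mat ?N v * unit_mat ?N w) $$ (k, l)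
        = (if snd v = fst w then unit_mat ?N (fst v, snd w) else 0\<^sub>m ?N ?N :: 'f mat) $$ (k, l)"
      using kl by (auto simp: unit_mat_def)
  qed (auto simp: unit_mat_def)
  also have "amp ?N \<dots> = (if snd v = fst w then rho i (unit i (fst v, snd w)) else 0)"
    by (auto simp: rho_unit i amp.rep_eq zero_rfmat.rep_eq n_pos intro!: rfmat_eqI)
  finally have *: "rho i (unit i v \<otimes>\<^bsub>A i\<^esub> unit i w)
      = (if snd v = fst w then rho i (unit i (fst v, snd w)) else 0)" .
  have "e i v * e i w = iota i (unit i v \<otimes>\<^bsub>A i\<^esub> unit i w)"
    by (simp add: e_def iota_mult i unit_closed)
  also have "\<dots> = kron {i} (\<lambda>_. if snd v = fst w then rho i (unit i (fst v, snd w)) else 0)"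
    unfolding iota_def tau_def by (rule kron_cong) (simp add: *)
  also have "\<dots> = (if snd v = fst w then e i (fst v, snd w) else 0)"
    by (auto simp: e_def iota_def tau_def kron.rep_eq zero_rfmat.rep_eq intro!: kron_cong rfmat_eqI)
  finally show ?thesis .
qed

lemma sum_e:
  assumes i: "i \<in> I"
  shows "(\<Sum>k<n i. e i (k, k)) = 1"
proof -
  have "(\<Sum>w\<in>ixs i. if fst w = snd w then e i w else 0)
      = (\<Sum>k<n i. \<Sum>l<n i. if k = l then e i (k, l) else 0)"
    unfolding sum.cartesian_product by (intro sum.cong) auto
  then have "(\<Sum>k<n i. e i (k, k)) = (\<Sum>w\<in>ixs i. if fst w = snd w then e i w else 0)"
    by simp
  also have "\<dots> = (\<Sum>w\<in>(\<Pi>\<^sub>E j\<in>{i}. ixs j). scale (coef {i} w 1) (mu {i} w))"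
  proof -
    have bij: "bij_betw (\<lambda>w. \<lambda>j\<in>{i}. w) (ixs i) (\<Pi>\<^sub>E j\<in>{i}. ixs j)"
      by (rule bij_betwI[where g = "\<lambda>f. f i"]) (auto simp: PiE_def extensional_def fun_eq_iff)
    have "scale (coef {i} (\<lambda>j\<in>{i}. w) 1) (mu {i} (\<lambda>j\<in>{i}. w))
        = (if fst w = snd w then e i w else 0)" for w
      by (auto simp: coef_def one_rfmat.rep_eq fun_eq_iff mu_def e_def iota_def intro!: tau_cong)
    then show ?thesis
      using sum.reindex_bij_betw[OF bij, of "\<lambda>w. scale (coef {i} w 1) (mu {i} w)"] by simp
  qed
  also have "\<dots> = 1" using M_expand[of "{i}" 1] M_one[of "{i}"] i by simp
  finally show ?thesis .
qed

lemma mu_insert: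
  assumes "fin S" "i \<in> I" "i \<notin> S"
  shows "mu (insert i S) w = e i (w i) * mu S w"
proof -
  have "(\<lambda>i. unit i (w i)) \<in> args (insert i S)"
    using assms by (auto simp: args_def unit_closed subset_iff)
  from tau_insert(1)[OF assms this] show ?thesis unfolding mu_def e_def by simp
qed

text \<open>
  Tensors of matrix units are products of matrix units in single places, so \<open>M S\<close> is generated as an
  algebra by the matrix units \<open>e j w\<close> with \<open>j \<in> S\<close>.
\<close>

lemma M_generated:
  assumes S: "fin S" and r: "r \<in> M S"
    and one: "Q 1"
    and gen: "\<And>j w. j \<in> S \<Longrightarrow> w \<in> ixs j \<Longrightarrow> Q (e j w)"
    and mult: "\<And>x y. x \<in> M S \<Longrightarrow> y \<in> M S \<Longrightarrow> Q x \<Longrightarrow> Q y \<Longrightarrow> Q (x * y)"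
    and add: "\<And>x y. x \<in> M S \<Longrightarrow> y \<in> M S \<Longrightarrow> Q x \<Longrightarrow> Q y \<Longrightarrow> Q (x + y)"
    and scale: "\<And>c x. x \<in> M S \<Longrightarrow> Q x \<Longrightarrow> Q (scale c x)"
  shows "Q r"
proof -
  have mu: "mu T w \<in> M S \<and> Q (mu T w)" if "finite T" "T \<subseteq> S" "\<And>i. i \<in> T \<Longrightarrow> w i \<in> ixs i" for T w
    using that
  proof (induction T rule: finite_induct)
    case empty
    then show ?case by (simp add: mu_def tau_empty M_one S one)
  next
    case (insert i T)
    have "fin T" "i \<in> I" using insert.prems S by (auto intro: finite_subset)
    moreover have "e i (w i) \<in> M S" using M_mono[OF S, of "{i}"] e_M insert.prems S by blast
    ultimately show ?case
      using insert mult gen by (simp add: mu_insert M_mult[OF S] del: mem_Times_iff)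
  qed
  have sum: "(\<Sum>w\<in>W. scale (c w) (mu S w)) \<in> M S \<and> Q (\<Sum>w\<in>W. scale (c w) (mu S w))"
    if "finite W" "W \<subseteq> (\<Pi>\<^sub>E i\<in>S. ixs i)" for W c
    using that
  proof (induction W rule: finite_induct)
    case empty
    show ?case using scale[OF M_one[OF S] one, of 0] by (simp add: M_zero)
  next
    case (insert w W)
    have "mu S w \<in> M S \<and> Q (mu S w)" using insert.prems S by (intro mu) auto
    then show ?case using insert by (simp add: M_add M_scale add scale)
  qed
  show ?thesis
    using sum[of "\<Pi>\<^sub>E i\<in>S. ixs i" "\<lambda>w. coef S w r"] M_expand[OF S r] S by (auto intro: finite_PiE)
qed

lemma commute_M:
  assumes S: "fin S" and r: "r \<in> M S"
    and c: "\<And>j w. j \<in> S \<Longrightarrow> w \<in> ixs j \<Longrightarrow> c * e j w = e j w * c"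
  shows "c * r = r * c"
  using S r
proof (rule M_generated)
  fix x y assume "c * x = x * c" "c * y = y * c"
  then show "c * (x * y) = x * y * c" by (metis mult.assoc)
next
  fix a x assume "c * x = x * c"
  then show "c * scale a x = scale a x * c" by (simp add: scale_mult_left scale_mult_right)
qed (use c in \<open>simp_all add: distrib_left distrib_right\<close>)

lemma iota_commute:
  assumes S: "fin S" and i: "i \<in> I" "i \<notin> S" and a: "a \<in> carrier (A i)" and r: "r \<in> M S"
  shows "iota i a * r = r * iota i a"
  using r unfolding M_def
proof (induction rule: rfmat.span_induct_alt)
  case base
  then show ?case by simp
next
  case (step c x y)
  then obtain p where p: "p \<in> args S" "x = tau S p" by blast
  have "p(i := a) \<in> args (insert i S)" using p(1) a by (auto simp: args_def)
  from tau_insert[OF S i this] have "iota i a * tau S (p(i := a)) = tau S (p(i := a)) * iota i a"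
    by simp
  moreover have "tau S (p(i := a)) = x" unfolding p(2) by (rule tau_cong) (use i in auto)
  ultimately show ?case
    using step.IH by (simp add: distrib_left distrib_right scale_mult_left scale_mult_right)
qed

lemma M_disjoint_commute:
  assumes S: "fin S" "r \<in> M S" and T: "fin T" "s \<in> M T" and disj: "S \<inter> T = {}"
  shows "r * s = s * r"
proof (rule commute_M[OF T])
  fix j w assume "j \<in> T"
  then have j: "j \<in> I" "j \<notin> S" using T disj by auto
  from iota_commute[OF S(1) j unit_closed[OF j(1)] S(2)] show "r * e j w = e j w * r"
    by (simp add: e_def)
qed

text \<open>
  The averaging map \<open>\<pi> x = (\<Sum>j<n i. e i (j, 0) * x * e i (0, j))\<close> replaces the \<open>i\<close>-th factor \<open>a\<close> of a tensor by
  the scalar \<open>a\<^sub>0\<^sub>0\<close>, so it maps \<open>M S\<close> into \<open>M (S - {i})\<close>. It fixes every element that commutes with the \<open>i\<close>-th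
  matrix units, because \<open>\<pi> r = r * (\<Sum>j<n i. e i (j, j)) = r\<close> for such an element.
\<close>

lemma centralizer_M:
  assumes S: "fin S" and r: "r \<in> M S" and i: "i \<in> I"
    and c: "\<And>w. w \<in> ixs i \<Longrightarrow> r * e i w = e i w * r"
  shows "r \<in> M (S - {i})"
proof (cases "i \<in> S")
  case True
  have S': "fin (S - {i})" "i \<notin> S - {i}" using S by auto
  define \<pi> where "\<pi> x = (\<Sum>j<n i. e i (j, 0) * x * e i (0, j))" for x
  have pos: "0 < n i" by (rule n_pos[OF i])
  have lin: "\<pi> (\<Sum>w\<in>W. scale (a w) (f w)) = (\<Sum>w\<in>W. scale (a w) (\<pi> (f w)))"
    for W and f :: "('i \<Rightarrow> nat \<times> nat) \<Rightarrow> ('i \<Rightarrow> nat, 'f) rfmat" and a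
    unfolding \<pi>_def sum_distrib_left sum_distrib_right rfmat.scale_sum_right
    by (subst sum.swap) (simp add: scale_mult_left scale_mult_right)
  have "\<pi> (mu S w) \<in> M (S - {i})" if w: "w \<in> (\<Pi>\<^sub>E i\<in>S. ixs i)" for w
  proof -
    let ?m = "mu (S - {i}) w"
    have wi: "w i \<in> ixs i" using w True by (rule PiE_mem)
    have m: "?m \<in> M (S - {i})"
      unfolding mu_def using S by (intro tau_in_M) (auto simp: args_def unit_closed)
    have mu: "mu S w = e i (w i) * ?m"
      using mu_insert[OF S'(1) i S'(2), of w] True by (simp add: insert_absorb)
    have comm: "?m * e i v = e i v * ?m" for v
      using iota_commute[OF S'(1) i S'(2) unit_closed[OF i] m, of v] by (simp add: e_def)
    have "e i (j, 0) * mu S w * e i (0, j) = (if w i = (0, 0) then e i (j, j) * ?m else 0)"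
      if j: "j < n i" for j
    proof -
      have "e i (j, 0) * mu S w * e i (0, j) = e i (j, 0) * e i (w i) * e i (0, j) * ?m"
        unfolding mu by (simp add: mult.assoc comm)
      also have "e i (j, 0) * e i (w i) * e i (0, j) = (if w i = (0, 0) then e i (j, j) else 0)"
        using j pos wi by (cases "w i") (auto simp: e_mult[OF i])
      finally show ?thesis by simp
    qed
    then have "\<pi> (mu S w) = (\<Sum>j<n i. if w i = (0, 0) then e i (j, j) * ?m else 0)"
      unfolding \<pi>_def by (intro sum.cong) auto
    also have "\<dots> = (if w i = (0, 0) then ?m else 0)"
      by (simp add: sum_distrib_right[symmetric] sum_e[OF i])
    finally show ?thesis by (simp add: m M_zero)
  qed
  then have "\<pi> r \<in> M (S - {i})"
    by (subst M_expand[OF S r]) (auto simp: lin intro!: M_sum M_scale)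
  also have "\<pi> r = r"
  proof -
    have "\<pi> r = (\<Sum>j<n i. r * (e i (j, 0) * e i (0, j)))"
      unfolding \<pi>_def using pos by (intro sum.cong refl) (simp add: c[symmetric] mult.assoc[symmetric])
    also have "\<dots> = r"
      using pos by (simp add: e_mult[OF i] sum_distrib_left[symmetric] sum_e[OF i])
    finally show ?thesis .
  qed
  finally show ?thesis .
qed (use r in simp)

lemma centralizer_M_finite:
  assumes "finite T" and S: "fin S" and r: "r \<in> M S" and T: "T \<subseteq> I"
    and c: "\<And>i w. i \<in> T \<Longrightarrow> w \<in> ixs i \<Longrightarrow> r * e i w = e i w * r"
  shows "r \<in> M (S - T)"
  using assms(1) T c
proof (induction T rule: finite_induct)
  case empty
  then show ?case using r by simp
next
  case (insert i T)
  have "r \<in> M (S - T)" using insert by simp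
  then have "r \<in> M (S - T - {i})" using insert.prems S by (intro centralizer_M) auto
  moreover have "S - T - {i} = S - insert i T" by auto
  ultimately show ?case by simp
qed

lemma Msp_closed:
  shows Msp_zero: "0 \<in> Msp" and Msp_one: "1 \<in> Msp"
    and Msp_add: "r \<in> Msp \<Longrightarrow> s \<in> Msp \<Longrightarrow> r + s \<in> Msp"
    and Msp_mult: "r \<in> Msp \<Longrightarrow> s \<in> Msp \<Longrightarrow> r * s \<in> Msp"
    and Msp_scale: "r \<in> Msp \<Longrightarrow> scale c r \<in> Msp"
    and Msp_diff: "r \<in> Msp \<Longrightarrow> s \<in> Msp \<Longrightarrow> r - s \<in> Msp"
proof -
  show "0 \<in> Msp" "1 \<in> Msp" using MspI[of "{}"] M_zero M_one by auto
  show "scale c r \<in> Msp" if "r \<in> Msp" using that by (auto elim!: MspE intro: MspI M_scale)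
  have *: "\<exists>U. fin U \<and> r \<in> M U \<and> s \<in> M U" if "r \<in> Msp" "s \<in> Msp" for r s
  proof -
    from that obtain S T where ST: "fin S" "r \<in> M S" "fin T" "s \<in> M T" by (meson MspE)
    then have "fin (S \<union> T)" by auto
    then show ?thesis using M_mono[of "S \<union> T" S] M_mono[of "S \<union> T" T] ST by blast
  qed
  show "r + s \<in> Msp" "r * s \<in> Msp" "r - s \<in> Msp" if rs: "r \<in> Msp" "s \<in> Msp" for r s
    using *[OF rs] by (blast intro: MspI M_add M_mult M_diff)+
qed

lemma Msp_sum: "(\<And>k. k \<in> K \<Longrightarrow> f k \<in> Msp) \<Longrightarrow> sum f K \<in> Msp"
  by (induction K rule: infinite_finite_induct) (simp_all add: Msp_zero Msp_add)

lemma e_Msp: "i \<in> I \<Longrightarrow> e i w \<in> Msp"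
  using MspI[of "{i}"] e_M by simp

lemma commut_Msp: "a \<in> Msp \<Longrightarrow> r \<in> Msp \<Longrightarrow> commut a r \<in> Msp"
  unfolding commut_def by (intro Msp_diff Msp_mult)

definition derivation :: "(('i \<Rightarrow> nat, 'f) rfmat \<Rightarrow> ('i \<Rightarrow> nat, 'f) rfmat) \<Rightarrow> bool" where
  "derivation \<delta> \<longleftrightarrow> (\<forall>r\<in>Msp. \<delta> r \<in> Msp) \<and> (\<forall>r\<in>Msp. \<forall>s\<in>Msp. \<delta> (r + s) = \<delta> r + \<delta> s) \<and>
     (\<forall>c. \<forall>r\<in>Msp. \<delta> (scale c r) = scale c (\<delta> r)) \<and>
     (\<forall>r\<in>Msp. \<forall>s\<in>Msp. \<delta> (r * s) = \<delta> r * s + r * \<delta> s)"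

lemma derivationD:
  assumes "derivation \<delta>"
  shows "r \<in> Msp \<Longrightarrow> \<delta> r \<in> Msp"
    and "r \<in> Msp \<Longrightarrow> s \<in> Msp \<Longrightarrow> \<delta> (r + s) = \<delta> r + \<delta> s"
    and "r \<in> Msp \<Longrightarrow> \<delta> (scale c r) = scale c (\<delta> r)"
    and "r \<in> Msp \<Longrightarrow> s \<in> Msp \<Longrightarrow> \<delta> (r * s) = \<delta> r * s + r * \<delta> s"
  using assms by (auto simp: derivation_def)

lemma derivation_one:
  assumes "derivation \<delta>"
  shows "\<delta> 1 = 0"
  using derivationD(4)[OF assms Msp_one Msp_one] by simp

lemma derivation_zero:
  assumes "derivation \<delta>"
  shows "\<delta> 0 = 0"
  using derivationD(2)[OF assms Msp_zero Msp_zero] by simp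

lemma derivation_commut: "a \<in> Msp \<Longrightarrow> derivation (commut a)"
  by (simp add: derivation_def commut_Msp)
    (simp add: commut_def algebra_simps scale_mult_left scale_mult_right rfmat.scale_right_diff_distrib)

lemma derivation_diff:
  assumes "derivation \<delta>" "derivation \<epsilon>"
  shows "derivation (\<lambda>r. \<delta> r - \<epsilon> r)"
  unfolding derivation_def
  by (simp add: derivationD[OF assms(1)] derivationD[OF assms(2)] Msp_diff
      rfmat.scale_right_diff_distrib algebra_simps)

lemma derivation_vanish_M:
  assumes \<delta>: "derivation \<delta>" and S: "fin S" and r: "r \<in> M S"
    and van: "\<And>j w. j \<in> S \<Longrightarrow> w \<in> ixs j \<Longrightarrow> \<delta> (e j w) = 0"
  shows "\<delta> r = 0"
  using S r
  by (rule M_generated)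
    (simp_all add: derivation_one[OF \<delta>] van derivationD[OF \<delta>] MspI[OF S])

text \<open>
  The classical element that makes a derivation inner on a matrix algebra, here on the \<open>i\<close>-th one. It is
  computed from the values of the derivation on the first column of matrix units.
\<close>

definition inner_part where
  "inner_part i \<delta> = (\<Sum>k<n i. \<delta> (e i (k, 0)) * e i (0, k))"

lemma inner_part_Msp:
  assumes "derivation \<delta>" "i \<in> I"
  shows "inner_part i \<delta> \<in> Msp"
  unfolding inner_part_def
  by (intro Msp_sum) (simp add: Msp_mult derivationD(1)[OF assms(1)] e_Msp assms(2))

text \<open>
  In \<open>e i w * inner_part i \<delta>\<close> the Leibniz rule moves \<open>\<delta>\<close> from \<open>e i (m, 0)\<close> to the product \<open>e i w * e i (m, 0)\<close>,
  which is \<open>e i (k, 0)\<close> for one \<open>m\<close> and \<open>0\<close> otherwise, and to \<open>e i w\<close>; the second contribution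
  sums up to \<open>\<delta> (e i w)\<close>.
\<close>

lemma commut_inner_part:
  assumes \<delta>: "derivation \<delta>" and i: "i \<in> I" and w: "w \<in> ixs i"
  shows "commut (inner_part i \<delta>) (e i w) = \<delta> (e i w)"
proof -
  obtain k l where kl: "w = (k, l)" "k < n i" "l < n i" using w by auto
  have pos: "0 < n i" by (rule n_pos[OF i])
  have "inner_part i \<delta> * e i w = (\<Sum>m<n i. \<delta> (e i (m, 0)) * (if m = k then e i (0, l) else 0))"
    unfolding inner_part_def sum_distrib_right kl(1)
    using kl pos by (intro sum.cong) (auto simp: mult.assoc e_mult[OF i])
  also have "\<dots> = \<delta> (e i (k, 0)) * e i (0, l)"
    using kl by (simp add: if_distrib[of "\<lambda>x. _ * x"] cong: if_cong)
  finally have 1: "inner_part i \<delta> * e i w = \<delta> (e i (k, 0)) * e i (0, l)" .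
  have "e i w * \<delta> (e i (m, 0)) * e i (0, m)
      = (if m = l then \<delta> (e i (k, 0)) * e i (0, l) else 0) - \<delta> (e i w) * e i (m, m)"
    if m: "m < n i" for m
  proof -
    have "e i w * \<delta> (e i (m, 0)) = \<delta> (e i w * e i (m, 0)) - \<delta> (e i w) * e i (m, 0)"
      by (simp add: derivationD(4)[OF \<delta>] e_Msp i)
    also have "e i w * e i (m, 0) = (if m = l then e i (k, 0) else 0)"
      using m kl pos by (auto simp: e_mult[OF i])
    finally show ?thesis
      using m pos by (auto simp: left_diff_distrib mult.assoc e_mult[OF i] derivation_zero[OF \<delta>])
  qed
  then have "e i w * inner_part i \<delta> = \<delta> (e i (k, 0)) * e i (0, l) - \<delta> (e i w)"
    unfolding inner_part_def sum_distrib_left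
    using kl by (simp add: mult.assoc[symmetric] sum_subtractf sum_distrib_left[symmetric] sum_e[OF i])
  then show ?thesis by (simp add: commut_def 1)
qed

text \<open>
  Applying \<open>\<delta>\<close> to \<open>e i w * e j v = e j v * e i w\<close> shows that all \<open>\<delta> (e i w)\<close> commute with \<open>e j v\<close> if \<open>\<delta>\<close>
  vanishes there. So making a derivation vanish in a new place does not spoil the places treated before.
\<close>

lemma inner_part_commute:
  assumes \<delta>: "derivation \<delta>" and i: "i \<in> I" and j: "j \<in> I" "i \<noteq> j"
    and van: "\<And>v. v \<in> ixs j \<Longrightarrow> \<delta> (e j v) = 0" and v: "v \<in> ixs j"
  shows "inner_part i \<delta> * e j v = e j v * inner_part i \<delta>"
proof -
  have comm: "e i w * e j v = e j v * e i w" for w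
    using M_disjoint_commute[of "{i}" "e i w" "{j}" "e j v"] e_M i j by simp
  have "\<delta> (e i w) * e j v = e j v * \<delta> (e i w)" for w
    using arg_cong[OF comm, of \<delta> w] by (simp add: derivationD(4)[OF \<delta>] e_Msp i j van v)
  moreover have "x * y * z = z * (x * y)" if "x * z = z * x" "y * z = z * y"
    for x y z :: "('i \<Rightarrow> nat, 'f) rfmat"
    using that by (metis mult.assoc)
  ultimately show ?thesis
    unfolding inner_part_def sum_distrib_left sum_distrib_right
    using comm by (intro sum.cong refl) blast
qed

text \<open>
  Subtract from \<open>\<delta>\<close>, place after place, the inner derivation that agrees with it there. The \<open>m\<close>-th
  correction \<open>a m\<close> commutes with the matrix units in the first \<open>m\<close> places, so \<open>centralizer_M\<close> removes these
  places from its support. After \<open>k\<close> steps the remaining derivation vanishes on the matrix units in the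
  first \<open>k\<close> places, hence on the algebra that they generate. Putting \<open>ix m\<close> into \<open>S m\<close> makes the sets
  nonempty and pairwise distinct.
\<close>

lemma derivation_decomposition:
  assumes \<delta>: "derivation \<delta>" and ix: "bij_betw ix (UNIV :: nat set) I"
  shows "\<exists>S a. (\<forall>m. fin (S m) \<and> ix m \<in> S m \<and> (\<forall>j<m. ix j \<notin> S m) \<and> a m \<in> M (S m)) \<and>
    (\<forall>k. \<forall>r\<in>M (ix ` {..<k}). \<delta> r = (\<Sum>m<k. commut (a m) r))"
proof -
  have ixI: "ix m \<in> I" for m using ix by (auto simp: bij_betw_def)
  have ix_inj: "ix m = ix j \<longleftrightarrow> m = j" for m j using ix by (auto simp: bij_betw_def inj_on_def)
  define D where "D = rec_nat \<delta> (\<lambda>m \<epsilon> r. \<epsilon> r - commut (inner_part (ix m) \<epsilon>) r)"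
  define a where "a m = inner_part (ix m) (D m)" for m
  have D0: "D 0 = \<delta>" by (simp add: D_def)
  have DS: "D (Suc m) r = D m r - commut (a m) r" for m r by (simp add: D_def a_def)
  have D: "derivation (D m)" for m
  proof (induction m)
    case (Suc m)
    have "D (Suc m) = (\<lambda>r. D m r - commut (a m) r)" by (simp add: fun_eq_iff DS)
    then show ?case using Suc by (simp add: derivation_diff derivation_commut a_def inner_part_Msp ixI)
  qed (simp add: D0 \<delta>)
  have aM: "a m \<in> Msp" for m unfolding a_def by (rule inner_part_Msp[OF D ixI])
  have van: "D m (e (ix j) v) = 0" if "j < m" "v \<in> ixs (ix j)" for m j v
    using that
  proof (induction m arbitrary: j v)
    case (Suc m)
    show ?case
    proof (cases "j = m")
      case True
      then show ?thesis using commut_inner_part[OF D ixI Suc.prems(2)] by (simp add: DS a_def)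
    next
      case False
      then have j: "j < m" using Suc.prems by simp
      have "a m * e (ix j) v = e (ix j) v * a m"
        unfolding a_def
        by (rule inner_part_commute[OF D ixI ixI]) (use j Suc ix_inj in auto)
      then show ?thesis using Suc.IH[OF j Suc.prems(2)] by (simp add: DS commut_def)
    qed
  qed simp
  have comm: "a m * e (ix j) v = e (ix j) v * a m" if "j < m" "v \<in> ixs (ix j)" for m j v
    unfolding a_def by (rule inner_part_commute[OF D ixI ixI]) (use that van ix_inj in auto)
  have "\<exists>S. fin S \<and> ix m \<in> S \<and> (\<forall>j<m. ix j \<notin> S) \<and> a m \<in> M S" for m
  proof -
    obtain T where T: "fin T" "a m \<in> M T" using aM by (rule MspE)
    \<comment> \<open>Adding \<open>ix m\<close> to the support keeps it from becoming empty when earlier places are removed.\<close>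
    let ?T = "insert (ix m) T"
    have T': "fin ?T" using T ixI by auto
    have "a m \<in> M ?T" using M_mono[OF T', of T] T by auto
    then have "a m \<in> M (?T - ix ` {..<m})"
      by (intro centralizer_M_finite T') (use comm ixI in auto)
    then show ?thesis using T' by (intro exI[of _ "?T - ix ` {..<m}"]) (auto simp: ix_inj)
  qed
  then obtain S where S: "\<And>m. fin (S m) \<and> ix m \<in> S m \<and> (\<forall>j<m. ix j \<notin> S m) \<and> a m \<in> M (S m)"
    by metis
  have Dsum: "D k r = \<delta> r - (\<Sum>m<k. commut (a m) r)" for k r
    by (induction k) (simp_all add: D0 DS)
  have "\<delta> r = (\<Sum>m<k. commut (a m) r)" if r: "r \<in> M (ix ` {..<k})" for k r
  proof -
    have "fin (ix ` {..<k})" using ixI by auto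
    then have "D k r = 0" using r by (rule derivation_vanish_M[OF D]) (use van in auto)
    then show ?thesis by (simp add: Dsum)
  qed
  then show ?thesis using S by (intro exI[of _ S] exI[of _ a]) blast
qed

end

section \<open>Bases of complements of the units\<close>

context matrix_factors
begin

lemma rho_zero: "i \<in> I \<Longrightarrow> rho i \<zero>\<^bsub>A i\<^esub> = 0"
proof -
  assume i: "i \<in> I"
  interpret ring "A i" by (rule ring[OF i])
  have "rho i (\<zero>\<^bsub>A i\<^esub> \<oplus>\<^bsub>A i\<^esub> \<zero>\<^bsub>A i\<^esub>) = rho i \<zero>\<^bsub>A i\<^esub> + rho i \<zero>\<^bsub>A i\<^esub>"
    by (rule rho_add[OF i]) simp_all
  then show ?thesis by simp
qed

lemma zero_neq_one: "i \<in> I \<Longrightarrow> \<zero>\<^bsub>A i\<^esub> \<noteq> \<one>\<^bsub>A i\<^esub>"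
  using rho_zero[of i] rho_one[of i] by auto

lemma rho_inj_on: "i \<in> I \<Longrightarrow> inj_on (rho i) (carrier (A i))"
  using rho_inj by (auto simp: inj_on_def)

lemma rho_lincomb:
  assumes i: "i \<in> I" and X: "finite X" "X \<subseteq> carrier (A i)"
  shows "rho i (LinearCombinations.module.lincomb (A i) c X) = (\<Sum>x\<in>X. scale (c x) (rho i x))"
    (is "?L X = _")
  using X
proof (induction X rule: finite_induct)
  case empty
  interpret Module.module class_ring "A i" by (rule module[OF i])
  show ?case by (simp add: lincomb_def rho_zero i)
next
  case (insert x X)
  interpret Module.module class_ring "A i" by (rule module[OF i])
  have "lincomb c (insert x X) = c x \<odot>\<^bsub>A i\<^esub> x \<oplus>\<^bsub>A i\<^esub> lincomb c X"
    unfolding lincomb_def using insert A_closed(5)[OF i] by (intro finsum_insert) auto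
  moreover have "lincomb c X \<in> carrier (A i)"
    unfolding lincomb_def using insert.prems A_closed(5)[OF i] by (intro finsum_closed) auto
  ultimately show ?case using insert A_closed(5)[OF i] by (simp add: rho_add rho_smult i)
qed

text \<open>
  \<open>E\<close> together with the unit is a basis of the \<open>i\<close>-th algebra, expressed in the vector space of matrices.
\<close>

definition unit_complement_basis :: "'i \<Rightarrow> 'a set \<Rightarrow> bool" where
  "unit_complement_basis i E \<longleftrightarrow> E \<subseteq> carrier (A i) \<and> \<one>\<^bsub>A i\<^esub> \<notin> E \<and>
     rfmat.independent (rho i ` insert \<one>\<^bsub>A i\<^esub> E) \<and>
     rho i ` carrier (A i) \<subseteq> rfmat.span (rho i ` insert \<one>\<^bsub>A i\<^esub> E)"

lemma unit_complement_basisI: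
  assumes i: "i \<in> I"
    and dec: "direct_sum_decomp (A i) (range (\<lambda>c. c \<odot>\<^bsub>A i\<^esub> \<one>\<^bsub>A i\<^esub>)) A0"
    and basis: "vectorspace.basis class_ring (A i\<lparr>carrier := A0\<rparr>) E"
  shows "unit_complement_basis i E"
proof -
  interpret V: vectorspace class_ring "A i" using algebra[OF i] by (simp add: unital_algebra_def)
  interpret R: ring "A i" by (rule ring[OF i])
  have sub: "VectorSpace.subspace class_ring A0 (A i)"
    and sum: "V.submodule_sum (range (\<lambda>c. c \<odot>\<^bsub>A i\<^esub> \<one>\<^bsub>A i\<^esub>)) A0 = carrier (A i)"
    and int: "range (\<lambda>c. c \<odot>\<^bsub>A i\<^esub> \<one>\<^bsub>A i\<^esub>) \<inter> A0 = {\<zero>\<^bsub>A i\<^esub>}"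
    using dec by (auto simp: direct_sum_decomp_def)
  have smod: "LinearCombinations.submodule class_ring A0 (A i)"
    using sub by (simp add: VectorSpace.subspace_def)
  then have A0: "A0 \<subseteq> carrier (A i)" by (simp add: LinearCombinations.submodule_def)
  interpret W: vectorspace class_ring "A i\<lparr>carrier := A0\<rparr>"
    by (rule V.subspace_is_vs[OF sub])
  have E: "E \<subseteq> A0" "\<not> W.lin_dep E" "W.span E = A0"
    using basis unfolding W.basis_def by auto
  have li: "\<not> V.lin_dep E" and span: "V.span E = A0"
    using E V.span_li_not_depend[OF E(1) smod] by auto
  have Ec: "E \<subseteq> carrier (A i)" using E(1) A0 by blast
  have inj: "inj_on (rho i) (carrier (A i))" by (rule rho_inj_on[OF i])
  have indep: "rfmat.independent (rho i ` E)"
  proof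
    assume "rfmat.dependent (rho i ` E)"
    then obtain t u v where t: "finite t" "t \<subseteq> rho i ` E" "(\<Sum>v\<in>t. scale (u v) v) = 0"
      and v: "v \<in> t" "u v \<noteq> 0"
      unfolding rfmat.dependent_explicit by blast
    obtain X where X: "X \<subseteq> E" "finite X" "t = rho i ` X"
      using finite_subset_image[OF t(1,2)] by blast
    have injX: "inj_on (rho i) X" using inj X(1) Ec by (meson inj_on_subset subset_trans)
    have XC: "X \<subseteq> carrier (A i)" using X(1) Ec by blast
    obtain x where x: "x \<in> X" "v = rho i x" using v X(3) by blast
    have "rho i (V.lincomb (\<lambda>x. u (rho i x)) X) = 0"
      using t(3) unfolding rho_lincomb[OF i X(2) XC] X(3) sum.reindex[OF injX] by simp
    then have "V.lincomb (\<lambda>x. u (rho i x)) X = \<zero>\<^bsub>A i\<^esub>"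
      using XC by (intro rho_inj[OF i]) (simp_all add: rho_zero i)
    then have "V.lin_dep E"
      unfolding V.lin_dep_def using X x v
      by (intro exI[of _ X] exI[of _ "\<lambda>x. u (rho i x)"] exI[of _ x]) auto
    then show False using li by blast
  qed
  have subsp: "rfmat.subspace (rho i ` A0)"
  proof (rule rfmat.subspaceI)
    have "\<zero>\<^bsub>A i\<^esub> \<in> A0" using smod by (simp add: LinearCombinations.submodule_def)
    then show "0 \<in> rho i ` A0" using rho_zero[OF i] by (metis image_eqI)
  next
    fix x y assume "x \<in> rho i ` A0" "y \<in> rho i ` A0"
    then obtain a b where ab: "a \<in> A0" "b \<in> A0" "x = rho i a" "y = rho i b" by blast
    then have "a \<oplus>\<^bsub>A i\<^esub> b \<in> A0" using smod by (simp add: LinearCombinations.submodule_def)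
    moreover have "rho i (a \<oplus>\<^bsub>A i\<^esub> b) = x + y" using ab A0 by (simp add: rho_add[OF i] subset_iff)
    ultimately show "x + y \<in> rho i ` A0" by (metis image_eqI)
  next
    fix c x assume "x \<in> rho i ` A0"
    then obtain a where a: "a \<in> A0" "x = rho i a" by blast
    then have "c \<odot>\<^bsub>A i\<^esub> a \<in> A0" using smod by (simp add: LinearCombinations.submodule_def)
    moreover have "rho i (c \<odot>\<^bsub>A i\<^esub> a) = scale c x" using a A0 by (simp add: rho_smult[OF i] subset_iff)
    ultimately show "scale c x \<in> rho i ` A0" by (metis image_eqI)
  qed
  have one: "1 \<notin> rfmat.span (rho i ` E)"
  proof
    assume "1 \<in> rfmat.span (rho i ` E)"
    moreover have "rfmat.span (rho i ` E) \<subseteq> rho i ` A0"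
      by (intro rfmat.span_minimal subsp image_mono E)
    ultimately obtain a where a: "a \<in> A0" "rho i a = rho i \<one>\<^bsub>A i\<^esub>"
      using rho_one[OF i] by auto
    then have "\<one>\<^bsub>A i\<^esub> \<in> A0" using rho_inj[OF i _ _ a(2)] A0 by auto
    moreover have "\<one>\<^bsub>A i\<^esub> = 1 \<odot>\<^bsub>A i\<^esub> \<one>\<^bsub>A i\<^esub>" using V.smult_one[of "\<one>\<^bsub>A i\<^esub>"] by simp
    ultimately have "\<one>\<^bsub>A i\<^esub> = \<zero>\<^bsub>A i\<^esub>" using int by blast
    then show False using zero_neq_one[OF i] by simp
  qed
  have "rho i \<one>\<^bsub>A i\<^esub> \<notin> rho i ` E" using one rho_one[OF i] rfmat.span_base by metis
  then have ind: "rfmat.independent (rho i ` insert \<one>\<^bsub>A i\<^esub> E)"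
    using indep one by (simp add: rfmat.independent_insert rho_one i)
  have span_A0: "rho i ` A0 \<subseteq> rfmat.span (rho i ` E)"
  proof safe
    fix a assume "a \<in> A0"
    then obtain X c where X: "finite X" "X \<subseteq> E" "a = V.lincomb c X"
      unfolding span[symmetric] V.span_def by blast
    have XC: "X \<subseteq> carrier (A i)" using X(2) Ec by blast
    show "rho i a \<in> rfmat.span (rho i ` E)"
      unfolding X(3) rho_lincomb[OF i X(1) XC]
      using X(2) by (intro rfmat.span_sum rfmat.span_scale rfmat.span_base) auto
  qed
  have "rho i ` carrier (A i) \<subseteq> rfmat.span (rho i ` insert \<one>\<^bsub>A i\<^esub> E)" (is "_ \<subseteq> ?span")
  proof safe
    fix a assume "a \<in> carrier (A i)"
    then obtain c b where b: "b \<in> A0" "a = c \<odot>\<^bsub>A i\<^esub> \<one>\<^bsub>A i\<^esub> \<oplus>\<^bsub>A i\<^esub> b"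
      unfolding sum[symmetric] V.submodule_sum_def by auto
    have "rho i b \<in> ?span"
      using span_A0 b(1) rfmat.span_mono[of "rho i ` E" "rho i ` insert \<one>\<^bsub>A i\<^esub> E"] by blast
    moreover have "rho i a = scale c (rho i \<one>\<^bsub>A i\<^esub>) + rho i b"
      using b A0 by (simp add: rho_add[OF i] rho_smult[OF i] subset_iff A_closed(5)[OF i])
    moreover have "rho i \<one>\<^bsub>A i\<^esub> \<in> ?span" by (intro rfmat.span_base imageI insertI1)
    ultimately show "rho i a \<in> ?span"
      by (simp only: rfmat.span_add rfmat.span_scale)
  qed
  then show ?thesis
    using Ec ind one rfmat.span_base[of 1 "rho i ` E"] rho_one[OF i]
    unfolding unit_complement_basis_def by (metis image_eqI)
qed

lemma unit_complement_basis_finite: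
  assumes i: "i \<in> I" and E: "unit_complement_basis i E"
  shows "finite E"
proof -
  let ?F = "(\<lambda>w. rho i (unit i w)) ` ixs i"
  have "rho i ` insert \<one>\<^bsub>A i\<^esub> E \<subseteq> rfmat.span ?F"
  proof (rule image_subsetI)
    fix x assume "x \<in> insert \<one>\<^bsub>A i\<^esub> E"
    then have "x \<in> carrier (A i)" using E A_closed(1)[OF i] by (auto simp: unit_complement_basis_def)
    then show "rho i x \<in> rfmat.span ?F"
      by (subst rho_expand[OF i], assumption)
        (intro rfmat.span_sum rfmat.span_scale rfmat.span_base imageI)
  qed
  moreover have "rfmat.independent (rho i ` insert \<one>\<^bsub>A i\<^esub> E)"
    using E unfolding unit_complement_basis_def by blast
  ultimately have "finite (rho i ` insert \<one>\<^bsub>A i\<^esub> E)"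
    using rfmat.independent_span_bound[of ?F "rho i ` insert \<one>\<^bsub>A i\<^esub> E"] by blast
  moreover have "insert \<one>\<^bsub>A i\<^esub> E \<subseteq> carrier (A i)"
    using E A_closed(1)[OF i] unfolding unit_complement_basis_def by blast
  then have "inj_on (rho i) (insert \<one>\<^bsub>A i\<^esub> E)" by (rule inj_on_subset[OF rho_inj_on[OF i]])
  ultimately have "finite (insert \<one>\<^bsub>A i\<^esub> E)" by (rule finite_imageD)
  then show ?thesis by simp
qed

text \<open>
  A coordinate functional of the basis \<open>insert \<one> E\<close>, written out by its values \<open>D w\<close> on matrix units.
\<close>

lemma dual_functional:
  assumes i: "i \<in> I" and E: "unit_complement_basis i E" and a: "a \<in> insert \<one>\<^bsub>A i\<^esub> E"
  shows "\<exists>D. \<forall>b\<in>insert \<one>\<^bsub>A i\<^esub> E. (\<Sum>w\<in>ixs i. D w * val i w b) = (if b = a then 1 else 0)"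
proof -
  let ?F = "rho i ` insert \<one>\<^bsub>A i\<^esub> E"
  have ind: "rfmat.independent ?F" and span: "rho i ` carrier (A i) \<subseteq> rfmat.span ?F"
    and sub: "insert \<one>\<^bsub>A i\<^esub> E \<subseteq> carrier (A i)"
    using E A_closed(1)[OF i] by (auto simp: unit_complement_basis_def)
  define D where "D w = rfmat.representation ?F (rho i (unit i w)) (rho i a)" for w
  have in_span: "rho i (unit i w) \<in> rfmat.span ?F" for w
    using span unit_closed[OF i] by blast
  have "(\<Sum>w\<in>ixs i. D w * val i w b) = (if b = a then 1 else 0)" if b: "b \<in> insert \<one>\<^bsub>A i\<^esub> E" for b
  proof -
    have bc: "b \<in> carrier (A i)" and ac: "a \<in> carrier (A i)" using a b sub by blast+
    have inj: "rho i a = rho i b \<longleftrightarrow> b = a"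
      using inj_on_eq_iff[OF rho_inj_on[OF i] bc ac] by auto
    have "(if b = a then 1 else 0) = rfmat.representation ?F (rho i b) (rho i a)"
      unfolding rfmat.representation_basis[OF ind imageI[OF b]] inj ..
    also have "\<dots> = (\<Sum>w\<in>ixs i. rfmat.representation ?F (scale (val i w b) (rho i (unit i w))) (rho i a))"
      by (subst rho_expand[OF i bc], subst rfmat.representation_sum[OF ind])
        (rule rfmat.span_scale[OF in_span], rule refl)
    also have "\<dots> = (\<Sum>w\<in>ixs i. D w * val i w b)"
      unfolding rfmat.representation_scale[OF ind in_span] D_def by (simp only: mult.commute)
    finally show ?thesis by simp
  qed
  then show ?thesis by blast
qed

text \<open>
  The tensor product of the functionals on the single algebras that are given by their values \<open>D i\<close> on
  matrix units.
\<close>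

definition tensor_functional ::
  "'i set \<Rightarrow> ('i \<Rightarrow> nat \<times> nat \<Rightarrow> 'f) \<Rightarrow> ('i \<Rightarrow> nat, 'f) rfmat \<Rightarrow> 'f" where
  "tensor_functional U D r = (\<Sum>w\<in>(\<Pi>\<^sub>E i\<in>U. ixs i). (\<Prod>i\<in>U. D i (w i)) * coef U w r)"

lemma tensor_functional_linear:
  "tensor_functional U D (r + s) = tensor_functional U D r + tensor_functional U D s"
  "tensor_functional U D (scale c r) = c * tensor_functional U D r"
  "tensor_functional U D 0 = 0"
  by (simp_all add: tensor_functional_def coef_add coef_scale coef_zero distrib_left sum.distrib
      sum_distrib_left mult.left_commute)

lemma tensor_functional_sum:
  "tensor_functional U D (\<Sum>k\<in>K. scale (c k) (f k)) = (\<Sum>k\<in>K. c k * tensor_functional U D (f k))"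
  by (induction K rule: infinite_finite_induct) (simp_all add: tensor_functional_linear)

lemma tensor_functional_tau:
  assumes U: "fin U" and T: "T \<subseteq> U"
  shows "tensor_functional U D (tau T p)
    = (\<Prod>i\<in>U. \<Sum>w\<in>ixs i. D i w * val i w (if i \<in> T then p i else \<one>\<^bsub>A i\<^esub>))"
proof -
  have "tensor_functional U D (tau T p) = (\<Sum>w\<in>(\<Pi>\<^sub>E i\<in>U. ixs i).
      \<Prod>i\<in>U. D i (w i) * val i (w i) (if i \<in> T then p i else \<one>\<^bsub>A i\<^esub>))"
    unfolding tau_extend[OF U T, symmetric] tensor_functional_def
    using U by (simp add: coef_tau prod.distrib)
  then show ?thesis using U by (simp add: prod_sum_PiE)
qed

text \<open>
  Take in each place the coordinate functional of the basis element that occurs in the given tensor, which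
  is the unit in the places outside \<open>T\<close>. The product of these functionals is dual to the given tensor. In a
  place \<open>i \<in> T\<close> the chosen functional vanishes on the unit, so the product vanishes on all tensors
  with a unit there.
\<close>

lemma dual_tensor_functional:
  assumes U: "fin U" and E: "\<And>i. i \<in> U \<Longrightarrow> unit_complement_basis i (E i)"
    and T: "T \<subseteq> U" and q: "q \<in> (\<Pi>\<^sub>E i\<in>T. E i)"
  obtains D where
    "\<And>T' q'. T' \<subseteq> U \<Longrightarrow> q' \<in> (\<Pi>\<^sub>E i\<in>T'. E i) \<Longrightarrow>
       tensor_functional U D (tau T' q') = (if T' = T \<and> q' = q then 1 else 0)"
    "\<And>i r. i \<in> T \<Longrightarrow> r \<in> M (U - {i}) \<Longrightarrow> tensor_functional U D r = 0"
proof -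
  let ?x = "\<lambda>T q i. if i \<in> T then q i else \<one>\<^bsub>A i\<^esub>"
  have x: "?x T' q' i \<in> insert \<one>\<^bsub>A i\<^esub> (E i)" if "q' \<in> (\<Pi>\<^sub>E i\<in>T'. E i)" for T' q' i
    using that by auto
  have "\<exists>D. \<forall>b\<in>insert \<one>\<^bsub>A i\<^esub> (E i). (\<Sum>w\<in>ixs i. D w * val i w b) = (if b = ?x T q i then 1 else 0)"
    if i: "i \<in> U" for i
    using U i by (intro dual_functional E x q) auto
  then have "\<forall>i\<in>U. \<exists>D. \<forall>b\<in>insert \<one>\<^bsub>A i\<^esub> (E i).
      (\<Sum>w\<in>ixs i. D w * val i w b) = (if b = ?x T q i then 1 else 0)" by blast
  from bchoice[OF this] obtain D where D0: "\<forall>i\<in>U. \<forall>b\<in>insert \<one>\<^bsub>A i\<^esub> (E i).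
      (\<Sum>w\<in>ixs i. D i w * val i w b) = (if b = ?x T q i then 1 else 0)" ..
  have D: "(\<Sum>w\<in>ixs i. D i w * val i w b) = (if b = ?x T q i then 1 else 0)"
    if "i \<in> U" "b \<in> insert \<one>\<^bsub>A i\<^esub> (E i)" for i b
    using D0 that by blast
  have one: "\<one>\<^bsub>A i\<^esub> \<notin> E i" if "i \<in> U" for i
    using E[OF that] by (simp add: unit_complement_basis_def)
  show ?thesis
  proof (rule that[of D])
    fix T' q' assume T': "T' \<subseteq> U" and q': "q' \<in> (\<Pi>\<^sub>E i\<in>T'. E i)"
    have "tensor_functional U D (tau T' q') = (\<Prod>i\<in>U. if ?x T' q' i = ?x T q i then 1 else 0)"
      unfolding tensor_functional_tau[OF U T'] using D x[OF q'] by (intro prod.cong) auto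
    also have "\<dots> = (if \<forall>i\<in>U. ?x T' q' i = ?x T q i then 1 else 0)"
      using U by (auto intro: prod.neutral)
    also have "(\<forall>i\<in>U. ?x T' q' i = ?x T q i) \<longleftrightarrow> T' = T \<and> q' = q"
    proof
      assume eq: "\<forall>i\<in>U. ?x T' q' i = ?x T q i"
      have "i \<in> T' \<longleftrightarrow> i \<in> T" if "i \<in> U" for i
        using eq one[OF that] that PiE_mem[OF q, of i] PiE_mem[OF q', of i] by metis
      then have TT: "T' = T" using T T' by blast
      have "q' i = q i" if "i \<in> T" for i
        using bspec[OF eq, of i] T that TT by auto
      then have "q' = q" by (intro PiE_ext[OF q'[unfolded TT] q])
      then show "T' = T \<and> q' = q" using TT by simp
    qed auto
    finally show "tensor_functional U D (tau T' q') = (if T' = T \<and> q' = q then 1 else 0)" .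
  next
    fix i r assume i: "i \<in> T" and r: "r \<in> M (U - {i})"
    have iU: "i \<in> U" using i T by blast
    have tau: "tensor_functional U D (tau (U - {i}) p) = 0" for p
    proof -
      have "(\<Sum>w\<in>ixs i. D i w * val i w \<one>\<^bsub>A i\<^esub>) = 0"
        using D[OF iU, of "\<one>\<^bsub>A i\<^esub>"] i one[OF iU] PiE_mem[OF q i] by auto
      then show ?thesis
        unfolding tensor_functional_tau[OF U Diff_subset] using U iU by (intro prod_zero bexI[of _ i]) auto
    qed
    from r show "tensor_functional U D r = 0"
      unfolding M_def
      by (induction rule: rfmat.span_induct_alt) (auto simp: tensor_functional_linear tau)
  qed
qed

text \<open>
  Index pairs for the elements of \<open>\<Union>T\<in>P. tensor_basis A I E T\<close>.
\<close>

definition monomials :: "('i \<Rightarrow> 'a set) \<Rightarrow> 'i set set \<Rightarrow> ('i set \<times> ('i \<Rightarrow> 'a)) set" where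
  "monomials E P = (SIGMA T:P. \<Pi>\<^sub>E i\<in>T. E i)"

lemma finite_monomials:
  assumes "finite P" "\<And>T. T \<in> P \<Longrightarrow> fin T" "\<And>T i. T \<in> P \<Longrightarrow> i \<in> T \<Longrightarrow> unit_complement_basis i (E i)"
  shows "finite (monomials E P)"
  unfolding monomials_def using assms
  by (intro finite_SigmaI finite_PiE) (auto intro!: unit_complement_basis_finite)

definition mono_val :: "'i set \<times> ('i \<Rightarrow> 'a) \<Rightarrow> ('i \<Rightarrow> nat, 'f) rfmat" where
  "mono_val k = tau (fst k) (snd k)"

text \<open>
  Expanding every factor of a tensor over \<open>S\<close> in the basis \<open>insert \<one> E\<close>, the factors \<open>\<one>\<close> drop out and leave
  products of basis elements over subsets of \<open>S\<close>.
\<close>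

lemma M_subset_span_monomials:
  assumes S: "fin S" and E: "\<And>i. i \<in> S \<Longrightarrow> unit_complement_basis i (E i)"
  shows "M S \<subseteq> rfmat.span (mono_val ` monomials E (Pow S))"
proof -
  have "tau T p \<in> rfmat.span (mono_val ` monomials E (Pow T))"
    if "finite T" "T \<subseteq> S" "p \<in> args T" for T p
    using that
  proof (induction T rule: finite_induct)
    case empty
    have "({}, \<lambda>_. undefined) \<in> monomials E (Pow {})" by (simp add: monomials_def)
    then have "mono_val ({}, \<lambda>_. undefined) \<in> rfmat.span (mono_val ` monomials E (Pow {}))"
      by (intro rfmat.span_base imageI)
    then show ?case by (simp add: mono_val_def tau_empty)
  next
    case (insert i T)
    let ?V = "rfmat.span (mono_val ` monomials E (Pow (insert i T)))"
    have T: "fin T" "i \<in> I" "i \<notin> T" "fin (insert i T)" using insert S by auto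
    have y: "tau T p \<in> rfmat.span (mono_val ` monomials E (Pow T))"
      using insert by (simp add: args_def)
    have mult: "iota i a * tau T p \<in> ?V" if a: "a \<in> insert \<one>\<^bsub>A i\<^esub> (E i)" for a
      using y
    proof (rule rfmat.span_induct[where P = "\<lambda>y. iota i a * y \<in> ?V"])
      show "rfmat.subspace {y. iota i a * y \<in> ?V}"
        by (rule subspace_right_mult[OF rfmat.subspace_span])
      fix y assume "y \<in> mono_val ` monomials E (Pow T)"
      then obtain T' q where T': "T' \<subseteq> T" and q: "q \<in> (\<Pi>\<^sub>E i\<in>T'. E i)" and yq: "y = tau T' q"
        by (auto simp: monomials_def mono_val_def)
      show "iota i a * y \<in> ?V"
      proof (cases "a = \<one>\<^bsub>A i\<^esub>")
        case True
        have "(T', q) \<in> monomials E (Pow (insert i T))" using T' q by (auto simp: monomials_def)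
        then have "mono_val (T', q) \<in> ?V" by (intro rfmat.span_base imageI)
        then show ?thesis using True T(2) yq by (simp add: mono_val_def iota_one)
      next
        case False
        then have aE: "a \<in> E i" using a by blast
        have q': "q(i := a) \<in> (\<Pi>\<^sub>E i\<in>insert i T'. E i)" using q aE by (intro PiE_fun_upd)
        have "E j \<subseteq> carrier (A j)" if "j \<in> insert i T'" for j
          using E[of j] that T' insert.prems by (auto simp: unit_complement_basis_def)
        then have "q(i := a) \<in> args (insert i T')" using PiE_mem[OF q'] unfolding args_def by blast
        moreover have "fin T'" "i \<notin> T'" using T T' by (auto intro: finite_subset)
        ultimately have "iota i a * tau T' (q(i := a)) = tau (insert i T') (q(i := a))"
          using tau_insert(1)[of T' i "q(i := a)"] T(2) by simp
        moreover have "tau T' (q(i := a)) = y" unfolding yq by (rule tau_cong) (use \<open>i \<notin> T'\<close> in auto)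
        moreover have "(insert i T', q(i := a)) \<in> monomials E (Pow (insert i T))"
          using T' q' by (auto simp: monomials_def simp del: PiE_iff)
        then have "mono_val (insert i T', q(i := a)) \<in> ?V" by (intro rfmat.span_base imageI)
        ultimately show ?thesis by (simp add: mono_val_def)
      qed
    qed
    have ai: "p i \<in> carrier (A i)" using insert.prems by (simp add: args_def)
    have Ei: "unit_complement_basis i (E i)" using insert.prems by (intro E) simp
    have sp: "rho i (p i) \<in> rfmat.span (rho i ` insert \<one>\<^bsub>A i\<^esub> (E i))"
      using Ei ai unfolding unit_complement_basis_def by blast
    have finF: "finite (insert \<one>\<^bsub>A i\<^esub> (E i))"
      using unit_complement_basis_finite[OF T(2) Ei] by simp
    obtain c where c: "rho i (p i) = (\<Sum>a\<in>insert \<one>\<^bsub>A i\<^esub> (E i). scale (c a) (rho i a))"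
      by (rule rfmat.span_image_coefficients[OF finF sp])
    have "iota i (p i) = (\<Sum>a\<in>insert \<one>\<^bsub>A i\<^esub> (E i). scale (c a) (iota i a))"
      by (rule rfmat_eqI) (auto simp: iota_def tau_def entry_sum scale.rep_eq kron.rep_eq c
          intro!: sum.neutral)
    then have "iota i (p i) * tau T p \<in> ?V"
      by (simp only: sum_distrib_right scale_mult_left) (intro rfmat.span_sum rfmat.span_scale mult)
    then show ?case using tau_insert(1)[OF T(1-3) insert.prems(2)] by simp
  qed
  then show ?thesis
    unfolding M_def using S by (intro rfmat.span_minimal rfmat.subspace_span) auto
qed

end

section \<open>Derivations and converging sums of operators\<close>

lemma inj_if_separated:
  fixes S :: "nat \<Rightarrow> 'i set" and ix :: "nat \<Rightarrow> 'i"
  assumes "\<And>m. ix m \<in> S m" "\<And>m j. j < m \<Longrightarrow> ix j \<notin> S m"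
  shows "inj S"
proof (rule injI)
  fix m k assume "S m = S k"
  then show "m = k" using assms by (metis linorder_neqE_nat)
qed

context matrix_factors
begin

lemma abelian_group_B: "abelian_group B"
proof (rule abelian_groupI)
  fix x assume "x \<in> carrier B"
  then obtain r where r: "r \<in> Msp" "x = cls r" by (auto simp: carrier_B)
  then have "- r \<in> Msp" using Msp_diff[OF Msp_zero r(1)] by simp
  then show "\<exists>y\<in>carrier B. y \<oplus>\<^bsub>B\<^esub> x = \<zero>\<^bsub>B\<^esub>"
    using r by (intro bexI[of _ "cls (- r)"]) (simp_all add: B_add B_zero carrier_B)
qed (auto simp: carrier_B B_zero B_add Msp_zero Msp_add ac_simps)

lemma cls_eq_iff: "r \<in> Msp \<Longrightarrow> s \<in> Msp \<Longrightarrow> cls r = cls s \<longleftrightarrow> r = s"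
  using cls_inj by (auto simp: inj_on_def)

lemma cls_carrier: "r \<in> Msp \<Longrightarrow> cls r \<in> carrier B"
  by (simp add: carrier_B)

lemma B_minus:
  assumes "r \<in> Msp" "s \<in> Msp"
  shows "cls r \<ominus>\<^bsub>B\<^esub> cls s = cls (r - s)"
proof -
  interpret abelian_group B by (rule abelian_group_B)
  have m: "- s \<in> Msp" using Msp_diff[OF Msp_zero assms(2)] by simp
  have "\<ominus>\<^bsub>B\<^esub> cls s = cls (- s)"
    by (rule minus_equality) (simp_all add: B_add B_zero m assms cls_carrier)
  then show ?thesis by (simp add: a_minus_def B_add assms m)
qed

lemma B_finsum:
  assumes "finite K" "\<And>k. k \<in> K \<Longrightarrow> g k \<in> Msp" "\<And>k. k \<in> K \<Longrightarrow> f k = cls (g k)"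
  shows "finsum B f K = cls (sum g K)"
  using assms
proof (induction K rule: finite_induct)
  case empty
  interpret abelian_group B by (rule abelian_group_B)
  show ?case by (simp add: B_zero)
next
  case (insert k K)
  interpret abelian_group B by (rule abelian_group_B)
  have "finsum B f (insert k K) = f k \<oplus>\<^bsub>B\<^esub> finsum B f K"
    using insert by (intro finsum_insert) (auto simp: cls_carrier)
  then show ?case using insert by (simp add: B_add Msp_sum)
qed

lemma ad_cls: "b \<in> Msp \<Longrightarrow> r \<in> Msp \<Longrightarrow> ad B (cls b) (cls r) = cls (commut b r)"
  by (simp add: ad_def cls_carrier B_mult B_minus Msp_mult commut_def)

text \<open>
  Converging sums of operators in the model. The index map \<open>\<phi>\<close> serves to index a family by pairs that is
  given as a family indexed by algebra elements.
\<close>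

lemma operator_sums_cls:
  assumes inj: "inj_on \<phi> K"
    and g: "\<And>k r. k \<in> K \<Longrightarrow> r \<in> Msp \<Longrightarrow> g k r \<in> Msp"
    and f: "\<And>k r. k \<in> K \<Longrightarrow> r \<in> Msp \<Longrightarrow> f (\<phi> k) (cls r) = cls (g k r)"
  shows "operator_sums B (\<phi> ` K) f d \<longleftrightarrow>
     d \<in> extensional (carrier B) \<and>
     (\<forall>r\<in>Msp. finite {k \<in> K. g k r \<noteq> 0} \<and> d (cls r) = cls (\<Sum>k | k \<in> K \<and> g k r \<noteq> 0. g k r))"
proof -
  have supp: "{x \<in> \<phi> ` K. f x (cls r) \<noteq> \<zero>\<^bsub>B\<^esub>} = \<phi> ` {k \<in> K. g k r \<noteq> 0}" if "r \<in> Msp" for r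
    using that f g by (auto simp: B_zero cls_eq_iff Msp_zero)
  have injs: "inj_on \<phi> {k \<in> K. g k r \<noteq> 0}" for r
    using inj by (rule inj_on_subset) auto
  have fin: "finite {x \<in> \<phi> ` K. f x (cls r) \<noteq> \<zero>\<^bsub>B\<^esub>} \<longleftrightarrow> finite {k \<in> K. g k r \<noteq> 0}" if "r \<in> Msp" for r
    unfolding supp[OF that] by (rule finite_image_iff[OF injs])
  have sum: "(\<Oplus>\<^bsub>B\<^esub>x\<in>{x \<in> \<phi> ` K. f x (cls r) \<noteq> \<zero>\<^bsub>B\<^esub>}. f x (cls r))
      = cls (\<Sum>k | k \<in> K \<and> g k r \<noteq> 0. g k r)"
    if "r \<in> Msp" and "finite {k \<in> K. g k r \<noteq> 0}" for r
  proof -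
    interpret abelian_group B by (rule abelian_group_B)
    have "(\<Oplus>\<^bsub>B\<^esub>x\<in>\<phi> ` {k \<in> K. g k r \<noteq> 0}. f x (cls r))
        = (\<Oplus>\<^bsub>B\<^esub>k\<in>{k \<in> K. g k r \<noteq> 0}. f (\<phi> k) (cls r))"
      using that(1) f g by (intro finsum_reindex injs) (auto simp: cls_carrier)
    also have "\<dots> = cls (\<Sum>k | k \<in> K \<and> g k r \<noteq> 0. g k r)"
      using that f g by (intro B_finsum) auto
    finally show ?thesis unfolding supp[OF that(1)] .
  qed
  show ?thesis
    unfolding operator_sums_def carrier_B
    by (auto simp: fin sum fun_eq_iff extensional_def) 
qed

lemma Der_cls:
  assumes "d \<in> extensional (carrier B)" and \<delta>: "\<And>r. r \<in> Msp \<Longrightarrow> \<delta> r \<in> Msp"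
    and d: "\<And>r. r \<in> Msp \<Longrightarrow> d (cls r) = cls (\<delta> r)"
  shows "d \<in> Der B \<longleftrightarrow> derivation \<delta>"
proof -
  have "d \<in> Der B \<longleftrightarrow> d \<in> LinearCombinations.module_hom class_ring B B \<and>
      (\<forall>r\<in>Msp. \<forall>s\<in>Msp. d (cls r \<otimes>\<^bsub>B\<^esub> cls s) = d (cls r) \<otimes>\<^bsub>B\<^esub> cls s \<oplus>\<^bsub>B\<^esub> cls r \<otimes>\<^bsub>B\<^esub> d (cls s))"
    using assms(1) by (simp add: Der_def carrier_B)
  also have "d \<in> LinearCombinations.module_hom class_ring B B \<longleftrightarrow>
      (\<forall>r\<in>Msp. \<forall>s\<in>Msp. d (cls r \<oplus>\<^bsub>B\<^esub> cls s) = d (cls r) \<oplus>\<^bsub>B\<^esub> d (cls s)) \<and>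
      (\<forall>c. \<forall>r\<in>Msp. d (c \<odot>\<^bsub>B\<^esub> cls r) = c \<odot>\<^bsub>B\<^esub> d (cls r))"
    unfolding LinearCombinations.module_hom_def carrier_B using \<delta> d by (auto simp: Pi_def)
  finally show ?thesis
    unfolding derivation_def
    by (simp add: d \<delta> B_add B_mult B_smult Msp_add Msp_mult Msp_scale cls_eq_iff)
qed

lemma sparse_fin: "sparse_system I P \<Longrightarrow> S \<in> P \<Longrightarrow> fin S"
  by (auto simp: sparse_system_def)

lemma sparse_meet_finite:
  assumes P: "sparse_system I P" and V: "fin V"
  shows "finite {S \<in> P. S \<inter> V \<noteq> {}}"
proof -
  have "{S \<in> P. S \<inter> V \<noteq> {}} = (\<Union>i\<in>V. {S \<in> P. i \<in> S})" by auto
  moreover have "finite {S \<in> P. i \<in> S}" if "i \<in> V" for i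
    using P V that unfolding sparse_system_def by blast
  ultimately show ?thesis using V by simp
qed

lemma commut_disjoint: "fin S \<Longrightarrow> b \<in> M S \<Longrightarrow> fin V \<Longrightarrow> r \<in> M V \<Longrightarrow> S \<inter> V = {} \<Longrightarrow> commut b r = 0"
  using M_disjoint_commute[of S b V r] by (simp add: commut_def)

text \<open>
  \<open>d\<close> is the sum of the inner derivations by \<open>b S\<close>. If \<open>r\<close> lies in \<open>M V\<close>, then \<open>b S\<close> commutes with it unless
  \<open>S\<close> meets \<open>V\<close>, and only finitely many members of a sparse system do; so the sum may be taken over
  these, which form a set that is independent of \<open>r\<close>.
\<close>

definition represents_sum ::
  "'i set set \<Rightarrow> ('i set \<Rightarrow> ('i \<Rightarrow> nat, 'f) rfmat) \<Rightarrow>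
     (('i, 'f, 'a) tensor \<Rightarrow> ('i, 'f, 'a) tensor) \<Rightarrow> bool" where
  "represents_sum P b d \<longleftrightarrow> (\<forall>S\<in>P. b S \<in> M S) \<and>
     (\<forall>r V. fin V \<longrightarrow> r \<in> M V \<longrightarrow> d (cls r) = cls (\<Sum>S | S \<in> P \<and> S \<inter> V \<noteq> {}. commut (b S) r))"

lemma operator_sums_represents:
  assumes P: "sparse_system I P" and b: "\<forall>S\<in>P. b S \<in> M S" and a: "\<forall>S\<in>P. a S = cls (b S)"
  shows "operator_sums B P (\<lambda>S. ad B (a S)) d \<longleftrightarrow> d \<in> extensional (carrier B) \<and> represents_sum P b d"
proof -
  have bM: "b S \<in> Msp" if "S \<in> P" for S using b that MspI[OF sparse_fin[OF P that]] by blast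
  have sub: "{S \<in> P. commut (b S) r \<noteq> 0} \<subseteq> {S \<in> P. S \<inter> V \<noteq> {}}" if "fin V" "r \<in> M V" for r V
    using commut_disjoint[OF sparse_fin[OF P] _ that] b by blast
  have sum: "(\<Sum>S | S \<in> P \<and> commut (b S) r \<noteq> 0. commut (b S) r)
      = (\<Sum>S | S \<in> P \<and> S \<inter> V \<noteq> {}. commut (b S) r)" if V: "fin V" "r \<in> M V" for r V
    using sub[OF V] by (intro sum.mono_neutral_left sparse_meet_finite[OF P V(1)]) auto
  have fin: "finite {S \<in> P. commut (b S) r \<noteq> 0}" if "r \<in> Msp" for r
    using that
  proof (rule MspE)
    fix V assume V: "fin V" "r \<in> M V"
    show ?thesis by (rule finite_subset[OF sub[OF V] sparse_meet_finite[OF P V(1)]])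
  qed
  have "operator_sums B (id ` P) (\<lambda>S. ad B (a S)) d \<longleftrightarrow> d \<in> extensional (carrier B) \<and>
     (\<forall>r\<in>Msp. finite {S \<in> P. commut (b S) r \<noteq> 0} \<and>
        d (cls r) = cls (\<Sum>S | S \<in> P \<and> commut (b S) r \<noteq> 0. commut (b S) r))"
    by (rule operator_sums_cls) (simp_all add: a ad_cls bM commut_Msp)
  moreover have "represents_sum P b d \<longleftrightarrow>
      (\<forall>r\<in>Msp. d (cls r) = cls (\<Sum>S | S \<in> P \<and> commut (b S) r \<noteq> 0. commut (b S) r))"
  proof
    assume *: "represents_sum P b d"
    show "\<forall>r\<in>Msp. d (cls r) = cls (\<Sum>S | S \<in> P \<and> commut (b S) r \<noteq> 0. commut (b S) r)"
    proof
      fix r assume "r \<in> Msp"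
      then obtain V where V: "fin V" "r \<in> M V" by (rule MspE)
      then show "d (cls r) = cls (\<Sum>S | S \<in> P \<and> commut (b S) r \<noteq> 0. commut (b S) r)"
        using * unfolding sum[OF V] represents_sum_def by blast
    qed
  next
    assume *: "\<forall>r\<in>Msp. d (cls r) = cls (\<Sum>S | S \<in> P \<and> commut (b S) r \<noteq> 0. commut (b S) r)"
    show "represents_sum P b d"
      unfolding represents_sum_def
    proof (intro conjI b allI impI)
      fix r V assume V: "fin V" "r \<in> M V"
      show "d (cls r) = cls (\<Sum>S | S \<in> P \<and> S \<inter> V \<noteq> {}. commut (b S) r)"
        using * MspI[OF V] unfolding sum[OF V, symmetric] by blast
    qed
  qed
  ultimately show ?thesis using fin by simp
qed

lemma sparse_derivations_iff:
  assumes P: "sparse_system I P"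
  shows "d \<in> sparse_derivations A I P \<longleftrightarrow>
     d \<in> extensional (carrier B) \<and> (\<exists>b. represents_sum P b d)"
proof
  assume "d \<in> sparse_derivations A I P"
  then obtain a where a: "\<forall>S\<in>P. a S \<in> tensor_sub A I S"
    and d: "operator_sums B P (\<lambda>S. ad B (a S)) d"
    unfolding sparse_derivations_def by blast
  have "\<forall>S\<in>P. \<exists>r. r \<in> M S \<and> a S = cls r"
  proof
    fix S assume S: "S \<in> P"
    then have "a S \<in> cls ` M S" using a tensor_sub_cls[OF sparse_fin[OF P S]] by blast
    then show "\<exists>r. r \<in> M S \<and> a S = cls r" by blast
  qed
  from bchoice[OF this] obtain b where "\<forall>S\<in>P. b S \<in> M S" "\<forall>S\<in>P. a S = cls (b S)" by blast
  from operator_sums_represents[OF P this] d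
  show "d \<in> extensional (carrier B) \<and> (\<exists>b. represents_sum P b d)" by blast
next
  assume "d \<in> extensional (carrier B) \<and> (\<exists>b. represents_sum P b d)"
  then obtain b where d: "d \<in> extensional (carrier B)" "represents_sum P b d" by blast
  then have b: "\<forall>S\<in>P. b S \<in> M S" by (simp add: represents_sum_def)
  have "operator_sums B P (\<lambda>S. ad B (cls (b S))) d"
    using operator_sums_represents[OF P b, of "\<lambda>S. cls (b S)"] d by blast
  moreover have "\<forall>S\<in>P. cls (b S) \<in> tensor_sub A I S"
  proof
    fix S assume S: "S \<in> P"
    then show "cls (b S) \<in> tensor_sub A I S"
      using b tensor_sub_cls[OF sparse_fin[OF P S]] by blast
  qed
  ultimately show "d \<in> sparse_derivations A I P"
    unfolding sparse_derivations_def by (intro CollectI exI[of _ "\<lambda>S. cls (b S)"] conjI)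
qed

text \<open>
  On two given elements the sum has the same finite range, and there it is a sum of derivations.
\<close>

lemma sparse_derivations_Der:
  assumes P: "sparse_system I P"
  shows "sparse_derivations A I P \<subseteq> Der B"
proof
  fix d assume "d \<in> sparse_derivations A I P"
  then obtain b where ext: "d \<in> extensional (carrier B)" and rep: "represents_sum P b d"
    unfolding sparse_derivations_iff[OF P] by blast
  then have b: "\<forall>S\<in>P. b S \<in> M S"
    and d: "\<And>r V. fin V \<Longrightarrow> r \<in> M V \<Longrightarrow> d (cls r) = cls (\<Sum>S | S \<in> P \<and> S \<inter> V \<noteq> {}. commut (b S) r)"
    by (simp_all add: represents_sum_def)
  have bM: "b S \<in> Msp" if "S \<in> P" for S using b that MspI[OF sparse_fin[OF P that]] by blast
  define \<delta> where "\<delta> r = the_inv_into Msp cls (d (cls r))" for r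
  have \<delta>: "\<delta> r = (\<Sum>S | S \<in> P \<and> S \<inter> V \<noteq> {}. commut (b S) r)" if "fin V" "r \<in> M V" for r V
  proof -
    have "r \<in> Msp" using that by (rule MspI)
    moreover have "(\<Sum>S | S \<in> P \<and> S \<inter> V \<noteq> {}. commut (b S) r) \<in> Msp"
      using bM \<open>r \<in> Msp\<close> by (intro Msp_sum commut_Msp) auto
    ultimately show ?thesis
      unfolding \<delta>_def using d[OF that] by (simp add: the_inv_into_f_f[OF cls_inj])
  qed
  have \<delta>M: "\<delta> r \<in> Msp" if "r \<in> Msp" for r
    using that
  proof (rule MspE)
    fix V assume V: "fin V" "r \<in> M V"
    show ?thesis unfolding \<delta>[OF V] using bM that by (intro Msp_sum commut_Msp) auto
  qed
  have d_cls: "d (cls r) = cls (\<delta> r)" if "r \<in> Msp" for r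
    using that by (rule MspE) (simp add: d \<delta>)
  have common: "\<exists>V. fin V \<and> r \<in> M V \<and> s \<in> M V" if rs: "r \<in> Msp" "s \<in> Msp" for r s
  proof -
    obtain V W where VW: "fin V" "r \<in> M V" "fin W" "s \<in> M W" using rs by (meson MspE)
    then have "fin (V \<union> W)" by auto
    then show ?thesis using M_mono[of "V \<union> W" V] M_mono[of "V \<union> W" W] VW by blast
  qed
  have der: "derivation (commut (b S))" if "S \<in> P" for S
    by (rule derivation_commut[OF bM[OF that]])
  have "derivation \<delta>"
    unfolding derivation_def
  proof (intro conjI ballI allI)
    fix r s assume rs: "r \<in> Msp" "s \<in> Msp"
    then obtain V where V: "fin V" "r \<in> M V" "s \<in> M V" using common by blast
    have rsV: "r + s \<in> M V" "r * s \<in> M V" using V by (auto intro: M_add M_mult)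
    show "\<delta> (r + s) = \<delta> r + \<delta> s"
      unfolding \<delta>[OF V(1,2)] \<delta>[OF V(1,3)] \<delta>[OF V(1) rsV(1)] sum.distrib[symmetric]
      by (intro sum.cong refl derivationD(2)[OF der]) (use rs in auto)
    show "\<delta> (r * s) = \<delta> r * s + r * \<delta> s"
      unfolding \<delta>[OF V(1,2)] \<delta>[OF V(1,3)] \<delta>[OF V(1) rsV(2)]
        sum_distrib_left sum_distrib_right sum.distrib[symmetric]
      by (intro sum.cong refl derivationD(4)[OF der]) (use rs in auto)
  next
    fix c r assume r: "r \<in> Msp"
    then obtain V where V: "fin V" "r \<in> M V" by (rule MspE)
    show "\<delta> (scale c r) = scale c (\<delta> r)"
      unfolding \<delta>[OF V] \<delta>[OF V(1) M_scale[OF V(2)]] rfmat.scale_sum_right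
      by (intro sum.cong refl derivationD(3)[OF der]) (use r in auto)
  qed (use \<delta>M in auto)
  then show "d \<in> Der B" using Der_cls[OF ext \<delta>M d_cls] by simp
qed

text \<open>
  The sets \<open>S m\<close> of \<open>derivation_decomposition\<close> avoid the first \<open>m\<close> places, so every place lies in finitely
  many of them, and their nonempty subsets form a sparse system. As the sets are distinct, the
  \<open>m\<close>-th correction can be assigned to \<open>S m\<close>, and \<open>0\<close> to every other set.
\<close>

lemma Der_sparse:
  assumes "countable I" "infinite I" and d: "d \<in> Der B"
  shows "\<exists>P. sparse_system I P \<and> d \<in> sparse_derivations A I P"
proof -
  define \<delta> where "\<delta> r = the_inv_into Msp cls (d (cls r))" for r
  have ext: "d \<in> extensional (carrier B)" and "d \<in> carrier B \<rightarrow> carrier B"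
    using d by (auto simp: Der_def LinearCombinations.module_hom_def)
  then have dc: "d (cls r) \<in> cls ` Msp" if "r \<in> Msp" for r
    using that by (auto simp: carrier_B)
  have \<delta>M: "\<delta> r \<in> Msp" and d_cls: "d (cls r) = cls (\<delta> r)" if "r \<in> Msp" for r
    unfolding \<delta>_def using dc[OF that] cls_inj
    by (auto simp: the_inv_into_into f_the_inv_into_f intro: the_inv_into_into)
  have der: "derivation \<delta>" using Der_cls[OF ext \<delta>M d_cls] d by simp
  have ix: "bij_betw (from_nat_into I) UNIV I"
    using assms by (simp add: bij_betw_from_nat_into)
  let ?ix = "from_nat_into I"
  obtain S a where Sa: "\<forall>m. fin (S m) \<and> ?ix m \<in> S m \<and> (\<forall>j<m. ?ix j \<notin> S m) \<and> a m \<in> M (S m)"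
    and sum: "\<forall>k. \<forall>r\<in>M (?ix ` {..<k}). \<delta> r = (\<Sum>m<k. commut (a m) r)"
    using derivation_decomposition[OF der ix] by blast
  then have S: "fin (S m)" "?ix m \<in> S m" "j < m \<Longrightarrow> ?ix j \<notin> S m" and a: "a m \<in> M (S m)" for m j
    by blast+
  have injS: "inj S" by (rule inj_if_separated[of ?ix]) (use S in auto)
  define P where "P = {T. T \<noteq> {} \<and> (\<exists>m. T \<subseteq> S m)}"
  \<comment> \<open>The family indexed by the sparse system: the correction belonging to a set of the form \<open>S m\<close>.\<close>
  define b where "b T = (if T \<in> range S then a (inv_into UNIV S T) else 0)" for T
  have bS: "b (S m) = a m" for m by (simp add: b_def inv_f_f[OF injS])
  have P: "sparse_system I P"
    unfolding sparse_system_def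
  proof (intro conjI ballI)
    fix T assume "T \<in> P"
    then show "T \<noteq> {}" "finite T" "T \<subseteq> I" using S(1) by (auto simp: P_def intro: finite_subset)
    show "\<forall>T'. T' \<noteq> {} \<and> T' \<subseteq> T \<longrightarrow> T' \<in> P" using \<open>T \<in> P\<close> unfolding P_def by blast
  next
    fix i assume "i \<in> I"
    then obtain k where k: "i = ?ix k" using ix by (metis bij_betw_def imageE)
    have "{T \<in> P. i \<in> T} \<subseteq> (\<Union>m\<le>k. Pow (S m))"
    proof
      fix T assume "T \<in> {T \<in> P. i \<in> T}"
      then obtain m where m: "T \<subseteq> S m" "?ix k \<in> S m" using k by (auto simp: P_def)
      then have "m \<le> k" using S(3)[of k m] by (meson not_le_imp_less)
      then show "T \<in> (\<Union>m\<le>k. Pow (S m))" using m(1) by blast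
    qed
    moreover have "finite (\<Union>m\<le>k. Pow (S m))" using S(1) by auto
    ultimately show "finite {T \<in> P. i \<in> T}" by (rule finite_subset)
  qed
  have SP: "S m \<in> P" for m using S(2)[of m] by (auto simp: P_def)
  have bM: "b T \<in> M T" for T using a bS by (cases "T \<in> range S") (auto simp: b_def M_zero inv_f_f[OF injS])
  have d_sum: "d (cls r) = cls (\<Sum>T | T \<in> P \<and> T \<inter> V \<noteq> {}. commut (b T) r)"
    if V: "fin V" "r \<in> M V" for r V
  proof -
    have "V \<subseteq> range ?ix" using V ix by (auto simp: bij_betw_def)
    then obtain J where J: "finite J" "V = ?ix ` J" using V finite_subset_image by metis
    obtain k where "J \<subseteq> {..<k}" using finite_nat_bounded[OF J(1)] by blast
    then have Vk: "V \<subseteq> ?ix ` {..<k}" using J by blast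
    have "?ix ` {..<k} \<subseteq> I" using ix by (auto simp: bij_betw_def)
    then have "r \<in> M (?ix ` {..<k})" using M_mono[OF _ Vk] V by blast
    then have "\<delta> r = (\<Sum>m<k. commut (b (S m)) r)" unfolding bS using sum by blast
    also have "\<dots> = (\<Sum>T\<in>S ` {..<k}. commut (b T) r)"
      by (subst sum.reindex) (use injS in \<open>auto simp: inj_on_def\<close>)
    also have "\<dots> = (\<Sum>T | T \<in> P \<and> T \<inter> V \<noteq> {}. commut (b T) r)"
    proof (rule sum.mono_neutral_cong)
      show "finite {T. T \<in> P \<and> T \<inter> V \<noteq> {}}" by (rule sparse_meet_finite[OF P V(1)])
      show "commut (b T) r = 0" if T: "T \<in> {T. T \<in> P \<and> T \<inter> V \<noteq> {}} - S ` {..<k}" for T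
      proof (cases "T \<in> range S")
        case True
        then obtain m where m: "T = S m" by blast
        then have "\<not> m < k" using T by blast
        then have "?ix j \<notin> T" if "j < k" for j
          using that S(3)[of j m] unfolding m by linarith
        then have "T \<inter> V = {}" using Vk by blast
        then show ?thesis using T by blast
      next
        case False
        then show ?thesis by (simp add: b_def commut_def)
      qed
      show "commut (b T) r = 0" if T: "T \<in> S ` {..<k} - {T. T \<in> P \<and> T \<inter> V \<noteq> {}}" for T
      proof -
        from T obtain m where m: "T = S m" by blast
        then have "T \<inter> V = {}" using T SP by blast
        then show ?thesis using m S(1) bM V by (intro commut_disjoint[of T _ V]) auto
      qed
    qed simp_all
    finally show ?thesis using d_cls[OF MspI[OF V]] by simp
  qed
  have "represents_sum P b d"
    unfolding represents_sum_def by (simp add: bM d_sum)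
  then have "d \<in> sparse_derivations A I P"
    unfolding sparse_derivations_iff[OF P] using ext by blast
  then show ?thesis using P by blast
qed

lemma commut_linear:
  "commut (\<Sum>k\<in>K. scale (c k) (f k)) r = (\<Sum>k\<in>K. scale (c k) (commut (f k) r))"
  by (simp add: commut_def sum_distrib_left sum_distrib_right sum_subtractf scale_mult_left
      scale_mult_right rfmat.scale_right_diff_distrib)

lemma monomials_iff: "k \<in> monomials E P \<longleftrightarrow> fst k \<in> P \<and> snd k \<in> (\<Pi>\<^sub>E i\<in>fst k. E i)"
  by (cases k) (simp add: monomials_def del: PiE_iff)

lemma mono_val_M:
  assumes "k \<in> monomials E P" "\<And>i. i \<in> fst k \<Longrightarrow> unit_complement_basis i (E i)"
  shows "mono_val k \<in> M (fst k)"
proof -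
  have "snd k \<in> args (fst k)"
    using assms unfolding monomials_iff args_def unit_complement_basis_def by blast
  then show ?thesis unfolding mono_val_def by (rule tau_in_M)
qed

text \<open>
  Existence: expanding each \<open>b S\<close> into monomials over subsets of \<open>S\<close>, the coefficient of a monomial over
  \<open>T \<noteq> {}\<close> in the total is a sum over the members \<open>S \<supseteq> T\<close> of the sparse system, which are finitely many; the
  scalar part, belonging to \<open>T = {}\<close>, acts as \<open>0\<close>, and \<open>T\<close> belongs to the system because it is closed
  under nonempty subsets.
  
  Uniqueness: let a combination be zero as an operator, and let \<open>k0\<close> be a monomial with \<open>i\<close> in its support.
  Only finitely many monomials have \<open>i\<close> in their support; their combination \<open>b\<close> commutes with the \<open>i\<close>-th
  matrix units, as all other monomials do. By \<open>centralizer_M\<close> the place \<open>i\<close> does not occur in \<open>b\<close>, so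
  the functional dual to \<open>k0\<close> vanishes on \<open>b\<close>; its value is the coefficient of \<open>k0\<close>.
\<close>

lemma topological_basis:
  assumes P: "sparse_system I P" and E: "\<And>i. i \<in> I \<Longrightarrow> unit_complement_basis i (E i)"
  shows "topological_basis_ad B (\<Union>S\<in>P. tensor_basis A I E S) (sparse_derivations A I P)"
proof -
  let ?K = "monomials E P"
  let ?\<phi> = "\<lambda>k. cls (mono_val k)"
  have finP: "fin T" if "T \<in> P" for T by (rule sparse_fin[OF P that])
  have ET: "unit_complement_basis i (E i)" if "T \<in> P" "i \<in> T" for T i
    using E finP[OF that(1)] that(2) by blast
  have tb: "(\<Union>S\<in>P. tensor_basis A I E S) = ?\<phi> ` ?K"
  proof -
    have "tensor_basis A I E S = (\<lambda>p. cls (tau S p)) ` (\<Pi>\<^sub>E i\<in>S. E i)" if "S \<in> P" for S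
      using ET[OF that] by (intro tensor_basis_cls finP that) (auto simp: unit_complement_basis_def)
    then have "(\<Union>S\<in>P. tensor_basis A I E S) = (\<Union>S\<in>P. (\<lambda>p. cls (tau S p)) ` (\<Pi>\<^sub>E i\<in>S. E i))"
      by (intro SUP_cong refl)
    then show ?thesis by (simp add: monomials_def mono_val_def Sigma_def image_UN image_image
        UNION_singleton_eq_range)
  qed
  have kM: "mono_val k \<in> M (fst k)" if "k \<in> ?K" for k
  proof (rule mono_val_M[OF that])
    have "fst k \<in> P" using that by (simp add: monomials_iff)
    then show "unit_complement_basis i (E i)" if "i \<in> fst k" for i using that by (rule ET)
  qed
  have kMsp: "mono_val k \<in> Msp" if "k \<in> ?K" for k
    using MspI[OF _ kM[OF that]] finP that by (simp add: monomials_iff)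
  have dual: "\<exists>D. (\<forall>k. fst k \<subseteq> U \<longrightarrow> k \<in> ?K \<longrightarrow>
        tensor_functional U D (mono_val k) = (if k = k0 then 1 else 0)) \<and>
      (\<forall>i r. i \<in> fst k0 \<longrightarrow> r \<in> M (U - {i}) \<longrightarrow> tensor_functional U D r = 0)"
    if U: "fin U" and k0: "k0 \<in> ?K" "fst k0 \<subseteq> U" for U k0
  proof -
    have EU: "unit_complement_basis i (E i)" if "i \<in> U" for i using E U that by blast
    have q: "snd k0 \<in> (\<Pi>\<^sub>E i\<in>fst k0. E i)" using k0 by (simp add: monomials_iff)
    obtain D where D1: "\<And>T' q'. T' \<subseteq> U \<Longrightarrow> q' \<in> (\<Pi>\<^sub>E i\<in>T'. E i) \<Longrightarrow>
       tensor_functional U D (tau T' q') = (if T' = fst k0 \<and> q' = snd k0 then 1 else 0)"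
      and D2: "\<And>i r. i \<in> fst k0 \<Longrightarrow> r \<in> M (U - {i}) \<Longrightarrow> tensor_functional U D r = 0"
      using dual_tensor_functional[OF U EU k0(2) q] by metis
    show ?thesis
    proof (intro exI[of _ D] conjI allI impI)
      fix k assume k: "fst k \<subseteq> U" "k \<in> ?K"
      then show "tensor_functional U D (mono_val k) = (if k = k0 then 1 else 0)"
        unfolding mono_val_def using D1[OF k(1), of "snd k"] by (simp add: monomials_iff prod_eq_iff)
    qed (rule D2)
  qed
  have inj: "inj_on ?\<phi> ?K"
  proof (rule inj_onI)
    fix k k0 assume k: "k \<in> ?K" "k0 \<in> ?K" and eq: "?\<phi> k = ?\<phi> k0"
    have eq': "mono_val k = mono_val k0" using eq k kMsp cls_eq_iff by blast
    have U: "fin (fst k \<union> fst k0)" using k finP by (auto simp: monomials_iff)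
    obtain D where "\<forall>j. fst j \<subseteq> fst k \<union> fst k0 \<longrightarrow> j \<in> ?K \<longrightarrow>
        tensor_functional (fst k \<union> fst k0) D (mono_val j) = (if j = k0 then 1 else 0)"
      using dual[OF U k(2)] by auto
    then have "(if k = k0 then 1 else 0) = (if k0 = k0 then 1 else (0 :: 'f))"
      using k eq' by (metis Un_upper1 Un_upper2)
    then show "k = k0" by (simp split: if_splits)
  qed
  have opsum: "operator_sums B (?\<phi> ` ?K) (\<lambda>e. \<lambda>x\<in>carrier B. \<alpha> e \<odot>\<^bsub>B\<^esub> ad B e x) d \<longleftrightarrow>
     d \<in> extensional (carrier B) \<and>
     (\<forall>r\<in>Msp. finite {k \<in> ?K. scale (\<alpha> (?\<phi> k)) (commut (mono_val k) r) \<noteq> 0} \<and>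
        d (cls r) = cls (\<Sum>k | k \<in> ?K \<and> scale (\<alpha> (?\<phi> k)) (commut (mono_val k) r) \<noteq> 0.
           scale (\<alpha> (?\<phi> k)) (commut (mono_val k) r)))" for \<alpha> d
    by (rule operator_sums_cls[OF inj])
      (simp_all add: commut_Msp Msp_scale kMsp cls_carrier ad_cls B_smult)
  have meet: "finite (monomials E {T \<in> P. T \<inter> V \<noteq> {}})" if V: "fin V" for V
    by (rule finite_monomials[OF sparse_meet_finite[OF P V]]) (auto simp: ET finP dest: finP)
  have van: "commut (mono_val k) r = 0" if V: "fin V" "r \<in> M V" and k: "k \<in> ?K" "fst k \<inter> V = {}" for V r k
    using k finP by (intro commut_disjoint[OF _ kM[OF k(1)] V]) (auto simp: monomials_iff)
  have sub: "{k \<in> ?K. scale (c k) (commut (mono_val k) r) \<noteq> 0} \<subseteq> monomials E {T \<in> P. T \<inter> V \<noteq> {}}"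
    if V: "fin V" "r \<in> M V" for V r and c
    using van[OF V] by (auto simp: monomials_iff)
  have supp_sum: "(\<Sum>k | k \<in> ?K \<and> scale (c k) (commut (mono_val k) r) \<noteq> 0. scale (c k) (commut (mono_val k) r))
      = (\<Sum>k\<in>monomials E {T \<in> P. T \<inter> V \<noteq> {}}. scale (c k) (commut (mono_val k) r))"
    if V: "fin V" "r \<in> M V" for V r and c
    using sub[OF V] by (intro sum.mono_neutral_left meet[OF V(1)]) (auto simp: monomials_iff)
  show ?thesis
    unfolding topological_basis_ad_def tb
  proof (intro conjI ballI allI impI)
    fix d assume "d \<in> sparse_derivations A I P"
    then obtain b where ext: "d \<in> extensional (carrier B)" and rep: "represents_sum P b d"
      unfolding sparse_derivations_iff[OF P] by blast
    have bM: "b S \<in> M S" if "S \<in> P" for S using rep that by (simp add: represents_sum_def)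
    have "\<exists>c. (\<forall>k. \<not> fst k \<subseteq> S \<longrightarrow> c k = 0) \<and>
        b S = (\<Sum>k\<in>monomials E (Pow S). scale (c k) (mono_val k))" if S: "S \<in> P" for S
    proof -
      have finM: "finite (monomials E (Pow S))"
        using finP[OF S] ET[OF S] by (intro finite_monomials) (auto intro: finite_subset)
      have "b S \<in> rfmat.span (mono_val ` monomials E (Pow S))"
        using M_subset_span_monomials[OF finP[OF S] ET[OF S]] bM[OF S] by blast
      then obtain c where c: "b S = (\<Sum>k\<in>monomials E (Pow S). scale (c k) (mono_val k))"
        by (rule rfmat.span_image_coefficients[OF finM])
      have "b S = (\<Sum>k\<in>monomials E (Pow S). scale (if fst k \<subseteq> S then c k else 0) (mono_val k))"
        unfolding c by (intro sum.cong refl) (simp add: monomials_iff)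
      then show ?thesis by (intro exI[of _ "\<lambda>k. if fst k \<subseteq> S then c k else 0"]) simp
    qed
    then have "\<forall>S\<in>P. \<exists>c. (\<forall>k. \<not> fst k \<subseteq> S \<longrightarrow> c k = 0) \<and>
        b S = (\<Sum>k\<in>monomials E (Pow S). scale (c k) (mono_val k))" by blast
    from bchoice[OF this] obtain c where c0: "\<And>S k. S \<in> P \<Longrightarrow> \<not> fst k \<subseteq> S \<Longrightarrow> c S k = 0"
      and bS: "\<And>S. S \<in> P \<Longrightarrow> b S = (\<Sum>k\<in>monomials E (Pow S). scale (c S k) (mono_val k))" by blast
    \<comment> \<open>The total coefficient of a monomial. The range of the sum is finite, as the support is nonempty.\<close>
    define \<gamma> where "\<gamma> k = (\<Sum>S | S \<in> P \<and> fst k \<subseteq> S. c S k)" for k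
    define \<alpha> where "\<alpha> x = \<gamma> (the_inv_into ?K ?\<phi> x)" for x
    have \<alpha>: "\<alpha> (?\<phi> k) = \<gamma> k" if "k \<in> ?K" for k
      unfolding \<alpha>_def by (simp add: the_inv_into_f_f[OF inj that])
    show "\<exists>\<alpha>. operator_sums B (?\<phi> ` ?K) (\<lambda>e. \<lambda>x\<in>carrier B. \<alpha> e \<odot>\<^bsub>B\<^esub> ad B e x) d"
    proof (intro exI[of _ \<alpha>], subst opsum, intro conjI ballI ext)
      fix r assume "r \<in> Msp"
      then obtain V where V: "fin V" "r \<in> M V" by (rule MspE)
      let ?PV = "{T \<in> P. T \<inter> V \<noteq> {}}"
      have finPV: "finite ?PV" by (rule sparse_meet_finite[OF P V(1)])
      show "finite {k \<in> ?K. scale (\<alpha> (?\<phi> k)) (commut (mono_val k) r) \<noteq> 0}"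
        by (rule finite_subset[OF sub[OF V] meet[OF V(1)]])
      have comm_b: "commut (b S) r = (\<Sum>k\<in>monomials E ?PV. scale (c S k) (commut (mono_val k) r))"
        if S: "S \<in> ?PV" for S
      proof -
        have SP: "S \<in> P" using S by simp
        have "commut (b S) r = (\<Sum>k\<in>monomials E (Pow S). scale (c S k) (commut (mono_val k) r))"
          unfolding bS[OF SP] by (rule commut_linear)
        also have "\<dots> = (\<Sum>k\<in>monomials E ?PV. scale (c S k) (commut (mono_val k) r))"
        proof (rule sum.mono_neutral_cong)
          show "finite (monomials E (Pow S))"
            using finP[OF SP] ET[OF SP] by (intro finite_monomials) (auto intro: finite_subset)
          show "finite (monomials E ?PV)" by (rule meet[OF V(1)])
          show "scale (c S k) (commut (mono_val k) r) = 0" if "k \<in> monomials E ?PV - monomials E (Pow S)" for k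
            using that c0[OF SP, of k] by (auto simp: monomials_iff)
          show "scale (c S k) (commut (mono_val k) r) = 0" if k: "k \<in> monomials E (Pow S) - monomials E ?PV" for k
          proof (cases "fst k = {}")
            case True
            then show ?thesis by (simp add: mono_val_def tau_empty commut_def)
          next
            case False
            have "fst k \<subseteq> S" using k by (simp add: monomials_iff)
            then have "fst k \<in> P" using False P SP unfolding sparse_system_def by blast
            then have "k \<in> ?K" "fst k \<inter> V = {}" using k by (auto simp: monomials_iff)
            then show ?thesis using van[OF V] by simp
          qed
        qed simp
        finally show ?thesis .
      qed
      have \<gamma>: "\<gamma> k = (\<Sum>S\<in>?PV. c S k)" if k: "k \<in> monomials E ?PV" for k
        unfolding \<gamma>_def
        by (rule sum.mono_neutral_left[OF finPV]) (use k c0 in \<open>auto simp: monomials_iff\<close>)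
      have "(\<Sum>k | k \<in> ?K \<and> scale (\<alpha> (?\<phi> k)) (commut (mono_val k) r) \<noteq> 0.
           scale (\<alpha> (?\<phi> k)) (commut (mono_val k) r))
         = (\<Sum>k\<in>monomials E ?PV. scale (\<alpha> (?\<phi> k)) (commut (mono_val k) r))"
        by (rule supp_sum[OF V])
      also have "\<dots> = (\<Sum>k\<in>monomials E ?PV. \<Sum>S\<in>?PV. scale (c S k) (commut (mono_val k) r))"
        by (intro sum.cong refl) (simp add: \<alpha> \<gamma> rfmat.scale_sum_left monomials_iff)
      also have "\<dots> = (\<Sum>S\<in>?PV. commut (b S) r)"
        by (subst sum.swap) (simp add: comm_b)
      finally show "d (cls r) = cls (\<Sum>k | k \<in> ?K \<and> scale (\<alpha> (?\<phi> k)) (commut (mono_val k) r) \<noteq> 0.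
           scale (\<alpha> (?\<phi> k)) (commut (mono_val k) r))"
        using rep V by (simp add: represents_sum_def)
    qed
  next
    fix \<alpha> x
    assume "operator_sums B (?\<phi> ` ?K) (\<lambda>e. \<lambda>x\<in>carrier B. \<alpha> e \<odot>\<^bsub>B\<^esub> ad B e x) (\<lambda>x\<in>carrier B. \<zero>\<^bsub>B\<^esub>)"
    then have zero: "cls 0 = cls (\<Sum>k | k \<in> ?K \<and> scale (\<alpha> (?\<phi> k)) (commut (mono_val k) r) \<noteq> 0.
           scale (\<alpha> (?\<phi> k)) (commut (mono_val k) r))" if "r \<in> Msp" for r
      unfolding opsum using that by (auto simp: cls_carrier B_zero)
    assume "x \<in> ?\<phi> ` ?K"
    then obtain k0 where k0: "k0 \<in> ?K" "x = ?\<phi> k0" by blast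
    then obtain i where i: "i \<in> fst k0" "i \<in> I"
      using P by (fastforce simp: monomials_iff sparse_system_def)
    let ?PV = "{T \<in> P. T \<inter> {i} \<noteq> {}}"
    define b where "b = (\<Sum>k\<in>monomials E ?PV. scale (\<alpha> (?\<phi> k)) (mono_val k))"
    define U where "U = \<Union>?PV"
    have U: "fin U"
      unfolding U_def using sparse_meet_finite[OF P, of "{i}"] finP i(2) by auto
    have kK: "k \<in> ?K" "fst k \<subseteq> U" if "k \<in> monomials E ?PV" for k
      using that unfolding U_def monomials_iff by auto
    have bU: "b \<in> M U"
      unfolding b_def using M_mono[OF U kK(2)] kM[OF kK(1)] by (intro M_sum M_scale) blast
    have "b * e i w = e i w * b" for w
    proof -
      have V: "fin {i}" "e i w \<in> M {i}" using i e_M by auto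
      have "commut b (e i w) = (\<Sum>k | k \<in> ?K \<and> scale (\<alpha> (?\<phi> k)) (commut (mono_val k) (e i w)) \<noteq> 0.
           scale (\<alpha> (?\<phi> k)) (commut (mono_val k) (e i w)))"
        unfolding b_def commut_linear supp_sum[OF V] ..
      also have "\<dots> = 0"
        using zero[OF e_Msp[OF i(2)]] by (subst (asm) cls_eq_iff)
          (auto intro!: Msp_zero Msp_sum Msp_scale commut_Msp kMsp e_Msp i(2))
      finally show ?thesis by (simp add: commut_def)
    qed
    then have bUi: "b \<in> M (U - {i})" by (intro centralizer_M[OF U bU i(2)])
    have k0PV: "k0 \<in> monomials E ?PV" using k0(1) i(1) by (auto simp: monomials_iff)
    obtain D where D1: "\<forall>k. fst k \<subseteq> U \<longrightarrow> k \<in> ?K \<longrightarrow>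
        tensor_functional U D (mono_val k) = (if k = k0 then 1 else 0)"
      and D2: "\<forall>i r. i \<in> fst k0 \<longrightarrow> r \<in> M (U - {i}) \<longrightarrow> tensor_functional U D r = 0"
      using dual[OF U k0(1) kK(2)[OF k0PV]] by blast
    have "0 = tensor_functional U D b" using D2 i(1) bUi by simp
    also have "\<dots> = (\<Sum>k\<in>monomials E ?PV. if k = k0 then \<alpha> (?\<phi> k) else 0)"
      unfolding b_def tensor_functional_sum using D1 kK by (intro sum.cong refl) auto
    also have "\<dots> = \<alpha> x" using k0PV meet[of "{i}"] i(2) k0(2) by simp
    finally show "\<alpha> x = 0" by simp
  qed
qed

lemma finite_tensor_basis:
  assumes "fin S" "\<And>i. i \<in> S \<Longrightarrow> unit_complement_basis i (E i)"
  shows "finite (tensor_basis A I E S)"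
proof -
  have "tensor_basis A I E S = (\<lambda>p. cls (tau S p)) ` (\<Pi>\<^sub>E i\<in>S. E i)"
    using assms by (intro tensor_basis_cls) (auto simp: unit_complement_basis_def)
  moreover have "finite (\<Pi>\<^sub>E i\<in>S. E i)"
    using assms by (intro finite_PiE) (auto intro!: unit_complement_basis_finite)
  ultimately show ?thesis by simp
qed

end

lemma matrix_factors_exist:
  fixes A :: "'i \<Rightarrow> ('f::field, 'a) module"
  assumes "\<And>i. i \<in> I \<Longrightarrow> matrix_algebra (A i)"
  shows "\<exists>n h. matrix_factors I A n h"
proof -
  let ?C = "\<lambda>i p. fst p \<ge> 1 \<and> snd p \<in> ring_iso (A i) (module_mat TYPE('f) (fst p) (fst p)) \<and>
     (\<forall>c. \<forall>x\<in>carrier (A i). snd p (c \<odot>\<^bsub>A i\<^esub> x) = c \<odot>\<^bsub>module_mat TYPE('f) (fst p) (fst p)\<^esub> snd p x)"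
  have "\<forall>i\<in>I. \<exists>p. ?C i p"
    using assms unfolding matrix_algebra_def by fastforce
  from bchoice[OF this] obtain p where p: "\<forall>i\<in>I. ?C i (p i)" ..
  have "matrix_factors I A (\<lambda>i. fst (p i)) (\<lambda>i. snd (p i))"
  proof (rule matrix_factors.intro)
    fix i assume i: "i \<in> I"
    show "unital_algebra class_ring (A i)" using assms[OF i] by (simp add: matrix_algebra_def)
    show "0 < fst (p i)" "snd (p i) \<in> ring_iso (A i) (module_mat TYPE('f) (fst (p i)) (fst (p i)))"
      using p i by auto
    show "snd (p i) (c \<odot>\<^bsub>A i\<^esub> a) = c \<cdot>\<^sub>m snd (p i) a" if "a \<in> carrier (A i)" for a c
      using p i that by (simp add: module_mat_simps)
  qed
  then show ?thesis by blast
qed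

theorem theorem2:
  fixes I :: "'i set" and A :: "'i \<Rightarrow> ('f::field, 'a) module"
  assumes "infinite I"
    and "\<And>i. i \<in> I \<Longrightarrow> matrix_algebra (A i)"
  shows "(countable I \<longrightarrow>
            Der (inf_tensor A I) = (\<Union>P\<in>{P. sparse_system I P}. sparse_derivations A I P)) \<and>
         (\<forall>P A0 E. sparse_system I P \<longrightarrow>
            (\<forall>i\<in>I. direct_sum_decomp (A i) (range (\<lambda>c. c \<odot>\<^bsub>A i\<^esub> \<one>\<^bsub>A i\<^esub>)) (A0 i) \<and>
                   vectorspace.basis class_ring (A i\<lparr>carrier := A0 i\<rparr>) (E i)) \<longrightarrow>
            (\<forall>S\<in>P. finite (ad (inf_tensor A I) ` tensor_basis A I E S)) \<and>
            topological_basis_ad (inf_tensor A I) (\<Union>S\<in>P. tensor_basis A I E S)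
              (sparse_derivations A I P))"
proof -
  have "\<exists>n h. matrix_factors I A n h" by (rule matrix_factors_exist) (rule assms(2))
  then obtain n h where "matrix_factors I A n h" by blast
  then interpret matrix_factors I A n h .
  show ?thesis
  proof (intro conjI impI allI)
    assume "countable I"
    then show "Der (inf_tensor A I) = (\<Union>P\<in>{P. sparse_system I P}. sparse_derivations A I P)"
      using Der_sparse[OF _ assms(1)] sparse_derivations_Der by fast
  next
    fix P A0 E
    assume P: "sparse_system I P"
      and E: "\<forall>i\<in>I. direct_sum_decomp (A i) (range (\<lambda>c. c \<odot>\<^bsub>A i\<^esub> \<one>\<^bsub>A i\<^esub>)) (A0 i) \<and>
                   vectorspace.basis class_ring (A i\<lparr>carrier := A0 i\<rparr>) (E i)"
    have basis: "unit_complement_basis i (E i)" if "i \<in> I" for i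
      by (rule unit_complement_basisI[of i "A0 i"]) (use E that in auto)
    show "\<forall>S\<in>P. finite (ad (inf_tensor A I) ` tensor_basis A I E S)"
    proof
      fix S assume "S \<in> P"
      then have S: "fin S" by (rule sparse_fin[OF P])
      then have "unit_complement_basis i (E i)" if "i \<in> S" for i using that basis by blast
      with S show "finite (ad (inf_tensor A I) ` tensor_basis A I E S)"
        by (intro finite_imageI finite_tensor_basis)
    qed
    show "topological_basis_ad (inf_tensor A I) (\<Union>S\<in>P. tensor_basis A I E S)
              (sparse_derivations A I P)"
      by (rule topological_basis[OF P basis])
  qed
qed

end
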